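(* There exist a parameterized smooth expanding on average cocycle $\mathbf T:\Omega\to C^r(I\times\mathbb S^1,\mathbb S^1)$ over some $(\Omega,\mathcal F,\mathbb P,\sigma)$ and an observable $\psi\in C^\infty(\mathbb S^1)$ such that quenched linear response holds but annealed linear response fails, in the following sense. For $\epsilon\in I$ let $(h_{\omega,\epsilon})_{\omega\in\Omega}\subset W^{1,1}$ be the unique measurable family with $h_{\omega,\epsilon}\ge0$, $\int_{\mathbb S^1}h_{\omega,\epsilon}\,dm=1$ and $\mathcal L_{\omega,\epsilon}h_{\omega,\epsilon}=h_{\sigma\omega,\epsilon}$ for $\mathbb P$-a.e. $\omega$. Then there is a measurable family $(\hat h_\omega)_{\omega\in\Omega}\subset W^{1,1}$ such that for every sequence $(\epsilon_k)_{k\in\mathbb N}$ in $I\setminus\{0\}$ with $\epsilon_k\to0$ there exist $s>0$ and $K\in\mathcal K$ with $$\Big\|\frac1{\epsilon_k}(h_{\omega,\epsilon_k}-h_{\omega,0})-\hat h_\omega\Big\|_{W^{1,1}}\le K(\omega)|\epsilon_k|^s\quad\text{for }\mathbb P\text{-a.e. }\omega\in\Omega\text{ and all }k\in\mathbb N$$ (in particular $\int_{\mathbb S^1}\psi\hat h_\omega\,dm$ is well defined for $\mathbb P$-a.e. $\omega$), while $$\int_\Omega\int_{\mathbb S^1}\psi\,\hat h_\omega\,dm\,d\mathbb P(\omega)=+\infty.$$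
   Context: $\mathbb S^1$ is the unit circle with Lebesgue measure $m$. $W^{1,1}=W^{1,1}(\mathbb S^1)$ is the Sobolev space with norm $\|f\|_{W^{1,1}}=\|f\|_{L^1}+\|f'\|_{L^1}$. Parameterized smooth expanding on average cocycle: $(\Omega,\mathcal F,\mathbb P)$ is a probability space with $\Omega$ a Borel subset of a separable complete metric space; $\sigma:\Omega\to\Omega$ is a homeomorphism preserving $\mathbb P$, and $\mathbb P$ is ergodic; $I\subset(-1,1)$ is an interval containing $0$; $r\in\mathbb N$, $r\ge4$; $\mathbf T:\Omega\to C^r(I\times\mathbb S^1,\mathbb S^1)$ is measurable, and with $T_{\omega,\epsilon}:=\mathbf T(\omega)(\epsilon,\cdot)$: (a) there is a log-integrable random variable $K:\Omega\to(0,\infty)$ (i.e. $\log K\in L^1(\mathbb P)$) such that for $\epsilon\in I$ and $\mathbb P$-a.e. $\omega$, $\|T_{\omega,\epsilon}\|_{C^r}\le K(\omega)$ and $\|\partial^i_\epsilon T_{\omega,\epsilon}\|_{C^{r-i}}\le K(\omega)$ for $i\in\{1,2\}$; (b) for each $\epsilon\in I$, $\omega\mapsto\lambda_{\omega,\epsilon}:=\min|T'_{\omega,\epsilon}|$ and $\omega\mapsto\int_{\mathbb S^1}\frac{|T''_{\omega,\epsilon}|}{(T'_{\omega,\epsilon})^2}dm$ are measurable; (c) there is a random variable $\underline\lambda:\Omega\to(0,\infty)$ such that for any $\epsilon\in I$, $\lambda_{\omega,\epsilon}\ge\underline\lambda(\omega)$ for $\mathbb P$-a.e. $\omega$, and $\int_\Omega\log\underline\lambda\,d\mathbb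 P>0$. $\mathcal L_{\omega,\epsilon}$ is the transfer operator of $T_{\omega,\epsilon}$ with respect to $m$: $\int(\mathcal L_{\omega,\epsilon}f)\varphi\,dm=\int f\cdot\varphi\circ T_{\omega,\epsilon}\,dm$. For such cocycles the unique family $(h_{\omega,\epsilon})$ in the claim is known to exist for every $\epsilon\in I$. A random variable $K:\Omega\to(0,\infty)$ is tempered if $\lim_{n\to\pm\infty}\frac1n\log K(\sigma^n\omega)=0$ for $\mathbb P$-a.e. $\omega$; $\mathcal K$ is the set of tempered random variables. Annealed linear response for the observable $\psi$ would require the double integral $\int_\Omega\int_{\mathbb S^1}\psi\hat h_\omega\,dm\,d\mathbb P$ to be well defined and finite. *)

theory Defs
  imports "HOL-Probability.Probability"
begin

section \<open>The circle and function spaces on it\<close>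

abbreviation circle :: "complex set" where
  "circle \<equiv> sphere 0 1"

text \<open>
  Functions on the circle are total functions on \<^typ>\<open>complex\<close>; no notion below depends on
  their values off the circle.
  The Lebesgue measure is arc length. Passing to the normalised measure rescales densities by
  a constant and does not affect any statement made with these notions.
\<close>

definition circle_measure :: "complex measure" where
  "circle_measure =
     distr (restrict_space lborel {0..<2 * pi}) (restrict_space borel circle) cis"

definition circle_deriv :: "(complex \<Rightarrow> 'b::real_normed_vector) \<Rightarrow> complex \<Rightarrow> 'b" where
  "circle_deriv f z = vector_derivative (\<lambda>t. f (z * cis t)) (at 0)"

definition smooth_on_circle :: "(complex \<Rightarrow> real) \<Rightarrow> bool" where
  "smooth_on_circle f \<longleftrightarrow>
     (\<forall>n. \<forall>z\<in>circle. (\<lambda>t. (circle_deriv ^^ n) f (z * cis t)) differentiable (at 0))"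

definition circle_C_norm :: "nat \<Rightarrow> (complex \<Rightarrow> 'b::real_normed_vector) \<Rightarrow> real" where
  "circle_C_norm k f = (SUP (j, z)\<in>{..k} \<times> circle. norm ((circle_deriv ^^ j) f z))"

text \<open>
  If a lift of a circle map has angular speed \<open>c\<close> at \<open>z\<close>, then
  \<open>circle_deriv g z = \<i> * c * g z\<close>. The following is this real number \<open>c\<close>, i.e. the
  derivative of any lift; the second derivative of \<open>g\<close> is \<open>circle_deriv (circle_map_deriv g)\<close>.
\<close>

definition circle_map_deriv :: "(complex \<Rightarrow> complex) \<Rightarrow> complex \<Rightarrow> real" where
  "circle_map_deriv g z = Im (circle_deriv g z / g z)"

definition is_weak_deriv :: "(complex \<Rightarrow> real) \<Rightarrow> (complex \<Rightarrow> real) \<Rightarrow> bool" where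
  "is_weak_deriv f g \<longleftrightarrow> integrable circle_measure g \<and>
     (\<forall>\<phi>. smooth_on_circle \<phi> \<longrightarrow>
        (\<integral>z. f z * circle_deriv \<phi> z \<partial>circle_measure) = - (\<integral>z. g z * \<phi> z \<partial>circle_measure))"

definition W11 :: "(complex \<Rightarrow> real) set" where
  "W11 = {f. integrable circle_measure f \<and> (\<exists>g. is_weak_deriv f g)}"

definition weak_deriv :: "(complex \<Rightarrow> real) \<Rightarrow> complex \<Rightarrow> real" where
  "weak_deriv f = (SOME g. is_weak_deriv f g)"

definition W11_norm :: "(complex \<Rightarrow> real) \<Rightarrow> real" where
  "W11_norm f = (\<integral>z. \<bar>f z\<bar> \<partial>circle_measure) + (\<integral>z. \<bar>weak_deriv f z\<bar> \<partial>circle_measure)"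

text \<open>
  The Borel sigma-algebra of the norm topology. Elements are representatives rather than
  classes modulo null sets; open sets are unions of classes.
\<close>

definition W11_borel :: "(complex \<Rightarrow> real) measure" where
  "W11_borel = sigma W11
     {U. U \<subseteq> W11 \<and>
         (\<forall>f\<in>U. \<exists>e>0. \<forall>g\<in>W11. W11_norm (\<lambda>z. g z - f z) < e \<longrightarrow> g \<in> U)}"


section \<open>The space of \<open>C\<^sup>r\<close> maps from \<open>I \<times> circle\<close> to the circle\<close>

text \<open>Nondegeneracy is needed for derivatives in the parameter to make sense.\<close>

definition param_interval :: "real set \<Rightarrow> bool" where
  "param_interval I \<longleftrightarrow> is_interval I \<and> I \<subseteq> {-1<..<1} \<and> 0 \<in> I \<and> I \<noteq> {0}"

definition param_deriv ::
  "real set \<Rightarrow> (real \<Rightarrow> complex \<Rightarrow> complex) \<Rightarrow> real \<Rightarrow> complex \<Rightarrow> complex" where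
  "param_deriv I F \<epsilon> z = vector_derivative (\<lambda>e. F e z) (at \<epsilon> within I)"

definition angle_deriv ::
  "(real \<Rightarrow> complex \<Rightarrow> complex) \<Rightarrow> real \<Rightarrow> complex \<Rightarrow> complex" where
  "angle_deriv F \<epsilon> = circle_deriv (F \<epsilon>)"

primrec C_k_on :: "nat \<Rightarrow> real set \<Rightarrow> (real \<Rightarrow> complex \<Rightarrow> complex) \<Rightarrow> bool" where
  "C_k_on 0 I F \<longleftrightarrow> continuous_on (I \<times> circle) (\<lambda>(\<epsilon>, z). F \<epsilon> z)"
| "C_k_on (Suc k) I F \<longleftrightarrow>
     continuous_on (I \<times> circle) (\<lambda>(\<epsilon>, z). F \<epsilon> z) \<and>
     (\<forall>\<epsilon>\<in>I. \<forall>z\<in>circle. (\<lambda>e. F e z) differentiable (at \<epsilon> within I) \<and>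
                        (\<lambda>t. F \<epsilon> (z * cis t)) differentiable (at 0)) \<and>
     C_k_on k I (param_deriv I F) \<and> C_k_on k I (angle_deriv F)"

definition C_maps :: "nat \<Rightarrow> real set \<Rightarrow> (real \<Rightarrow> complex \<Rightarrow> complex) set" where
  "C_maps r I = {F. C_k_on r I F \<and> (\<forall>\<epsilon>\<in>I. \<forall>z\<in>circle. F \<epsilon> z \<in> circle)}"

text \<open>
  The Borel sigma-algebra of the usual \<open>C\<^sup>r\<close> topology: uniform convergence of all derivatives
  up to order \<open>r\<close> on compact subsets of \<open>I \<times> circle\<close>.
\<close>

definition C_maps_borel :: "nat \<Rightarrow> real set \<Rightarrow> (real \<Rightarrow> complex \<Rightarrow> complex) measure" where
  "C_maps_borel r I = sigma (C_maps r I)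
     {U. U \<subseteq> C_maps r I \<and>
         (\<forall>F\<in>U. \<exists>J e. compact J \<and> J \<subseteq> I \<and> e > 0 \<and>
            (\<forall>G\<in>C_maps r I.
               (\<forall>i j. i + j \<le> r \<longrightarrow> (\<forall>\<epsilon>\<in>J. \<forall>z\<in>circle.
                  dist ((param_deriv I ^^ i) ((angle_deriv ^^ j) G) \<epsilon> z)
                       ((param_deriv I ^^ i) ((angle_deriv ^^ j) F) \<epsilon> z) < e)) \<longrightarrow> G \<in> U))}"


section \<open>Cocycles\<close>

text \<open>
  Only the topology of the ambient separable complete metric space matters. A type such as
  \<^typ>\<open>int \<Rightarrow> real\<close> with the product topology is universal: every Borel subset of a Polish space
  is homeomorphic to a Borel subset of it.
\<close>

definition driving_system ::
  "'a::polish_space set \<Rightarrow> 'a measure \<Rightarrow> ('a \<Rightarrow> 'a) \<Rightarrow> bool" where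
  "driving_system \<Omega> P \<sigma> \<longleftrightarrow>
     \<Omega> \<in> sets borel \<and> space P = \<Omega> \<and> sets P = sets (restrict_space borel \<Omega>) \<and> prob_space P \<and>
     homeomorphism \<Omega> \<Omega> \<sigma> (inv_into \<Omega> \<sigma>) \<and>
     distr P P \<sigma> = P \<and>
     (\<forall>A\<in>sets P. \<sigma> -` A \<inter> space P = A \<longrightarrow> measure P A = 0 \<or> measure P A = 1)"

definition positive_rv :: "'a measure \<Rightarrow> ('a \<Rightarrow> real) \<Rightarrow> bool" where
  "positive_rv P K \<longleftrightarrow> K \<in> borel_measurable P \<and> (\<forall>\<omega>\<in>space P. K \<omega> > 0)"

definition min_expansion :: "(complex \<Rightarrow> complex) \<Rightarrow> real" where
  "min_expansion g = (INF z\<in>circle. \<bar>circle_map_deriv g z\<bar>)"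

definition distortion :: "(complex \<Rightarrow> complex) \<Rightarrow> ennreal" where
  "distortion g = (\<integral>\<^sup>+z. ennreal \<bar>circle_deriv (circle_map_deriv g) z\<bar> /
                          ennreal ((circle_map_deriv g z)\<^sup>2) \<partial>circle_measure)"

text \<open>
  The \<open>C\<^sup>k\<close> norms of \<open>T\<close> and of its parameter derivatives are those of \<open>\<complex>\<close>-valued functions.
  Measuring derivatives of a lift instead changes them at most polynomially, which is
  immaterial for the existence of a log-integrable bound.
\<close>

definition expanding_on_average_cocycle ::
  "'a::polish_space set \<Rightarrow> 'a measure \<Rightarrow> ('a \<Rightarrow> 'a) \<Rightarrow> real set \<Rightarrow> nat \<Rightarrow>
   ('a \<Rightarrow> real \<Rightarrow> complex \<Rightarrow> complex) \<Rightarrow> bool" where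
  "expanding_on_average_cocycle \<Omega> P \<sigma> I r T \<longleftrightarrow>
     driving_system \<Omega> P \<sigma> \<and> param_interval I \<and> 4 \<le> r \<and>
     T \<in> P \<rightarrow>\<^sub>M C_maps_borel r I \<and>
     (\<exists>K. positive_rv P K \<and> integrable P (\<lambda>\<omega>. ln (K \<omega>)) \<and>
        (\<forall>\<epsilon>\<in>I. AE \<omega> in P. circle_C_norm r (T \<omega> \<epsilon>) \<le> K \<omega> \<and>
           (\<forall>i\<in>{1, 2}. circle_C_norm (r - i) ((param_deriv I ^^ i) (T \<omega>) \<epsilon>) \<le> K \<omega>))) \<and>
     (\<forall>\<epsilon>\<in>I. (\<lambda>\<omega>. min_expansion (T \<omega> \<epsilon>)) \<in> borel_measurable P \<and>
             (\<lambda>\<omega>. distortion (T \<omega> \<epsilon>)) \<in> borel_measurable P) \<and>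
     (\<exists>\<Lambda>. positive_rv P \<Lambda> \<and> (\<forall>\<epsilon>\<in>I. AE \<omega> in P. min_expansion (T \<omega> \<epsilon>) \<ge> \<Lambda> \<omega>) \<and>
        integrable P (\<lambda>\<omega>. ln (\<Lambda> \<omega>)) \<and> (\<integral>\<omega>. ln (\<Lambda> \<omega>) \<partial>P) > 0)"

definition tempered :: "'a measure \<Rightarrow> ('a \<Rightarrow> 'a) \<Rightarrow> ('a \<Rightarrow> real) \<Rightarrow> bool" where
  "tempered P \<sigma> K \<longleftrightarrow> positive_rv P K \<and>
     (AE \<omega> in P.
        (\<lambda>n. 1 / real n * ln (K ((\<sigma> ^^ n) \<omega>))) \<longlonglongrightarrow> 0 \<and>
        (\<lambda>n. 1 / (- real n) * ln (K ((inv_into (space P) \<sigma> ^^ n) \<omega>))) \<longlonglongrightarrow> 0)"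

text \<open>\<open>u\<close> is a version of the image of \<open>f\<close> under the transfer operator of \<open>g\<close>.\<close>

definition is_transfer ::
  "(complex \<Rightarrow> complex) \<Rightarrow> (complex \<Rightarrow> real) \<Rightarrow> (complex \<Rightarrow> real) \<Rightarrow> bool" where
  "is_transfer g f u \<longleftrightarrow> integrable circle_measure u \<and>
     (\<forall>\<phi>\<in>borel_measurable circle_measure. (\<exists>B. \<forall>z\<in>circle. \<bar>\<phi> z\<bar> \<le> B) \<longrightarrow>
        (\<integral>z. u z * \<phi> z \<partial>circle_measure) = (\<integral>z. f z * \<phi> (g z) \<partial>circle_measure))"

definition equivariant_density ::
  "'a measure \<Rightarrow> ('a \<Rightarrow> 'a) \<Rightarrow> ('a \<Rightarrow> complex \<Rightarrow> complex) \<Rightarrow> ('a \<Rightarrow> complex \<Rightarrow> real) \<Rightarrow> bool" where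
  "equivariant_density P \<sigma> S h \<longleftrightarrow> h \<in> P \<rightarrow>\<^sub>M W11_borel \<and>
     (AE \<omega> in P. (AE z in circle_measure. h \<omega> z \<ge> 0) \<and> (\<integral>z. h \<omega> z \<partial>circle_measure) = 1 \<and>
                 is_transfer (S \<omega>) (h \<omega>) (h (\<sigma> \<omega>)))"

definition unique_equivariant_density ::
  "'a measure \<Rightarrow> ('a \<Rightarrow> 'a) \<Rightarrow> ('a \<Rightarrow> complex \<Rightarrow> complex) \<Rightarrow> ('a \<Rightarrow> complex \<Rightarrow> real) \<Rightarrow> bool" where
  "unique_equivariant_density P \<sigma> S h \<longleftrightarrow> equivariant_density P \<sigma> S h \<and>
     (\<forall>h'. equivariant_density P \<sigma> S h' \<longrightarrow>
        (AE \<omega> in P. AE z in circle_measure. h' \<omega> z = h \<omega> z))"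

text \<open>
  The integral exists in the extended sense and equals \<open>+\<infinity>\<close>: the negative part has finite
  integral, the positive part does not. (The Bochner integral would be 0 here by convention.)
\<close>

definition integral_is_infinity :: "'a measure \<Rightarrow> ('a \<Rightarrow> real) \<Rightarrow> bool" where
  "integral_is_infinity M f \<longleftrightarrow> f \<in> borel_measurable M \<and>
     (\<integral>\<^sup>+x. ennreal (- f x) \<partial>M) < \<infinity> \<and> (\<integral>\<^sup>+x. ennreal (f x) \<partial>M) = \<infinity>"

end

theory Submission
  imports Defs "HOL-Complex_Analysis.Complex_Analysis" "HOL-Real_Asymp.Real_Asymp"
begin

text \<open>
  Random rotations of random, non-integrable speed produce the counterexample. Let \<open>S\<close> be an expanding
  circle map with a non-uniform smooth invariant density \<open>\<rho>\<close>, let the base be a Bernoulli shift, and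
  let \<open>a \<ge> 1\<close> be a function of one coordinate of \<open>\<omega>\<close> with \<open>log a\<close> integrable but \<open>a\<close> not. Put
  \<open>T\<^sub>\<omega>\<^sub>,\<^sub>\<epsilon> = R (\<epsilon> a(\<sigma> \<omega>)) \<circ> S \<circ> R (- \<epsilon> a(\<omega>))\<close>, where \<open>R t\<close> is the rotation by \<open>t\<close>. Rotations do not change
  the expansion, and a parameter derivative costs only a polynomial in the two amplitudes, which is
  log-integrable; so this is an expanding on average cocycle. Its equivariant density is the rotated
  density \<open>\<rho> \<circ> R (- \<epsilon> a(\<omega>))\<close>, and its derivative at \<open>\<epsilon> = 0\<close> is \<open>- a(\<omega>) \<rho>'\<close>. By Taylor's formula the
  error of the difference quotient is at most \<open>C a(\<omega>)\<^sup>2 \<bar>\<epsilon>\<bar>\<close> (\<open>response_estimate\<close>), and \<open>C a\<^sup>2\<close> is tempered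
  because \<open>log a\<close> grows sublinearly along orbits (\<open>tempered_exp_site\<close>). Tested against the coordinate
  function \<open>Im\<close> the response is a positive multiple of \<open>a\<close>, whose expectation is infinite
  (\<open>response_integral_infinite\<close>).

  To keep everything explicit, \<open>S\<close> is the conjugate of \<open>z \<mapsto> z ^ 10\<close> by an automorphism of the disc
  that moves 0 to 1/2. Then \<open>S\<close> extends holomorphically to the disc with fixed point 1/2, and the
  densities are Poisson kernels. Integrating a holomorphic function against a Poisson kernel
  evaluates it at the base point (\<open>poisson_integral\<close>), and finite measures on the circle are determined
  by their moments (\<open>finite_measures_on_circle_eqI\<close>). So the transfer operator identity reduces to the
  fact that the fibre maps send base points to base points (\<open>poisson_is_transfer\<close>). Uniqueness
  (\<open>density_family_unique\<close>) is a Fourier argument: in the coordinate that turns the fibre maps into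
  \<open>z \<mapsto> z ^ 10\<close>, the n-th coefficient at \<open>\<sigma> \<omega>\<close> is the 10 n-th coefficient at \<open>\<omega>\<close>; coefficients of \<open>W\<^sup>1\<^sup>,\<^sup>1\<close>
  functions tend to 0, and stationarity forces all coefficients with \<open>n > 0\<close> to vanish.
\<close>

section \<open>Finite measures on the circle\<close>

lemma space_circle_measure [simp]: "space circle_measure = circle"
  by (simp add: circle_measure_def)

lemma circle_in_sets [simp]: "circle \<in> sets (restrict_space borel circle)"
  using sets.top[of "restrict_space borel circle"] by (simp add: space_restrict_space)

lemma sets_circle_measure [measurable_cong]:
  "sets circle_measure = sets (restrict_space borel circle)"
  by (simp add: circle_measure_def)

lemma measurable_cis_circle:
  "cis \<in> restrict_space lborel {0..<2 * pi} \<rightarrow>\<^sub>M restrict_space borel circle"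
proof (rule measurable_restrict_space2)
  have "cis \<in> borel_measurable borel"
    by (intro borel_measurable_continuous_onI continuous_intros)
  then show "cis \<in> borel_measurable (restrict_space lborel {0..<2 * pi})"
    by (intro measurable_restrict_space1) simp
qed auto

lemma emeasure_circle: "emeasure circle_measure circle = ennreal (2 * pi)"
proof -
  have "emeasure circle_measure circle = emeasure lborel {0..<2*pi}"
    unfolding circle_measure_def
    by (subst emeasure_distr[OF measurable_cis_circle])
      (auto simp: space_restrict_space emeasure_restrict_space vimage_def intro!: arg_cong2[of _ _ _ _ emeasure])
  then show ?thesis by simp
qed

lemma finite_measure_circle: "finite_measure circle_measure"
  by (rule finite_measureI) (simp add: emeasure_circle)

interpretation circle_measure: finite_measure circle_measure
  by (rule finite_measure_circle)

lemma measure_circle: "measure circle_measure circle = 2 * pi"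
  by (simp add: measure_def emeasure_circle)

lemma borel_measurable_circle_iff:
  "f \<in> borel_measurable circle_measure \<longleftrightarrow> f \<in> borel_measurable (restrict_space borel circle)"
  by (simp add: measurable_def space_restrict_space sets_circle_measure)

lemma continuous_measurable_circle:
  fixes f :: "complex \<Rightarrow> 'b::topological_space"
  assumes "continuous_on circle f"
  shows "f \<in> borel_measurable circle_measure"
  unfolding borel_measurable_circle_iff using assms
  by (rule borel_measurable_continuous_on_restrict)

lemma continuous_bounded_circle:
  fixes f :: "complex \<Rightarrow> 'b::real_normed_vector"
  assumes "continuous_on circle f"
  obtains B where "B > 0" "\<And>z. z \<in> circle \<Longrightarrow> norm (f z) \<le> B"
proof -
  have "bounded (f ` circle)"
    by (intro compact_imp_bounded compact_continuous_image assms) simp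
  then show ?thesis using that unfolding bounded_pos by auto
qed

lemma integrable_continuous_finite_measure_on_circle:
  fixes f :: "complex \<Rightarrow> 'b::{banach, second_countable_topology}"
  assumes "finite_measure \<mu>" and [measurable_cong]: "sets \<mu> = sets circle_measure"
    and f: "continuous_on circle f"
  shows "integrable \<mu> f"
proof -
  interpret finite_measure \<mu> by fact
  have "space \<mu> = circle" using sets_eq_imp_space_eq[OF assms(2)] by simp
  moreover obtain B where "\<And>z. z \<in> circle \<Longrightarrow> norm (f z) \<le> B"
    using continuous_bounded_circle[OF f] by metis
  moreover have [measurable]: "f \<in> borel_measurable circle_measure"
    by (rule continuous_measurable_circle[OF f])
  ultimately show ?thesis
    by (intro integrable_const_bound[of _ B]) auto
qed

lemmas integrable_continuous_circle =
  integrable_continuous_finite_measure_on_circle[OF finite_measure_circle refl]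

lemma integrable_mult_continuous_circle:
  fixes v :: "complex \<Rightarrow> 'b::{real_normed_algebra, banach, second_countable_topology}"
  assumes f: "integrable circle_measure f" and v: "continuous_on circle v"
  shows "integrable circle_measure (\<lambda>z. f z * v z)"
proof -
  obtain B where B: "B > 0" "\<And>z. z \<in> circle \<Longrightarrow> norm (v z) \<le> B"
    using continuous_bounded_circle[OF v] by metis
  have [measurable]: "f \<in> borel_measurable circle_measure" "v \<in> borel_measurable circle_measure"
    using f v by (auto intro: continuous_measurable_circle)
  show ?thesis
  proof (rule Bochner_Integration.integrable_bound[OF integrable_mult_right[OF integrable_norm[OF f], of B]])
    show "AE z in circle_measure. norm (f z * v z) \<le> norm (B * norm (f z))"
    proof (rule AE_I2)
      fix z assume "z \<in> space circle_measure"
      then have "norm (f z * v z) \<le> norm (f z) * B"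
        using B by (intro order_trans[OF norm_mult_ineq] mult_left_mono) auto
      then show "norm (f z * v z) \<le> norm (B * norm (f z))" using B by (simp add: mult.commute)
    qed
  qed auto
qed

text \<open>
  The gauge integral is the form in which the fundamental theorem of calculus and Cauchy's
  formula are available.
\<close>

lemma integral_circle_eq_has_integral:
  fixes f :: "complex \<Rightarrow> 'b::euclidean_space"
  assumes f: "continuous_on circle f"
  shows "((\<lambda>t. f (cis t)) has_integral (\<integral>z. f z \<partial>circle_measure)) {0..2 * pi}"
proof -
  have meas: "f \<in> borel_measurable (restrict_space borel circle)"
    using continuous_measurable_circle[OF f] by (simp add: borel_measurable_circle_iff)
  have cont: "continuous_on {0..2*pi} (\<lambda>t. f (cis t))"
    by (rule continuous_on_compose2[OF f]) (auto intro!: continuous_intros)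
  have cis_meas: "(\<lambda>t. indicat_real {0..<2*pi} t *\<^sub>R f (cis t)) \<in> borel_measurable lborel"
    using measurable_compose[OF measurable_cis_circle meas]
    by (subst (asm) borel_measurable_restrict_space_iff) auto
  have int: "set_integrable lborel {0..2*pi} (\<lambda>t. f (cis t))"
    by (rule borel_integrable_atLeastAtMost') (use cont in auto)
  have "(\<integral>z. f z \<partial>circle_measure) = (\<integral>t. f (cis t) \<partial>restrict_space lborel {0..<2*pi})"
    unfolding circle_measure_def
    by (rule integral_distr[OF measurable_cis_circle meas])
  also have "\<dots> = (LINT t:{0..<2*pi}|lborel. f (cis t))"
    by (subst integral_restrict_space) (auto simp: set_lebesgue_integral_def)
  also have "\<dots> = (LINT t:{0..2*pi}|lborel. f (cis t))"
  proof (rule set_integral_cong_set)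
    have "AE t in lborel. t \<noteq> 2 * pi" by (rule AE_lborel_singleton)
    then show "AE t in lborel. (t \<in> {0..2*pi}) = (t \<in> {0..<2*pi})" by eventually_elim auto
  qed (use int cis_meas in \<open>auto simp: set_integrable_def set_borel_measurable_def\<close>)
  finally show ?thesis
    using set_borel_integral_eq_integral[OF int] by (simp add: has_integral_integral)
qed

lemma inverse_eq_cnj_on_circle: "z \<in> circle \<Longrightarrow> inverse z = cnj z"
  by (auto simp: inverse_complex_def cmod_def complex_eq_iff)

text \<open>
  By Stone-Weierstrass it is enough to compare integrals of real polynomials in the two
  coordinates. The class of continuous \<open>v\<close> for which \<open>v z\<^sup>m\<close> has equal integrals for all
  integers \<open>m\<close> contains the constants and is stable under multiplication by such polynomials,
  because a real linear function of \<open>z\<close> is a combination of \<open>z\<close> and \<open>1/z\<close> on the circle.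
\<close>

lemma finite_measures_on_circle_eqI:
  assumes fin: "finite_measure \<mu>" "finite_measure \<nu>"
    and [measurable_cong]: "sets \<mu> = sets circle_measure" "sets \<nu> = sets circle_measure"
    and moments: "\<And>n. (\<integral>z. z ^ n \<partial>\<mu>) = (\<integral>z. z ^ n \<partial>\<nu>)"
  shows "\<mu> = \<nu>"
proof -
  interpret \<mu>: finite_measure \<mu> by fact
  interpret \<nu>: finite_measure \<nu> by fact
  have sp: "space \<mu> = circle" "space \<nu> = circle"
    using assms(3,4)[THEN sets_eq_imp_space_eq] by auto
  note int = integrable_continuous_finite_measure_on_circle[OF fin(1) assms(3)]
    integrable_continuous_finite_measure_on_circle[OF fin(2) assms(4)]
  define same where "same v \<longleftrightarrow> continuous_on circle v \<and>
    (\<forall>m::int. (\<integral>z. v z * z powi m \<partial>\<mu>) = (\<integral>z. v z * z powi m \<partial>\<nu>))" for v :: "complex \<Rightarrow> complex"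
  have powi: "continuous_on circle (\<lambda>z::complex. z powi m)" for m
    by (intro continuous_intros) auto
  have same1: "same (\<lambda>z. 1)"
  proof -
    have "(\<integral>z. z powi m \<partial>\<mu>) = (\<integral>z. z powi m \<partial>\<nu>)" for m :: int
    proof (cases "m \<ge> 0")
      case True
      then show ?thesis using moments[of "nat m"] by (simp add: power_int_def)
    next
      case False
      have *: "z powi m = cnj (z ^ nat (- m))" if "z \<in> circle" for z
        using False inverse_eq_cnj_on_circle[OF that] by (simp add: power_int_def)
      have "(\<integral>z. z powi m \<partial>\<mu>) = (\<integral>z. cnj (z ^ nat (- m)) \<partial>\<mu>)"
        by (rule Bochner_Integration.integral_cong) (use * sp in auto)
      also have "\<dots> = (\<integral>z. cnj (z ^ nat (- m)) \<partial>\<nu>)"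
        by (simp only: Bochner_Integration.integral_cnj moments)
      also have "\<dots> = (\<integral>z. z powi m \<partial>\<nu>)"
        by (rule Bochner_Integration.integral_cong) (use * sp in auto)
      finally show ?thesis .
    qed
    then show ?thesis by (simp add: same_def)
  qed
  have poly: "same (\<lambda>z. v z * of_real (p z))" if "real_polynomial_function p" "same v" for p v
    using that
  proof (induction arbitrary: v)
    case (linear f)
    define \<alpha> where "\<alpha> = (of_real (f 1) - \<i> * of_real (f \<i>)) / 2"
    define \<beta> where "\<beta> = (of_real (f 1) + \<i> * of_real (f \<i>)) / 2"
    have v: "continuous_on circle v" using linear(2) by (simp add: same_def)
    have f: "of_real (f z) = \<alpha> * z + \<beta> * inverse z" if "z \<in> circle" for z
    proof -
      interpret f: bounded_linear f by fact
      have "z = Re z *\<^sub>R 1 + Im z *\<^sub>R \<i>" by (simp add: complex_eq_iff)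
      then have "f z = Re z * f 1 + Im z * f \<i>"
        by (metis f.add f.scaleR real_scaleR_def)
      then show ?thesis unfolding inverse_eq_cnj_on_circle[OF that]
        by (simp add: \<alpha>_def \<beta>_def complex_eq_iff algebra_simps flip: add_divide_distrib)
    qed
    have *: "v z * of_real (f z) * z powi m = \<alpha> * (v z * z powi (m + 1)) + \<beta> * (v z * z powi (m - 1))"
      if "z \<in> circle" for z m
    proof -
      have "z \<noteq> 0" using that by auto
      then show ?thesis
        by (simp add: f[OF that] power_int_add power_int_diff divide_inverse algebra_simps)
    qed
    have step: "(\<integral>z. v z * of_real (f z) * z powi m \<partial>M) =
        \<alpha> * (\<integral>z. v z * z powi (m + 1) \<partial>M) + \<beta> * (\<integral>z. v z * z powi (m - 1) \<partial>M)"
      if "M = \<mu> \<or> M = \<nu>" for M m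
    proof -
      have i: "integrable M (\<lambda>z. v z * z powi k)" for k
        using that int continuous_on_mult[OF v powi] by blast
      have "(\<integral>z. v z * of_real (f z) * z powi m \<partial>M) =
          (\<integral>z. \<alpha> * (v z * z powi (m + 1)) + \<beta> * (v z * z powi (m - 1)) \<partial>M)"
        by (rule Bochner_Integration.integral_cong) (use * sp that in auto)
      then show ?thesis using i by simp
    qed
    have eq: "(\<integral>z. v z * z powi k \<partial>\<mu>) = (\<integral>z. v z * z powi k \<partial>\<nu>)" for k
      using linear(2) by (simp add: same_def)
    have "(\<integral>z. v z * of_real (f z) * z powi m \<partial>\<mu>) = (\<integral>z. v z * of_real (f z) * z powi m \<partial>\<nu>)" for m
      by (simp only: step[OF disjI1[OF refl]] step[OF disjI2[OF refl]] eq)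
    moreover have "continuous_on circle (\<lambda>z. v z * of_real (f z))"
      by (intro continuous_on_mult v continuous_on_of_real linear_continuous_on linear(1))
    ultimately show ?case unfolding same_def by blast
  next
    case (const c)
    have "(\<integral>z. v z * of_real c * z powi m \<partial>M) = of_real c * (\<integral>z. v z * z powi m \<partial>M)" for M m
      by (subst integral_mult_right_zero[symmetric]) (simp add: mult_ac)
    then show ?case using const by (auto simp: same_def intro!: continuous_intros)
  next
    case (add p q)
    then have pq: "same (\<lambda>z. v z * of_real (p z))" "same (\<lambda>z. v z * of_real (q z))" by auto
    then have c: "continuous_on circle (\<lambda>z. v z * of_real (p z))"
      "continuous_on circle (\<lambda>z. v z * of_real (q z))" by (auto simp: same_def)
    have step: "(\<integral>z. v z * of_real (p z + q z) * z powi m \<partial>M) =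
        (\<integral>z. v z * of_real (p z) * z powi m \<partial>M) + (\<integral>z. v z * of_real (q z) * z powi m \<partial>M)"
      if "M = \<mu> \<or> M = \<nu>" for M m
    proof -
      have "integrable M (\<lambda>z. v z * of_real (p z) * z powi m)"
        "integrable M (\<lambda>z. v z * of_real (q z) * z powi m)"
        using that int continuous_on_mult[OF c(1) powi] continuous_on_mult[OF c(2) powi] by blast+
      then show ?thesis
        by (subst Bochner_Integration.integral_add[symmetric]) (auto simp: ring_distribs)
    qed
    have eq: "(\<integral>z. v z * of_real (p z) * z powi k \<partial>\<mu>) = (\<integral>z. v z * of_real (p z) * z powi k \<partial>\<nu>)"
      "(\<integral>z. v z * of_real (q z) * z powi k \<partial>\<mu>) = (\<integral>z. v z * of_real (q z) * z powi k \<partial>\<nu>)" for k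
      using pq by (simp_all add: same_def)
    have "(\<integral>z. v z * of_real (p z + q z) * z powi m \<partial>\<mu>) = (\<integral>z. v z * of_real (p z + q z) * z powi m \<partial>\<nu>)" for m
      by (simp only: step[OF disjI1[OF refl]] step[OF disjI2[OF refl]] eq)
    moreover have "continuous_on circle (\<lambda>z. v z * of_real (p z + q z))"
      using continuous_on_add[OF c] by (simp add: ring_distribs)
    ultimately show ?case unfolding same_def by blast
  next
    case (mult p q)
    then have "same (\<lambda>z. v z * of_real (p z) * of_real (q z))" by blast
    then show ?case by (simp add: mult.assoc)
  qed
  have polynomial: "(\<integral>z. p z \<partial>\<mu>) = (\<integral>z. p z \<partial>\<nu>)" if "real_polynomial_function p" for p
  proof -
    have "(\<integral>z. complex_of_real (p z) \<partial>\<mu>) = (\<integral>z. complex_of_real (p z) \<partial>\<nu>)"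
      using poly[OF that same1] by (auto simp: same_def dest!: spec[of _ 0])
    then show ?thesis by simp
  qed
  have cont: "(\<integral>z. f z \<partial>\<mu>) = (\<integral>z. f z \<partial>\<nu>)" if f: "continuous_on circle f" for f :: "complex \<Rightarrow> real"
  proof (rule ccontr)
    define D where "D = \<bar>(\<integral>z. f z \<partial>\<mu>) - (\<integral>z. f z \<partial>\<nu>)\<bar>"
    define B where "B = measure \<mu> circle + measure \<nu> circle + 1"
    assume "(\<integral>z. f z \<partial>\<mu>) \<noteq> (\<integral>z. f z \<partial>\<nu>)"
    then have "D > 0" by (simp add: D_def)
    have "B > 0" by (simp add: B_def add_nonneg_pos)
    with \<open>D > 0\<close> have "0 < D / B" by simp
    then obtain p where p: "real_polynomial_function p" "\<And>z. z \<in> circle \<Longrightarrow> \<bar>f z - p z\<bar> < D / B"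
      using Stone_Weierstrass_real_polynomial_function[OF _ f] by (metis compact_sphere)
    have pc: "continuous_on circle p"
      using p(1) by (simp add: continuous_on_polymonial_function real_polynomial_function_eq)
    have "\<bar>(\<integral>z. f z \<partial>M) - (\<integral>z. p z \<partial>M)\<bar> \<le> D / B * measure M circle" if M: "M = \<mu> \<or> M = \<nu>" for M
    proof -
      have i: "integrable M f" "integrable M p" "integrable M (\<lambda>z. D / B)"
        using M int f pc by auto
      have "\<bar>(\<integral>z. f z \<partial>M) - (\<integral>z. p z \<partial>M)\<bar> = \<bar>\<integral>z. f z - p z \<partial>M\<bar>"
        using i by simp
      also have "\<dots> \<le> (\<integral>z. \<bar>f z - p z\<bar> \<partial>M)" by (rule integral_abs_bound)
      also have "\<dots> \<le> (\<integral>z. D / B \<partial>M)"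
        by (rule integral_mono) (use i M sp in \<open>auto intro!: less_imp_le p(2)\<close>)
      finally show ?thesis using M sp by (auto simp: mult.commute)
    qed
    from this[of \<mu>] this[of \<nu>] polynomial[OF p(1)]
    have "D \<le> D / B * measure \<mu> circle + D / B * measure \<nu> circle" by (simp add: D_def)
    also have "\<dots> = D / B * (B - 1)" by (simp add: B_def ring_distribs)
    also have "\<dots> < D" using \<open>0 < D\<close> \<open>0 < B\<close> by (simp add: field_simps)
    finally show False by simp
  qed
  have closed: "measure \<mu> (C \<inter> circle) = measure \<nu> (C \<inter> circle)" if C: "closed C" "C \<noteq> {}" for C
  proof -
    \<comment> \<open>The indicator of a closed set is a decreasing limit of continuous functions.\<close>
    define f where "f n z = max 0 (1 - real n * infdist z C)" for n z
    have fc: "continuous_on circle (f n)" for n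
      unfolding f_def by (intro continuous_intros)
    have lim: "(\<lambda>n. f n z) \<longlonglongrightarrow> indicat_real (C \<inter> circle) z" if "z \<in> circle" for z
    proof (cases "z \<in> C")
      case True
      then show ?thesis using that by (simp add: f_def)
    next
      case False
      then have pos: "infdist z C > 0"
        using C in_closed_iff_infdist_zero[of C z] infdist_nonneg[of z C] by (simp add: less_le)
      obtain k where k: "1 / infdist z C < real k" using reals_Archimedean2 by blast
      have "f n z = 0" if "n \<ge> k" for n
      proof -
        have "1 / infdist z C < real n" using k that by linarith
        then show ?thesis using pos by (simp add: f_def field_simps)
      qed
      then have "eventually (\<lambda>n. f n z = 0) sequentially"
        unfolding eventually_sequentially by blast
      then show ?thesis using False by (simp add: tendsto_eventually)
    qed
    have "(\<lambda>n. \<integral>z. f n z \<partial>M) \<longlonglongrightarrow> measure M (C \<inter> circle)" if M: "M = \<mu> \<or> M = \<nu>" for M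
    proof -
      have setsM: "sets M = sets circle_measure" and spM: "space M = circle"
        using M assms(3,4) sp by auto
      have mem: "C \<inter> circle \<in> sets M"
        using C unfolding setsM sets_circle_measure sets_restrict_space
        by (auto simp: Int_commute)
      have "(\<lambda>n. \<integral>z. f n z \<partial>M) \<longlonglongrightarrow> (\<integral>z. indicat_real (C \<inter> circle) z \<partial>M)"
      proof (rule integral_dominated_convergence[where w = "\<lambda>_. 1"])
        show "f n \<in> borel_measurable M" for n
          using M int fc by (meson borel_measurable_integrable)
        show "AE z in M. norm (f n z) \<le> 1" for n
          by (auto simp: f_def max_def infdist_nonneg)
        show "integrable M (\<lambda>_. 1::real)"
          using M by auto
      qed (use lim mem spM in auto)
      then show ?thesis using mem spM by simp
    qed
    from this[of \<mu>] this[of \<nu>] show ?thesis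
      using cont[OF fc] LIMSEQ_unique by auto
  qed
  show ?thesis
  proof (rule measure_eqI_generator_eq[where E = "(\<lambda>C. C \<inter> circle) ` Collect closed" and \<Omega> = circle
        and A = "\<lambda>_. circle"])
    show "Int_stable ((\<lambda>C. C \<inter> circle) ` Collect closed)"
    proof (rule Int_stableI, safe)
      fix A B :: "complex set" assume "closed A" "closed B"
      then show "A \<inter> circle \<inter> (B \<inter> circle) \<in> (\<lambda>C. C \<inter> circle) ` Collect closed"
        by (intro image_eqI[of _ _ "A \<inter> B"]) auto
    qed
    have sig: "sets (restrict_space borel circle) = sigma_sets circle ((\<lambda>C. C \<inter> circle) ` Collect closed)"
    proof -
      have "sets (restrict_space borel circle) = (\<inter>) circle ` sigma_sets UNIV (Collect closed)"
        unfolding sets_restrict_space borel_eq_closed by (simp add: sets_measure_of)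
      also have "\<dots> = sigma_sets circle ((\<lambda>C. C \<inter> circle) ` Collect closed)"
        using restricted_sigma[of circle UNIV "Collect closed"]
        by (simp add: Int_commute image_def)
      finally show ?thesis .
    qed
    then show "sets \<mu> = sigma_sets circle ((\<lambda>C. C \<inter> circle) ` Collect closed)"
      "sets \<nu> = sigma_sets circle ((\<lambda>C. C \<inter> circle) ` Collect closed)"
      using assms(3,4) sets_circle_measure by auto
    show "emeasure \<mu> X = emeasure \<nu> X" if "X \<in> (\<lambda>C. C \<inter> circle) ` Collect closed" for X
      using that closed by (cases "X = {}") (auto simp: \<mu>.emeasure_eq_measure \<nu>.emeasure_eq_measure)
    show "range (\<lambda>_::nat. circle) \<subseteq> (\<lambda>C. C \<inter> circle) ` Collect closed"
      by (auto intro: image_eqI[of _ _ UNIV])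
  qed auto
qed

lemma finite_measure_circle_density:
  assumes w: "integrable circle_measure w" "AE z in circle_measure. 0 \<le> w z"
  shows "finite_measure (density circle_measure (\<lambda>z. ennreal (w z)))"
proof
  have [measurable]: "w \<in> borel_measurable circle_measure" using w by auto
  have "emeasure (density circle_measure (\<lambda>z. ennreal (w z))) (space circle_measure) =
      (\<integral>\<^sup>+z. ennreal (w z) \<partial>circle_measure)"
    by (subst emeasure_density) (auto intro!: nn_integral_cong simp del: space_circle_measure)
  also have "\<dots> \<noteq> \<infinity>" using w by (simp add: nn_integral_eq_integral)
  finally show "emeasure (density circle_measure (\<lambda>z. ennreal (w z)))
      (space (density circle_measure (\<lambda>z. ennreal (w z)))) \<noteq> \<infinity>" by simp
qed

abbreviation with_density :: "(complex \<Rightarrow> real) \<Rightarrow> complex measure" where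
  "with_density f \<equiv> density circle_measure (\<lambda>z. ennreal (f z))"

lemma integral_with_density:
  fixes Q :: "complex \<Rightarrow> 'b::{real_normed_algebra_1, banach, second_countable_topology}"
  assumes "integrable circle_measure f" "AE z in circle_measure. 0 \<le> f z"
    and "Q \<in> borel_measurable circle_measure"
  shows "(\<integral>z. Q z \<partial>with_density f) = (\<integral>z. of_real (f z) * Q z \<partial>circle_measure)"
  using assms by (subst integral_density) (auto simp: scaleR_conv_of_real)


section \<open>Derivatives along rotations and weak derivatives\<close>

text \<open>
  Each fibre map and each explicit density below is, on the circle, a bounded linear image of a function that is
  complex analytic near the circle. For such a function the derivative with respect to the angle
  is \<open>\<i> z Q'(z)\<close>, which is again analytic, so all iterated derivatives are at hand.
\<close>

definition rot_deriv :: "(complex \<Rightarrow> complex) \<Rightarrow> complex \<Rightarrow> complex" where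
  "rot_deriv Q z = \<i> * z * deriv Q z"

lemma analytic_rot_deriv [analytic_intros]: "Q analytic_on S \<Longrightarrow> rot_deriv Q analytic_on S"
  unfolding rot_deriv_def by (intro analytic_intros)

lemma analytic_rot_deriv_iter [analytic_intros]:
  "Q analytic_on S \<Longrightarrow> (rot_deriv ^^ n) Q analytic_on S"
  by (induction n) (auto intro!: analytic_intros)

lemma analytic_on_circle_continuous: "Q analytic_on S \<Longrightarrow> continuous_on S Q"
  by (simp add: analytic_imp_holomorphic holomorphic_on_imp_continuous_on)

lemma mult_cis_in_circle: "z \<in> circle \<Longrightarrow> z * cis t \<in> circle"
  by (simp add: norm_mult)

lemma DERIV_circle:
  "Q analytic_on circle \<Longrightarrow> z \<in> circle \<Longrightarrow> (Q has_field_derivative deriv Q z) (at z)"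
  using DERIV_deriv_iff_field_differentiable analytic_on_imp_differentiable_at by blast

lemma rot_deriv_eqI:
  "(Q has_field_derivative D) (at z) \<Longrightarrow> rot_deriv Q z = \<i> * z * D"
  by (simp add: rot_deriv_def DERIV_imp_deriv)

lemma has_vector_derivative_rotate:
  assumes Q: "Q analytic_on circle" and z: "z \<in> circle"
  shows "((\<lambda>t. Q (z * cis t)) has_vector_derivative rot_deriv Q (z * cis t)) (at t within A)"
proof -
  have "(cis has_vector_derivative \<i> * cis t) (at t)"
    unfolding has_vector_derivative_def using has_derivative_cis[OF has_derivative_ident, of t UNIV]
    by (simp add: o_def scaleR_conv_of_real mult_ac)
  then have "((\<lambda>t. z * cis t) has_vector_derivative z * (\<i> * cis t)) (at t)"
    by (intro has_vector_derivative_mult_right)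
  from field_vector_diff_chain_at[OF this DERIV_circle[OF Q mult_cis_in_circle[OF z]]]
  have "((\<lambda>t. Q (z * cis t)) has_vector_derivative rot_deriv Q (z * cis t)) (at t)"
    by (simp add: o_def rot_deriv_def mult_ac)
  then show ?thesis by (rule has_vector_derivative_at_within)
qed

text \<open>The map \<open>L\<close> is the identity for circle maps, and \<open>Re\<close> or \<open>Im\<close> for densities and test functions.\<close>

lemma circle_deriv_analytic:
  assumes L: "bounded_linear L" and Q: "Q analytic_on circle"
    and f: "\<And>z. z \<in> circle \<Longrightarrow> f z = L (Q z)" and z: "z \<in> circle"
  shows "circle_deriv f z = L (rot_deriv Q z)"
    and "(\<lambda>t. f (z * cis t)) differentiable (at 0)"
proof -
  have "((\<lambda>t. L (Q (z * cis t))) has_vector_derivative L (rot_deriv Q (z * cis 0))) (at 0)"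
    by (intro bounded_linear.has_vector_derivative[OF L] has_vector_derivative_rotate Q z)
  also have "(\<lambda>t. L (Q (z * cis t))) = (\<lambda>t. f (z * cis t))"
    using f mult_cis_in_circle[OF z] by auto
  finally have *: "((\<lambda>t. f (z * cis t)) has_vector_derivative L (rot_deriv Q z)) (at 0)" by simp
  show "circle_deriv f z = L (rot_deriv Q z)"
    unfolding circle_deriv_def using * by (rule vector_derivative_at)
  show "(\<lambda>t. f (z * cis t)) differentiable (at 0)"
    using * by (rule differentiableI_vector)
qed

lemma circle_deriv_iter_analytic:
  assumes L: "bounded_linear L" and Q: "Q analytic_on circle"
    and f: "\<And>z. z \<in> circle \<Longrightarrow> f z = L (Q z)" and z: "z \<in> circle"
  shows "(circle_deriv ^^ n) f z = L ((rot_deriv ^^ n) Q z)"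
  using z
proof (induction n arbitrary: z)
  case (Suc n)
  then show ?case
    using circle_deriv_analytic(1)[OF L analytic_rot_deriv_iter[OF Q] Suc.IH] by simp
qed (use f in simp)

lemma smooth_on_circle_analytic:
  assumes L: "bounded_linear L" and Q: "Q analytic_on circle"
  shows "smooth_on_circle (\<lambda>z. L (Q z))"
  unfolding smooth_on_circle_def
  using circle_deriv_analytic(2)[OF L analytic_rot_deriv_iter[OF Q] circle_deriv_iter_analytic[OF L Q refl]]
  by blast

text \<open>A point \<open>w\<close> near \<open>z\<close> is \<open>z\<close> rotated by \<open>Arg (w / z)\<close>, and \<open>Arg\<close> is continuous at 1.\<close>

lemma continuous_on_circleI:
  fixes f :: "complex \<Rightarrow> 'b::topological_space"
  assumes "\<And>z. z \<in> circle \<Longrightarrow> isCont (\<lambda>t. f (z * cis t)) 0"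
  shows "continuous_on circle f"
  unfolding continuous_on_eq_continuous_within
proof
  fix z :: complex assume z: "z \<in> circle"
  then have z0: "z \<noteq> 0" by auto
  have "isCont (\<lambda>w. Arg (w / z)) z"
    by (rule isCont_o2[OF _ continuous_at_Arg]) (use z0 in \<open>auto intro!: continuous_intros\<close>)
  then have "isCont (\<lambda>w. f (z * cis (Arg (w / z)))) z"
    by (rule isCont_o2) (use assms[OF z] z0 in \<open>simp add: Arg_eq_0\<close>)
  then have "continuous (at z within circle) (\<lambda>w. f (z * cis (Arg (w / z))))"
    by (rule continuous_at_imp_continuous_at_within)
  moreover have "f (z * cis (Arg (w / z))) = f w" if "w \<in> circle" for w
  proof -
    have "w / z = cis (Arg (w / z))"
      using that z z0 rcis_cmod_Arg[of "w / z"] by (simp add: rcis_def norm_divide)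
    then show ?thesis using z0 by (metis nonzero_mult_div_cancel_left times_divide_eq_right)
  qed
  ultimately show "continuous (at z within circle) f"
    using continuous_transform_within[of z circle "\<lambda>w. f (z * cis (Arg (w / z)))" 1 f] z by auto
qed

lemma smooth_on_circle_continuous:
  assumes "smooth_on_circle f"
  shows "continuous_on circle ((circle_deriv ^^ n) f)"
  using assms unfolding smooth_on_circle_def
  by (intro continuous_on_circleI differentiable_imp_continuous_within) auto

lemma smooth_on_circle_has_derivative:
  assumes "smooth_on_circle f"
  shows "((\<lambda>t. f (cis t)) has_real_derivative circle_deriv f (cis t)) (at t)"
proof -
  have "(\<lambda>s. f (cis t * cis s)) differentiable (at 0)"
    using assms unfolding smooth_on_circle_def by (metis funpow_0 mem_sphere_0 norm_cis)
  then have "((\<lambda>s. f (cis t * cis s)) has_real_derivative circle_deriv f (cis t)) (at 0)"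
    unfolding circle_deriv_def by (simp add: vector_derivative_works has_real_derivative_iff_has_vector_derivative)
  then have "((\<lambda>s. f (cis (s + t))) has_real_derivative circle_deriv f (cis t)) (at 0)"
    by (simp add: cis_mult add.commute)
  then show ?thesis using DERIV_shift[of "\<lambda>t. f (cis t)" _ 0 t] by simp
qed

lemma is_weak_deriv_integrable: "is_weak_deriv f g \<Longrightarrow> integrable circle_measure g"
  unfolding is_weak_deriv_def by (elim conjunct1)

text \<open>
  Integration by parts: the angle derivative of \<open>L (Q z) * \<phi> z\<close> has integral zero because the
  circle is closed.
\<close>

lemma is_weak_deriv_analytic:
  assumes L: "bounded_linear L" and Q: "Q analytic_on circle"
  shows "is_weak_deriv (\<lambda>z. L (Q z)) (\<lambda>z. L (rot_deriv Q z))"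
  unfolding is_weak_deriv_def
proof (intro conjI allI impI)
  have cL: "continuous_on circle (\<lambda>z. L (P z))" if "P analytic_on circle" for P
    by (rule bounded_linear.continuous_on[OF L analytic_on_circle_continuous[OF that]])
  note cont = cL[OF Q] cL[OF analytic_rot_deriv[OF Q]]
  show "integrable circle_measure (\<lambda>z. L (rot_deriv Q z))"
    by (intro integrable_continuous_circle cont)
  fix \<phi> assume \<phi>: "smooth_on_circle \<phi>"
  have c\<phi>: "continuous_on circle \<phi>" "continuous_on circle (circle_deriv \<phi>)"
    using smooth_on_circle_continuous[OF \<phi>, of 0] smooth_on_circle_continuous[OF \<phi>, of 1] by auto
  let ?g = "\<lambda>z. L (Q z) * circle_deriv \<phi> z + L (rot_deriv Q z) * \<phi> z"
  let ?F = "\<lambda>t. L (Q (cis t)) * \<phi> (cis t)"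
  have "((\<lambda>t. ?g (cis t)) has_integral (?F (2 * pi) - ?F 0)) {0..2 * pi}"
  proof (rule fundamental_theorem_of_calculus)
    fix t :: real
    have "((\<lambda>t. L (Q (1 * cis t))) has_vector_derivative L (rot_deriv Q (1 * cis t))) (at t)"
      by (intro bounded_linear.has_vector_derivative[OF L] has_vector_derivative_rotate Q) simp
    then have "((\<lambda>t. L (Q (cis t))) has_real_derivative L (rot_deriv Q (cis t))) (at t)"
      by (simp add: has_real_derivative_iff_has_vector_derivative)
    from DERIV_mult[OF this smooth_on_circle_has_derivative[OF \<phi>]]
    have "(?F has_real_derivative ?g (cis t)) (at t)"
      by (simp add: mult.commute add.commute)
    then show "(?F has_vector_derivative ?g (cis t)) (at t within {0..2 * pi})"
      by (simp add: has_real_derivative_iff_has_vector_derivative has_vector_derivative_at_within)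
  qed simp
  then have zero: "((\<lambda>t. ?g (cis t)) has_integral 0) {0..2 * pi}" by simp
  have whole: "((\<lambda>t. ?g (cis t)) has_integral (\<integral>z. ?g z \<partial>circle_measure)) {0..2 * pi}"
    by (intro integral_circle_eq_has_integral continuous_intros cont c\<phi>)
  have "(\<integral>z. ?g z \<partial>circle_measure) = 0"
    by (rule has_integral_unique[OF whole zero])
  moreover have "(\<integral>z. ?g z \<partial>circle_measure) =
      (\<integral>z. L (Q z) * circle_deriv \<phi> z \<partial>circle_measure) + (\<integral>z. L (rot_deriv Q z) * \<phi> z \<partial>circle_measure)"
    by (intro Bochner_Integration.integral_add integrable_continuous_circle continuous_intros cont c\<phi>)
  ultimately show "(\<integral>z. L (Q z) * circle_deriv \<phi> z \<partial>circle_measure) =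
      - (\<integral>z. L (rot_deriv Q z) * \<phi> z \<partial>circle_measure)" by simp
qed

lemma integrable_on_circle_complex:
  fixes f :: "complex \<Rightarrow> real"
  assumes "integrable circle_measure f" "continuous_on circle Q"
  shows "integrable circle_measure (\<lambda>z. of_real (f z) * Q z :: complex)"
  using assms by (intro integrable_mult_continuous_circle) auto

lemma is_weak_deriv_complex:
  assumes fg: "integrable circle_measure f" "is_weak_deriv f g" and Q: "Q analytic_on circle"
  shows "(\<integral>z. of_real (f z) * rot_deriv Q z \<partial>circle_measure) =
    - (\<integral>z. of_real (g z) * Q z \<partial>circle_measure)"
proof -
  have g: "integrable circle_measure g" using fg(2) by (rule is_weak_deriv_integrable)
  have cont: "continuous_on circle Q" "continuous_on circle (rot_deriv Q)"
    by (intro analytic_on_circle_continuous analytic_intros Q)+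
  have *: "(\<integral>z. f z * L (rot_deriv Q z) \<partial>circle_measure) = - (\<integral>z. g z * L (Q z) \<partial>circle_measure)"
    if L: "bounded_linear L" for L
  proof -
    have "(\<integral>z. f z * circle_deriv (\<lambda>z. L (Q z)) z \<partial>circle_measure) = - (\<integral>z. g z * L (Q z) \<partial>circle_measure)"
      using fg(2) smooth_on_circle_analytic[OF L Q] by (simp add: is_weak_deriv_def)
    moreover have "(\<integral>z. f z * circle_deriv (\<lambda>z. L (Q z)) z \<partial>circle_measure) =
        (\<integral>z. f z * L (rot_deriv Q z) \<partial>circle_measure)"
      by (rule Bochner_Integration.integral_cong) (auto simp: circle_deriv_analytic(1)[OF L Q refl])
    ultimately show ?thesis by simp
  qed
  note i = integrable_on_circle_complex[OF fg(1) cont(2)] integrable_on_circle_complex[OF g cont(1)]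
  show ?thesis
    using *[OF bounded_linear_Re] *[OF bounded_linear_Im]
      i[THEN integral_Re] i[THEN integral_Im]
    by (simp add: complex_eq_iff)
qed

lemma power_analytic: "(\<lambda>z::complex. z ^ n) analytic_on S"
  by (intro analytic_intros)

text \<open>
  The positive and the negative part of \<open>f - g\<close> are densities of two finite measures with equal
  moments, hence they agree; since they have disjoint supports, both vanish.
\<close>

lemma AE_eq_on_circle_by_moments:
  fixes f g :: "complex \<Rightarrow> real"
  assumes [simp]: "integrable circle_measure f" "integrable circle_measure g"
    and moments: "\<And>n. (\<integral>z. of_real (f z) * z ^ n \<partial>circle_measure) = (\<integral>z. of_real (g z) * z ^ n \<partial>circle_measure)"
  shows "AE z in circle_measure. f z = g z"
proof -
  define u where "u z = f z - g z" for z
  have u: "integrable circle_measure u" by (simp add: u_def[abs_def])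
  then have [measurable]: "u \<in> borel_measurable circle_measure" by auto
  have up: "integrable circle_measure (\<lambda>z. max 0 (u z))" "integrable circle_measure (\<lambda>z. max 0 (- u z))"
    using u by auto
  have "density circle_measure (\<lambda>z. ennreal (max 0 (u z))) = density circle_measure (\<lambda>z. ennreal (max 0 (- u z)))"
  proof (rule finite_measures_on_circle_eqI)
    fix n :: nat
    have c: "continuous_on circle (\<lambda>z::complex. z ^ n)" by (intro continuous_intros)
    have [measurable]: "(\<lambda>z. z ^ n) \<in> borel_measurable circle_measure"
      by (rule continuous_measurable_circle[OF c])
    note i = integrable_on_circle_complex[OF _ c]
    have "(\<integral>z. of_real (max 0 (u z)) * z ^ n \<partial>circle_measure) - (\<integral>z. of_real (max 0 (- u z)) * z ^ n \<partial>circle_measure)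
       = (\<integral>z. of_real (max 0 (u z)) * z ^ n - of_real (max 0 (- u z)) * z ^ n \<partial>circle_measure)"
      by (intro Bochner_Integration.integral_diff[symmetric] i up)
    also have "\<dots> = (\<integral>z. of_real (f z) * z ^ n - of_real (g z) * z ^ n \<partial>circle_measure)"
      by (intro Bochner_Integration.integral_cong refl) (auto simp: u_def max_def ring_distribs)
    also have "\<dots> = (\<integral>z. of_real (f z) * z ^ n \<partial>circle_measure) - (\<integral>z. of_real (g z) * z ^ n \<partial>circle_measure)"
      by (intro Bochner_Integration.integral_diff i) auto
    finally have "(\<integral>z. of_real (max 0 (u z)) * z ^ n \<partial>circle_measure) =
        (\<integral>z. of_real (max 0 (- u z)) * z ^ n \<partial>circle_measure)" using moments by simp
    then show "(\<integral>z. z ^ n \<partial>density circle_measure (\<lambda>z. ennreal (max 0 (u z)))) =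
        (\<integral>z. z ^ n \<partial>density circle_measure (\<lambda>z. ennreal (max 0 (- u z))))"
      by (subst (1 2) integral_density) (auto simp: scaleR_conv_of_real)
  next
    show "finite_measure (with_density (\<lambda>z. max 0 (u z)))"
      by (rule finite_measure_circle_density[OF up(1)]) simp
    show "finite_measure (with_density (\<lambda>z. max 0 (- u z)))"
      by (rule finite_measure_circle_density[OF up(2)]) simp
  qed simp_all
  then have "AE z in circle_measure. ennreal (max 0 (u z)) = ennreal (max 0 (- u z))"
    by (subst (asm) finite_density_unique) (use up in \<open>auto simp: nn_integral_eq_integral\<close>)
  then show ?thesis
    by eventually_elim (auto simp: u_def max_def split: if_splits)
qed

lemma weak_deriv_unique:
  assumes "integrable circle_measure f" "is_weak_deriv f g" "is_weak_deriv f g'"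
  shows "AE z in circle_measure. g z = g' z"
proof (rule AE_eq_on_circle_by_moments)
  show "integrable circle_measure g" "integrable circle_measure g'"
    by (rule is_weak_deriv_integrable[OF assms(2)], rule is_weak_deriv_integrable[OF assms(3)])
  show "(\<integral>z. of_real (g z) * z ^ n \<partial>circle_measure) = (\<integral>z. of_real (g' z) * z ^ n \<partial>circle_measure)" for n
    using is_weak_deriv_complex[OF assms(1,2) power_analytic[of n]]
      is_weak_deriv_complex[OF assms(1,3) power_analytic[of n]] by simp
qed

lemma analytic_in_W11:
  assumes "bounded_linear L" "Q analytic_on circle"
  shows "(\<lambda>z. L (Q z)) \<in> W11"
  unfolding W11_def
proof (intro CollectI conjI exI)
  show "integrable circle_measure (\<lambda>z. L (Q z))"
    by (intro integrable_continuous_circle bounded_linear.continuous_on[OF assms(1)]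
        analytic_on_circle_continuous assms(2))
  show "is_weak_deriv (\<lambda>z. L (Q z)) (\<lambda>z. L (rot_deriv Q z))"
    by (rule is_weak_deriv_analytic[OF assms])
qed

lemma is_weak_deriv_weak_deriv: "is_weak_deriv f g \<Longrightarrow> is_weak_deriv f (weak_deriv f)"
  unfolding weak_deriv_def by (rule someI[of "is_weak_deriv f" g])

text \<open>
  The norm is defined by a choice of weak derivative. By uniqueness the choice does not matter,
  and the classical derivative can be used.
\<close>

lemma W11_norm_analytic_le:
  assumes Q: "Q analytic_on circle"
    and B: "\<And>z. z \<in> circle \<Longrightarrow> \<bar>Re (Q z)\<bar> \<le> B" "\<And>z. z \<in> circle \<Longrightarrow> \<bar>Re (rot_deriv Q z)\<bar> \<le> C"
  shows "W11_norm (\<lambda>z. Re (Q z)) \<le> 2 * pi * (B + C)"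
proof -
  have c: "continuous_on circle (\<lambda>z. Re (Q z))" "continuous_on circle (\<lambda>z. Re (rot_deriv Q z))"
    by (intro continuous_intros analytic_on_circle_continuous analytic_intros Q)+
  have wd: "is_weak_deriv (\<lambda>z. Re (Q z)) (weak_deriv (\<lambda>z. Re (Q z)))"
    by (rule is_weak_deriv_weak_deriv[OF is_weak_deriv_analytic[OF bounded_linear_Re Q]])
  have "AE z in circle_measure. weak_deriv (\<lambda>z. Re (Q z)) z = Re (rot_deriv Q z)"
    by (rule weak_deriv_unique[OF integrable_continuous_circle[OF c(1)] wd
          is_weak_deriv_analytic[OF bounded_linear_Re Q]])
  then have "AE z in circle_measure. \<bar>weak_deriv (\<lambda>z. Re (Q z)) z\<bar> = \<bar>Re (rot_deriv Q z)\<bar>"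
    by eventually_elim simp
  then have "(\<integral>z. \<bar>weak_deriv (\<lambda>z. Re (Q z)) z\<bar> \<partial>circle_measure) =
      (\<integral>z. \<bar>Re (rot_deriv Q z)\<bar> \<partial>circle_measure)"
    using is_weak_deriv_integrable[OF wd] integrable_continuous_circle[OF c(2)]
    by (intro integral_cong_AE) auto
  moreover have "(\<integral>z. \<bar>f z\<bar> \<partial>circle_measure) \<le> 2 * pi * K"
    if "continuous_on circle f" "\<And>z. z \<in> circle \<Longrightarrow> \<bar>f z\<bar> \<le> K" for f :: "complex \<Rightarrow> real" and K
  proof -
    have "(\<integral>z. \<bar>f z\<bar> \<partial>circle_measure) \<le> (\<integral>z. K \<partial>circle_measure)"
      by (rule integral_mono) (use that in \<open>auto intro!: integrable_continuous_circle continuous_intros\<close>)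
    then show ?thesis by (simp add: measure_circle)
  qed
  ultimately show ?thesis
    using c B unfolding W11_norm_def by (simp add: ring_distribs add_mono)
qed


section \<open>Twisting by rotations\<close>

text \<open>
  The map \<open>G\<close> seen in rotated coordinates, by \<open>\<alpha>\<close> in the source and by \<open>\<beta>\<close> in the target. The
  fibre maps of the cocycle are twists of one fixed map, with \<open>\<alpha>\<close> and \<open>\<beta>\<close> linear in the parameter.
\<close>

definition twist :: "real \<Rightarrow> real \<Rightarrow> (complex \<Rightarrow> complex) \<Rightarrow> complex \<Rightarrow> complex" where
  "twist \<alpha> \<beta> G z = cis \<beta> * G (cis (- \<alpha>) * z)"

lemma rotate_in_circle: "z \<in> circle \<Longrightarrow> cis \<alpha> * z \<in> circle"
  by (simp add: norm_mult)

lemma analytic_twist: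
  assumes G: "G analytic_on circle"
  shows "twist \<alpha> \<beta> G analytic_on circle"
proof -
  have "(G \<circ> (\<lambda>z. cis (- \<alpha>) * z)) analytic_on circle"
    by (rule analytic_on_compose_gen[OF _ G]) (auto intro!: analytic_intros simp: norm_mult)
  then show ?thesis
    unfolding twist_def[abs_def] by (intro analytic_intros) (simp add: o_def)
qed

lemma rot_deriv_twist:
  assumes G: "G analytic_on circle" and z: "z \<in> circle"
  shows "rot_deriv (twist \<alpha> \<beta> G) z = twist \<alpha> \<beta> (rot_deriv G) z"
proof -
  have "((\<lambda>z. G (cis (- \<alpha>) * z)) has_field_derivative deriv G (cis (- \<alpha>) * z) * cis (- \<alpha>)) (at z)"
    by (rule DERIV_chain2[where f = G and g = "\<lambda>z. cis (- \<alpha>) * z",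
          OF DERIV_circle[OF G rotate_in_circle[OF z]]])
      (auto intro!: derivative_eq_intros)
  then have "(twist \<alpha> \<beta> G has_field_derivative cis \<beta> * (deriv G (cis (- \<alpha>) * z) * cis (- \<alpha>))) (at z)"
    unfolding twist_def[abs_def] by (rule DERIV_cmult)
  from rot_deriv_eqI[OF this] show ?thesis
    by (simp add: twist_def rot_deriv_def mult_ac)
qed

lemma norm_twist [simp]: "norm (twist \<alpha> \<beta> G z) = norm (G (cis (- \<alpha>) * z))"
  by (simp add: twist_def norm_mult)


section \<open>A conjugate of a power map and its invariant density\<close>

text \<open>
  The map \<open>moebius\<close> is the automorphism of the unit disc that takes 0 to 1/2. Conjugating \<open>z \<mapsto> z\<^sup>1\<^sup>0\<close> by it
  makes the invariant density non-uniform, which is needed to detect rotations. The distortion of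
  the angle by \<open>moebius\<close> and by its inverse is at most 3 each, so exponent 10 > 9 leaves an expansion.
\<close>

definition moebius :: "complex \<Rightarrow> complex" where "moebius z = (2 * z + 1) / (z + 2)"
definition moebius_inv :: "complex \<Rightarrow> complex" where "moebius_inv z = (2 * z - 1) / (2 - z)"
definition base_map :: "complex \<Rightarrow> complex" where "base_map z = moebius (moebius_inv z ^ 10)"

lemma moebius_inv_eq: "moebius_inv z = - moebius (- z)"
  by (simp add: moebius_def moebius_inv_def divide_minus_left[symmetric])

lemma moebius_denominators_nonzero:
  assumes "norm (z::complex) \<le> 1" shows "z + 2 \<noteq> 0" "2 - z \<noteq> 0"
proof -
  have "z \<noteq> - 2" "z \<noteq> 2" using assms by auto
  then show "z + 2 \<noteq> 0" "2 - z \<noteq> 0" by (auto simp: add_eq_0_iff2)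
qed

lemma norm_moebius_eq:
  "(cmod (z + 2))\<^sup>2 - (cmod (2 * z + 1))\<^sup>2 = 3 * (1 - (cmod z)\<^sup>2)"
  unfolding cmod_power2 by (simp add: power2_eq_square algebra_simps)

lemma norm_moebius:
  assumes "norm z \<le> 1"
  shows "norm (moebius z) \<le> 1" and "norm z = 1 \<Longrightarrow> norm (moebius z) = 1"
proof -
  have pos: "cmod (z + 2) > 0" using moebius_denominators_nonzero[OF assms] by simp
  have "0 \<le> 3 * (1 - (cmod z)\<^sup>2)"
    using power_le_one[OF norm_ge_zero assms, of 2] by simp
  then have "(cmod (2 * z + 1))\<^sup>2 \<le> (cmod (z + 2))\<^sup>2"
    unfolding norm_moebius_eq[symmetric] by simp
  then have "cmod (2 * z + 1) \<le> cmod (z + 2)" by (rule power2_le_imp_le) simp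
  then show "norm (moebius z) \<le> 1" using pos by (simp add: moebius_def norm_divide)
  assume "norm z = 1"
  then have "(cmod (2 * z + 1))\<^sup>2 = (cmod (z + 2))\<^sup>2"
    using norm_moebius_eq[of z] by simp
  then have "cmod (2 * z + 1) = cmod (z + 2)" by (simp add: power2_eq_iff_nonneg)
  then show "norm (moebius z) = 1" using pos by (simp add: moebius_def norm_divide)
qed

lemma norm_moebius_inv:
  assumes "norm z \<le> 1"
  shows "norm (moebius_inv z) \<le> 1" and "norm z = 1 \<Longrightarrow> norm (moebius_inv z) = 1"
  using norm_moebius[of "- z"] assms by (simp_all add: moebius_inv_eq)

lemma moebius_moebius_inv:
  assumes "norm z \<le> 1" shows "moebius (moebius_inv z) = z"
proof -
  have n: "2 - z \<noteq> 0" using moebius_denominators_nonzero[OF assms] by simp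
  have "2 * moebius_inv z + 1 = 3 * z / (2 - z)" "moebius_inv z + 2 = 3 / (2 - z)"
    using n by (simp_all add: moebius_inv_def field_simps)
  then show ?thesis using n by (simp add: moebius_def)
qed

lemma moebius_inv_moebius:
  assumes "norm z \<le> 1" shows "moebius_inv (moebius z) = z"
  using moebius_moebius_inv[of "- z"] assms by (simp add: moebius_inv_eq)

lemma moebius_inv_half [simp]: "moebius_inv (1 / 2) = 0"
  by (simp add: moebius_inv_def)

lemma DERIV_moebius:
  assumes "norm z \<le> 1" shows "(moebius has_field_derivative 3 / (z + 2)\<^sup>2) (at z)"
  unfolding moebius_def[abs_def]
  using moebius_denominators_nonzero[OF assms] by (auto intro!: derivative_eq_intros simp: power2_eq_square divide_simps)

lemma DERIV_moebius_inv:
  assumes "norm z \<le> 1" shows "(moebius_inv has_field_derivative 3 / (2 - z)\<^sup>2) (at z)"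
  unfolding moebius_inv_def[abs_def]
  using moebius_denominators_nonzero[OF assms] by (auto intro!: derivative_eq_intros simp: power2_eq_square divide_simps)

lemma analytic_moebius: "moebius analytic_on cball 0 1"
  unfolding moebius_def[abs_def] using moebius_denominators_nonzero by (intro analytic_intros) auto

lemma analytic_moebius_inv: "moebius_inv analytic_on cball 0 1"
  unfolding moebius_inv_def[abs_def] using moebius_denominators_nonzero by (intro analytic_intros) auto

lemma analytic_base_map: "base_map analytic_on cball 0 1"
proof -
  have "(moebius \<circ> (\<lambda>z. moebius_inv z ^ 10)) analytic_on cball 0 1"
    by (rule analytic_on_compose_gen[OF _ analytic_moebius])
      (auto intro!: analytic_intros analytic_moebius_inv power_le_one norm_moebius_inv simp: norm_power)
  then show ?thesis by (simp add: base_map_def[abs_def] o_def)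
qed

lemma analytic_base_map_circle: "base_map analytic_on circle"
  using analytic_base_map by (rule analytic_on_subset) auto

lemma norm_base_map: "norm z = 1 \<Longrightarrow> norm (base_map z) = 1"
  by (simp add: base_map_def norm_moebius norm_moebius_inv norm_power)

lemma moebius_inv_base_map: "norm z \<le> 1 \<Longrightarrow> moebius_inv (base_map z) = moebius_inv z ^ 10"
  by (simp add: base_map_def moebius_inv_moebius norm_moebius_inv norm_power power_le_one)

lemma base_map_half: "base_map (1 / 2) = 1 / 2"
  by (simp add: base_map_def moebius_def)

text \<open>
  The left-hand side is \<open>v moebius'(v) / moebius v\<close>, the angular speed of \<open>moebius\<close>; on the circle
  \<open>2 v + 1 = v cnj (v + 2)\<close>, which makes it real and positive.
\<close>

lemma moebius_speed:
  assumes "norm v = 1"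
  shows "3 * v / ((v + 2) * (2 * v + 1)) = of_real (3 / (cmod (v + 2))\<^sup>2)"
    and "1 / 3 \<le> 3 / (cmod (v + 2))\<^sup>2"
proof -
  have v: "v * cnj v = 1" "v \<noteq> 0" using assms by (auto simp: complex_norm_square[symmetric])
  have nz: "v + 2 \<noteq> 0" using moebius_denominators_nonzero[of v] assms by simp
  have "2 * v + 1 = v * cnj (v + 2)" using v by (simp add: algebra_simps)
  moreover have "(v + 2) * cnj (v + 2) = of_real ((cmod (v + 2))\<^sup>2)"
    by (simp only: complex_norm_square)
  ultimately have "(v + 2) * (2 * v + 1) = v * of_real ((cmod (v + 2))\<^sup>2)"
    by (metis mult.left_commute)
  then show "3 * v / ((v + 2) * (2 * v + 1)) = of_real (3 / (cmod (v + 2))\<^sup>2)"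
    using v by simp
  have "cmod (v + 2) \<le> 3" using norm_triangle_ineq[of v 2] assms by simp
  then have "(cmod (v + 2))\<^sup>2 \<le> 3\<^sup>2" by (rule power_mono) simp
  then show "1 / 3 \<le> 3 / (cmod (v + 2))\<^sup>2" using nz by (simp add: field_simps)
qed

text \<open>
  By the chain rule the angular speed is the product of the speeds of the three factors, at least
  \<open>1/3 * 10 * 1/3\<close>.
\<close>

lemma circle_map_deriv_twist_base_map:
  assumes z: "z \<in> circle"
  shows "circle_map_deriv (twist \<alpha> \<beta> base_map) z \<ge> 10 / 9"
proof -
  define y where "y = cis (- \<alpha>) * z"
  define w where "w = moebius_inv y"
  define v where "v = w ^ 10"
  have ny: "norm y = 1" using z by (simp add: y_def norm_mult)
  then have nw: "norm w = 1" by (simp add: w_def norm_moebius_inv)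
  then have nv: "norm v = 1" by (simp add: v_def norm_power)
  have "((\<lambda>y. moebius_inv y ^ 10) has_field_derivative 10 * w ^ 9 * (3 / (2 - y)\<^sup>2)) (at y)"
    using DERIV_power[OF DERIV_moebius_inv, of y 10] ny by (simp add: w_def mult_ac)
  moreover have "(moebius has_field_derivative 3 / (v + 2)\<^sup>2) (at (moebius_inv y ^ 10))"
    using DERIV_moebius[of v] nv by (simp add: v_def w_def)
  ultimately have "(base_map has_field_derivative 3 / (v + 2)\<^sup>2 * (10 * w ^ 9 * (3 / (2 - y)\<^sup>2))) (at y)"
    unfolding base_map_def[abs_def] by (rule DERIV_chain2[rotated])
  note S' = rot_deriv_eqI[OF this]
  have nz: "y \<noteq> 0" "w \<noteq> 0" "v \<noteq> 0" "2 - y \<noteq> 0" "v + 2 \<noteq> 0"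
    using ny nw nv moebius_denominators_nonzero[of y] moebius_denominators_nonzero[of v] by auto
  have nz2: "2 * y - 1 \<noteq> 0" using nz by (auto simp: w_def moebius_inv_def)
  have nz3: "2 * v + 1 \<noteq> 0" using norm_moebius(2)[of v] nv by (auto simp: moebius_def)
  define p where "p = 3 / (cmod (v + 2))\<^sup>2"
  define q where "q = 3 / (cmod (- y + 2))\<^sup>2"
  have p: "3 * v / ((v + 2) * (2 * v + 1)) = of_real p" "p \<ge> 1 / 3"
    unfolding p_def by (rule moebius_speed[OF nv])+
  have "3 * (- y) / ((- y + 2) * (2 * (- y) + 1)) = of_real q" and q: "q \<ge> 1 / 3"
    unfolding q_def using moebius_speed[of "- y"] ny by auto
  moreover have "3 * (- y) / ((- y + 2) * (2 * (- y) + 1)) = 3 * y / ((2 - y) * (2 * y - 1))"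
  proof -
    have "(- y + 2) * (2 * (- y) + 1) = - ((2 - y) * (2 * y - 1))" by (simp add: algebra_simps)
    then show ?thesis by simp
  qed
  ultimately have q': "3 * y / ((2 - y) * (2 * y - 1)) = of_real q" by simp
  have "w ^ 9 = v / w" using nz by (simp add: v_def power_eq_if)
  also have "\<dots> = v * (2 - y) / (2 * y - 1)" by (simp add: w_def moebius_inv_def)
  finally have w9: "w ^ 9 = v * (2 - y) / (2 * y - 1)" .
  have "rot_deriv base_map y / base_map y = \<i> * (y * (3 / (v + 2)\<^sup>2 * (10 * (v * (2 - y) / (2 * y - 1)) * (3 / (2 - y)\<^sup>2)))) / moebius v"
    unfolding S' w9 by (simp add: base_map_def v_def w_def)
  also have "\<dots> = \<i> * 10 * (3 * v / ((v + 2) * (2 * v + 1))) * (3 * y / ((2 - y) * (2 * y - 1)))"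
    using nz nz2 nz3 by (simp add: moebius_def power2_eq_square divide_simps)
  also have "\<dots> = \<i> * of_real (10 * p * q)" unfolding p q' by simp
  finally have quot: "rot_deriv base_map y / base_map y = \<i> * of_real (10 * p * q)" .
  have "circle_deriv (twist \<alpha> \<beta> base_map) z = twist \<alpha> \<beta> (rot_deriv base_map) z"
    using circle_deriv_analytic(1)[OF bounded_linear_ident analytic_twist[OF analytic_base_map_circle] refl z]
    by (simp add: rot_deriv_twist[OF analytic_base_map_circle z])
  then have "circle_map_deriv (twist \<alpha> \<beta> base_map) z = Im (rot_deriv base_map y / base_map y)"
    by (simp add: circle_map_deriv_def twist_def y_def)
  also have "\<dots> = 10 * (p * q)" unfolding quot by simp
  also have "\<dots> \<ge> 10 * (1 / 3 * (1 / 3))"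
    using p q by (intro mult_left_mono mult_mono) auto
  finally show ?thesis by simp
qed

text \<open>
  On the circle the real part of \<open>herglotz\<close> is the Poisson kernel \<open>(1 - p\<^sup>2) / \<bar>1 - p z\<bar>\<^sup>2\<close> with
  \<open>p = 1/2\<close>, so \<open>poisson \<alpha>\<close> is the density of the harmonic measure of the
  disc as seen from \<open>cis \<alpha> / 2\<close>.
\<close>

definition herglotz :: "complex \<Rightarrow> complex" where "herglotz z = (2 + z) / (2 - z)"

definition poisson :: "real \<Rightarrow> complex \<Rightarrow> real" where
  "poisson \<alpha> z = Re (herglotz (cis (- \<alpha>) * z)) / (2 * pi)"

lemma analytic_herglotz: "herglotz analytic_on cball 0 1"
  unfolding herglotz_def[abs_def] using moebius_denominators_nonzero by (intro analytic_intros) auto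

lemma analytic_herglotz_circle: "herglotz analytic_on circle"
  using analytic_herglotz by (rule analytic_on_subset) auto

lemma Re_herglotz:
  assumes "norm y = 1"
  shows "of_real (Re (herglotz y)) = 3 * y / ((2 - y) * (2 * y - 1))" and "Re (herglotz y) > 0"
proof -
  have nz: "2 - y \<noteq> 0" "y \<noteq> 0" using moebius_denominators_nonzero[of y] assms by auto
  have y1: "cnj y = inverse y" using inverse_eq_cnj_on_circle[of y] assms by simp
  have nz2: "2 * y - 1 \<noteq> 0" using norm_moebius_inv(2)[of y] assms by (auto simp: moebius_inv_def)
  have "of_real (Re (herglotz y)) = (herglotz y + cnj (herglotz y)) / 2"
    by (simp add: complex_add_cnj)
  also have "cnj (herglotz y) = (2 + inverse y) / (2 - inverse y)"
    by (simp add: herglotz_def y1)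
  also have "\<dots> = (2 * y + 1) / (2 * y - 1)"
    using nz nz2 by (simp add: field_simps)
  also have "(herglotz y + (2 * y + 1) / (2 * y - 1)) / 2 = 3 * y / ((2 - y) * (2 * y - 1))"
    using nz nz2 by (simp add: herglotz_def divide_simps) (simp add: algebra_simps)
  finally show eq: "of_real (Re (herglotz y)) = 3 * y / ((2 - y) * (2 * y - 1))" .
  have "3 * (- y) / ((- y + 2) * (2 * (- y) + 1)) = 3 * y / ((2 - y) * (2 * y - 1))"
  proof -
    have "(- y + 2) * (2 * (- y) + 1) = - ((2 - y) * (2 * y - 1))" by (simp add: algebra_simps)
    then show ?thesis by simp
  qed
  then have "complex_of_real (Re (herglotz y)) = of_real (3 / (cmod (- y + 2))\<^sup>2)"
    using moebius_speed(1)[of "- y"] assms eq by simp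
  then have "Re (herglotz y) = 3 / (cmod (- y + 2))\<^sup>2" by (simp only: of_real_eq_iff)
  then show "Re (herglotz y) > 0" using moebius_speed(2)[of "- y"] assms nz by simp
qed

lemma poisson_pos: "z \<in> circle \<Longrightarrow> poisson \<alpha> z > 0"
  using Re_herglotz(2)[of "cis (- \<alpha>) * z"] by (simp add: poisson_def norm_mult)

lemma poisson_eq_twist: "poisson \<alpha> z = Re (of_real (1 / (2 * pi)) * twist \<alpha> 0 herglotz z)"
  by (simp add: poisson_def twist_def)

lemma continuous_poisson: "continuous_on circle (poisson \<alpha>)"
  unfolding poisson_eq_twist[abs_def]
  by (intro continuous_intros analytic_on_circle_continuous analytic_twist analytic_herglotz_circle)

lemma integrable_poisson: "integrable circle_measure (poisson \<alpha>)"
  by (rule integrable_continuous_circle[OF continuous_poisson])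

text \<open>
  On the circle the kernel equals a rational function with a single pole in the disc, at
  \<open>q = cis \<alpha> / 2\<close>, so this is Cauchy's integral formula for the function \<open>G\<close> below.
\<close>

lemma poisson_integral:
  assumes F: "F analytic_on cball 0 1"
  shows "(\<integral>z. of_real (poisson \<alpha> z) * F z \<partial>circle_measure) = F (cis \<alpha> / 2)"
proof -
  define c where "c = cis (- \<alpha>)"
  define G where "G z = 3 * F z / (4 * of_real pi * \<i> * (2 - c * z))" for z
  define q where "q = cis \<alpha> / 2"
  have cq: "c * q = 1 / 2" "norm c = 1" "c \<noteq> 0" by (auto simp: c_def q_def cis_mult)
  have nz: "2 - c * z \<noteq> 0" if "norm z \<le> 1" for z
    using moebius_denominators_nonzero(2)[of "c * z"] that cq by (simp add: norm_mult)
  have "G holomorphic_on cball 0 1"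
    unfolding G_def using nz
    by (intro holomorphic_intros analytic_imp_holomorphic[OF F]) auto
  moreover have "norm (q - 0) < 1" by (simp add: q_def norm_divide)
  ultimately have "((\<lambda>u. G u / (u - q)) has_contour_integral (2 * of_real pi * \<i> * G q)) (circlepath 0 1)"
    by (rule Cauchy_integral_circlepath_simple)
  also have "2 * of_real pi * \<i> * G q = F q"
  proof -
    have "2 - c * q = 3 / 2" unfolding cq(1) by simp
    show ?thesis unfolding G_def \<open>2 - c * q = 3 / 2\<close> by simp
  qed
  finally have "((\<lambda>t. G (cis t) / (cis t - q) * \<i> * cis t) has_integral F q) {0..2 * pi}"
    unfolding circlepath_def by (subst (asm) has_contour_integral_part_circlepath_iff) auto
  moreover have "G z / (z - q) * \<i> * z = of_real (poisson \<alpha> z) * F z" if "z \<in> circle" for z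
  proof -
    have ncz: "norm (c * z) = 1" using that cq by (simp add: norm_mult)
    have zq: "2 * (c * z) - 1 = 2 * c * (z - q)" using cq by (simp add: algebra_simps)
    have "norm q = 1 / 2" by (simp add: q_def norm_divide)
    then have "z \<noteq> q" using that by auto
    have "of_real (poisson \<alpha> z) = 3 * (c * z) / ((2 - c * z) * (2 * (c * z) - 1)) / (2 * of_real pi)"
      using Re_herglotz(1)[OF ncz] by (simp add: poisson_def c_def)
    also have "\<dots> = 3 * z / ((2 - c * z) * (z - q)) / (4 * of_real pi)"
      unfolding zq using cq by simp
    finally show ?thesis using nz[of z] that \<open>z \<noteq> q\<close> by (simp add: G_def mult_ac)
  qed
  ultimately have 1: "((\<lambda>t. of_real (poisson \<alpha> (cis t)) * F (cis t)) has_integral F q) {0..2 * pi}"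
    by simp
  have "F analytic_on circle" using F by (rule analytic_on_subset) auto
  then have "continuous_on circle (\<lambda>z. of_real (poisson \<alpha> z) * F z)"
    by (intro continuous_intros continuous_poisson analytic_on_circle_continuous)
  from integral_circle_eq_has_integral[OF this] 1 show ?thesis
    unfolding q_def by (rule has_integral_unique)
qed


lemma measurable_circle_self_map:
  assumes "continuous_on circle f" "\<And>z. z \<in> circle \<Longrightarrow> f z \<in> circle"
  shows "f \<in> circle_measure \<rightarrow>\<^sub>M circle_measure"
proof -
  have "f \<in> circle_measure \<rightarrow>\<^sub>M restrict_space borel circle"
    using assms by (intro measurable_restrict_space2 continuous_measurable_circle) auto
  then show ?thesis using measurable_cong_sets[OF refl sets_circle_measure] by blast
qed

lemma AE_poisson_nonneg: "AE z in circle_measure. 0 \<le> poisson \<alpha> z"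
  using poisson_pos by (auto intro!: AE_I2 less_imp_le)

lemma poisson_moment:
  assumes "F analytic_on cball 0 1"
  shows "(\<integral>z. F z \<partial>with_density (poisson \<alpha>)) = F (cis \<alpha> / 2)"
proof -
  have "continuous_on circle F"
    using analytic_on_circle_continuous[OF analytic_on_subset[OF assms]] by auto
  then show ?thesis
    using poisson_integral[OF assms, of \<alpha>]
      integral_with_density[OF integrable_poisson AE_poisson_nonneg continuous_measurable_circle, of F]
    by simp
qed

lemma analytic_twist_cball:
  assumes "G analytic_on cball 0 1"
  shows "twist \<alpha> \<beta> G analytic_on cball 0 1"
proof -
  have "(G \<circ> (\<lambda>z. cis (- \<alpha>) * z)) analytic_on cball 0 1"
    by (rule analytic_on_compose_gen[OF _ assms]) (auto intro!: analytic_intros simp: norm_mult)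
  then show ?thesis
    unfolding twist_def[abs_def] by (intro analytic_intros) (simp add: o_def)
qed

lemma twist_in_circle: "(\<And>z. z \<in> circle \<Longrightarrow> G z \<in> circle) \<Longrightarrow> z \<in> circle \<Longrightarrow> twist \<alpha> \<beta> G z \<in> circle"
  using rotate_in_circle[of z "- \<alpha>"] by (simp add: norm_twist)

lemma measurable_twist:
  assumes "G analytic_on circle" "\<And>z. z \<in> circle \<Longrightarrow> G z \<in> circle"
  shows "twist \<alpha> \<beta> G \<in> circle_measure \<rightarrow>\<^sub>M circle_measure"
  by (intro measurable_circle_self_map twist_in_circle assms analytic_on_circle_continuous analytic_twist)

section \<open>Invariance and uniqueness on the fibres\<close>

text \<open>
  A holomorphic self-map of the disc carries harmonic measures to harmonic measures: the moments
  of the image are \<open>R\<^sup>n\<close> evaluated at the base point. No change of variables is needed.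
\<close>

lemma distr_poisson_eqI:
  assumes "finite_measure \<mu>" "sets \<mu> = sets circle_measure"
    and R: "R analytic_on cball 0 1" "\<And>z. z \<in> circle \<Longrightarrow> R z \<in> circle"
    and moments: "\<And>n. (\<integral>z. z ^ n \<partial>\<mu>) = R (cis \<alpha> / 2) ^ n"
  shows "distr (with_density (poisson \<alpha>)) circle_measure R = \<mu>"
proof (rule finite_measures_on_circle_eqI)
  have Rc: "R analytic_on circle" using R(1) by (rule analytic_on_subset) auto
  have Rm: "R \<in> with_density (poisson \<alpha>) \<rightarrow>\<^sub>M circle_measure"
    using measurable_circle_self_map[OF analytic_on_circle_continuous[OF Rc] R(2)] by simp
  show "finite_measure (distr (with_density (poisson \<alpha>)) circle_measure R)"
    by (intro finite_measure.finite_measure_distr finite_measure_circle_density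
        integrable_poisson AE_poisson_nonneg Rm)
  fix n :: nat
  have "(\<integral>z. z ^ n \<partial>distr (with_density (poisson \<alpha>)) circle_measure R) =
      (\<integral>z. R z ^ n \<partial>with_density (poisson \<alpha>))"
    by (rule integral_distr[OF Rm]) (auto intro!: continuous_measurable_circle continuous_intros)
  also have "\<dots> = R (cis \<alpha> / 2) ^ n"
    by (rule poisson_moment) (intro analytic_intros R)
  finally show "(\<integral>z. z ^ n \<partial>distr (with_density (poisson \<alpha>)) circle_measure R) = (\<integral>z. z ^ n \<partial>\<mu>)"
    using moments by simp
qed (use assms in auto)

lemma distr_twist_base_map:
  "distr (with_density (poisson \<alpha>)) circle_measure (twist \<alpha> \<beta> base_map) = with_density (poisson \<beta>)"
proof (rule distr_poisson_eqI)
  show "finite_measure (with_density (poisson \<beta>))"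
    by (intro finite_measure_circle_density integrable_poisson AE_poisson_nonneg)
  show "twist \<alpha> \<beta> base_map z \<in> circle" if "z \<in> circle" for z
    using that by (intro twist_in_circle) (auto simp: norm_base_map)
  fix n :: nat
  have eq: "twist \<alpha> \<beta> base_map (cis \<alpha> / 2) = cis \<beta> / 2"
    using base_map_half by (simp add: twist_def cis_mult)
  show "(\<integral>z. z ^ n \<partial>with_density (poisson \<beta>)) = twist \<alpha> \<beta> base_map (cis \<alpha> / 2) ^ n"
    unfolding eq by (rule poisson_moment) (intro analytic_intros)
qed (simp_all add: analytic_twist_cball analytic_base_map)

lemma poisson_is_transfer: "is_transfer (twist \<alpha> \<beta> base_map) (poisson \<alpha>) (poisson \<beta>)"
  unfolding is_transfer_def
proof (intro conjI ballI impI integrable_poisson)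
  fix \<phi> :: "complex \<Rightarrow> real" assume \<phi>: "\<phi> \<in> borel_measurable circle_measure"
  have T: "twist \<alpha> \<beta> base_map \<in> circle_measure \<rightarrow>\<^sub>M circle_measure"
    by (intro measurable_twist analytic_base_map_circle) (simp add: norm_base_map)
  have "(\<integral>z. poisson \<beta> z * \<phi> z \<partial>circle_measure) = (\<integral>z. \<phi> z \<partial>with_density (poisson \<beta>))"
    using integral_with_density[OF integrable_poisson AE_poisson_nonneg \<phi>] by simp
  also have "\<dots> = (\<integral>z. \<phi> z \<partial>distr (with_density (poisson \<alpha>)) circle_measure (twist \<alpha> \<beta> base_map))"
    by (simp only: distr_twist_base_map)
  also have "\<dots> = (\<integral>z. \<phi> (twist \<alpha> \<beta> base_map z) \<partial>with_density (poisson \<alpha>))"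
    using T \<phi> by (intro integral_distr) auto
  also have "\<dots> = (\<integral>z. poisson \<alpha> z * \<phi> (twist \<alpha> \<beta> base_map z) \<partial>circle_measure)"
    using integral_with_density[OF integrable_poisson AE_poisson_nonneg measurable_compose[OF T \<phi>]]
    by simp
  finally show "(\<integral>z. poisson \<beta> z * \<phi> z \<partial>circle_measure) =
      (\<integral>z. poisson \<alpha> z * \<phi> (twist \<alpha> \<beta> base_map z) \<partial>circle_measure)" .
qed

lemma poisson_integral_1: "(\<integral>z. poisson \<alpha> z \<partial>circle_measure) = 1"
proof -
  have "(\<lambda>z::complex. 1) analytic_on cball 0 1" by (intro analytic_intros)
  from poisson_integral[OF this, of \<alpha>]
  have "(\<integral>z. complex_of_real (poisson \<alpha> z) \<partial>circle_measure) = 1" by simp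
  then show ?thesis by simp
qed

text \<open>
  In the coordinate \<open>straighten \<alpha>\<close> the fibre map becomes \<open>z \<mapsto> z\<^sup>1\<^sup>0\<close> and the density
  \<open>poisson \<alpha>\<close> becomes that of normalised arc length.
\<close>

abbreviation straighten :: "real \<Rightarrow> complex \<Rightarrow> complex" where
  "straighten \<alpha> \<equiv> twist \<alpha> 0 moebius_inv"

lemma analytic_moebius_circle: "moebius analytic_on circle"
  using analytic_moebius by (rule analytic_on_subset) auto

lemma analytic_moebius_inv_circle: "moebius_inv analytic_on circle"
  using analytic_moebius_inv by (rule analytic_on_subset) auto

lemma straighten_in_circle: "z \<in> circle \<Longrightarrow> straighten \<alpha> z \<in> circle"
  by (intro twist_in_circle) (auto simp: norm_moebius_inv)

lemma straighten_base_map: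
  assumes "z \<in> circle"
  shows "straighten \<beta> (twist \<alpha> \<beta> base_map z) = straighten \<alpha> z ^ 10"
proof -
  have "norm (cis (- \<alpha>) * z) \<le> 1" using assms by (simp add: norm_mult)
  from moebius_inv_base_map[OF this] show ?thesis
    by (simp add: twist_def cis_mult mult.assoc[symmetric])
qed

text \<open>
  The hypotheses say that in the straightened coordinate the measure with density \<open>f\<close> has the
  moments of normalised arc length. So the two images agree, and transporting them back with the
  inverse coordinate shows that the measures themselves agree.
\<close>

lemma poisson_AE_unique:
  assumes f: "integrable circle_measure f" "AE z in circle_measure. 0 \<le> f z"
    and 1: "(\<integral>z. f z \<partial>circle_measure) = 1"
    and moments: "\<And>n. n > 0 \<Longrightarrow> (\<integral>z. of_real (f z) * straighten \<alpha> z ^ n \<partial>circle_measure) = 0"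
  shows "AE z in circle_measure. f z = poisson \<alpha> z"
proof -
  let ?N = "straighten \<alpha>" and ?M = "\<lambda>w. cis \<alpha> * moebius w"
  have N: "?N \<in> circle_measure \<rightarrow>\<^sub>M circle_measure"
    by (intro measurable_twist analytic_moebius_inv_circle) (simp add: norm_moebius_inv)
  have M: "?M \<in> circle_measure \<rightarrow>\<^sub>M circle_measure"
    by (intro measurable_circle_self_map continuous_intros analytic_on_circle_continuous
        analytic_moebius_circle) (simp add: norm_moebius norm_mult)
  have MN: "?M (?N z) = z" if "z \<in> circle" for z
    using moebius_moebius_inv[of "cis (- \<alpha>) * z"] that
    by (simp add: twist_def norm_mult mult.assoc[symmetric] cis_mult)
  have "distr (with_density (poisson \<alpha>)) circle_measure ?N = distr (with_density f) circle_measure ?N"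
  proof (rule distr_poisson_eqI)
    show "finite_measure (distr (with_density f) circle_measure ?N)"
      using N by (intro finite_measure.finite_measure_distr finite_measure_circle_density f) simp
    show "?N analytic_on cball 0 1" by (rule analytic_twist_cball[OF analytic_moebius_inv])
    fix n :: nat
    have Nn: "continuous_on circle (\<lambda>z. ?N z ^ n)"
      by (intro continuous_intros analytic_on_circle_continuous analytic_twist analytic_moebius_inv_circle)
    have "(\<integral>z. z ^ n \<partial>distr (with_density f) circle_measure ?N) = (\<integral>z. ?N z ^ n \<partial>with_density f)"
      by (rule integral_distr) (use N in \<open>auto intro!: continuous_measurable_circle continuous_intros\<close>)
    also have "\<dots> = (\<integral>z. of_real (f z) * ?N z ^ n \<partial>circle_measure)"
      by (rule integral_with_density[OF f continuous_measurable_circle[OF Nn]])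
    also have "\<dots> = 0 ^ n"
      using moments[of n] 1 by (cases "n = 0") auto
    finally show "(\<integral>z. z ^ n \<partial>distr (with_density f) circle_measure ?N) = ?N (cis \<alpha> / 2) ^ n"
      by (simp add: twist_def cis_mult)
    show "?N z \<in> circle" if "z \<in> circle" for z
      by (rule straighten_in_circle[OF that])
  qed simp
  then have "distr (distr (with_density (poisson \<alpha>)) circle_measure ?N) circle_measure ?M =
      distr (distr (with_density f) circle_measure ?N) circle_measure ?M" by simp
  moreover have "distr (distr (with_density g) circle_measure ?N) circle_measure ?M = with_density g" for g
  proof -
    have "distr (distr (with_density g) circle_measure ?N) circle_measure ?M =
        distr (with_density g) circle_measure (?M \<circ> ?N)"
      using N M by (intro distr_distr) auto
    also have "\<dots> = distr (with_density g) (with_density g) (\<lambda>z. z)"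
      using MN by (intro distr_cong) auto
    finally show ?thesis by (simp add: distr_id)
  qed
  ultimately have "with_density f = with_density (poisson \<alpha>)" by simp
  then have "AE z in circle_measure. ennreal (f z) = ennreal (poisson \<alpha> z)"
    by (subst (asm) finite_density_unique)
      (use f integrable_poisson in \<open>auto simp: nn_integral_eq_integral\<close>)
  with f(2) AE_poisson_nonneg[of \<alpha>] show ?thesis
    by eventually_elim (simp add: ennreal_inj)
qed

text \<open>
  The reciprocal of the angular speed \<open>3 / \<bar>2 - y\<bar>\<^sup>2\<close> of \<open>moebius_inv\<close>, written with \<open>inverse y\<close> for
  \<open>cnj y\<close> so as to be analytic. As a weight it turns the angle derivative of \<open>moebius_inv y ^ n\<close> into
  \<open>\<i> n moebius_inv y ^ n\<close>.
\<close>

definition recip_speed :: "complex \<Rightarrow> complex" where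
  "recip_speed y = (2 - y) * (2 - inverse y) / 3"

lemma analytic_recip_speed: "recip_speed analytic_on circle"
  unfolding recip_speed_def[abs_def] by (intro analytic_intros) auto

lemma rot_deriv_moebius_inv_power:
  assumes y: "y \<in> circle"
  shows "rot_deriv (\<lambda>y. moebius_inv y ^ n * recip_speed y) y =
    \<i> * of_nat n * moebius_inv y ^ n + moebius_inv y ^ n * rot_deriv recip_speed y"
proof -
  have ny: "norm y = 1" and nz: "y \<noteq> 0" "2 - y \<noteq> 0" using y moebius_denominators_nonzero[of y] by auto
  have "((\<lambda>y. moebius_inv y ^ n) has_field_derivative of_nat n * (3 / (2 - y)\<^sup>2 * moebius_inv y ^ (n - 1))) (at y)"
    using DERIV_power[OF DERIV_moebius_inv, of y n] ny by simp
  then have "((\<lambda>y. moebius_inv y ^ n * recip_speed y) has_field_derivative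
      (of_nat n * (3 / (2 - y)\<^sup>2 * moebius_inv y ^ (n - 1))) * recip_speed y + deriv recip_speed y * moebius_inv y ^ n) (at y)"
    by (rule DERIV_mult[OF _ DERIV_circle[OF analytic_recip_speed y]])
  from rot_deriv_eqI[OF this]
  have split: "rot_deriv (\<lambda>y. moebius_inv y ^ n * recip_speed y) y =
      \<i> * of_nat n * (moebius_inv y ^ (n - 1) * (y * (3 / (2 - y)\<^sup>2) * recip_speed y))
      + moebius_inv y ^ n * rot_deriv recip_speed y"
    by (simp add: rot_deriv_def algebra_simps)
  have "recip_speed y = (2 - y) * (2 * y - 1) / (3 * y)"
    using nz by (simp add: recip_speed_def divide_simps)
  moreover have "y * (3 / d\<^sup>2) * (d * e / (3 * y)) = e / d" if "d \<noteq> 0" for d e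
    using nz that by (simp add: power2_eq_square)
  ultimately have "y * (3 / (2 - y)\<^sup>2) * recip_speed y = moebius_inv y"
    using nz by (simp add: moebius_inv_def)
  then show ?thesis unfolding split by (cases n) (simp_all add: mult_ac)
qed

text \<open>
  A Riemann-Lebesgue lemma with rate 1/n. Placing the weight on the test function instead of \<open>f\<close>
  avoids a product rule for weak derivatives.
\<close>

lemma straighten_coeff_tendsto_0:
  assumes f: "f \<in> W11"
  shows "(\<lambda>n. \<integral>z. of_real (f z) * straighten \<alpha> z ^ n \<partial>circle_measure) \<longlonglongrightarrow> 0"
proof -
  obtain g where fi: "integrable circle_measure f" and g: "is_weak_deriv f g"
    using f by (auto simp: W11_def)
  have gi: "integrable circle_measure g" by (rule is_weak_deriv_integrable[OF g])
  define r where "r = twist \<alpha> 0 recip_speed"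
  define r' where "r' = twist \<alpha> 0 (rot_deriv recip_speed)"
  define N where "N = straighten \<alpha>"
  have cont: "continuous_on circle r" "continuous_on circle r'" "continuous_on circle N"
    unfolding r_def r'_def N_def
    by (intro analytic_on_circle_continuous analytic_twist analytic_rot_deriv analytic_recip_speed
        analytic_moebius_inv_circle)+
  have normN: "norm (N z) = 1" if "z \<in> circle" for z
    using straighten_in_circle[OF that] by (simp add: N_def del: norm_twist)
  obtain B where B: "\<And>z. z \<in> circle \<Longrightarrow> norm (r z) \<le> B"
    using continuous_bounded_circle[OF cont(1)] by metis
  obtain B' where B': "\<And>z. z \<in> circle \<Longrightarrow> norm (r' z) \<le> B'"
    using continuous_bounded_circle[OF cont(2)] by metis
  define C where "C = B * (\<integral>z. \<bar>g z\<bar> \<partial>circle_measure) + B' * (\<integral>z. \<bar>f z\<bar> \<partial>circle_measure)"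
  let ?c = "\<lambda>n. \<integral>z. of_real (f z) * N z ^ n \<partial>circle_measure"
  have bound: "norm (\<integral>z. of_real (u z) * (N z ^ n * v z) \<partial>circle_measure) \<le> K * (\<integral>z. \<bar>u z\<bar> \<partial>circle_measure)"
    if u: "integrable circle_measure u" and v: "continuous_on circle v" "\<And>z. z \<in> circle \<Longrightarrow> norm (v z) \<le> K"
    for u v K n
  proof -
    have "norm (\<integral>z. of_real (u z) * (N z ^ n * v z) \<partial>circle_measure) \<le> (\<integral>z. K * \<bar>u z\<bar> \<partial>circle_measure)"
    proof (rule Bochner_Integration.integral_norm_bound_integral)
      show "integrable circle_measure (\<lambda>z. of_real (u z) * (N z ^ n * v z))"
        by (intro integrable_on_circle_complex u continuous_intros cont v)
      show "integrable circle_measure (\<lambda>z. K * \<bar>u z\<bar>)" using u by auto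
      fix z assume "z \<in> space circle_measure"
      then have "norm (N z) = 1" "norm (v z) \<le> K" using normN v by auto
      then show "norm (of_real (u z) * (N z ^ n * v z)) \<le> K * \<bar>u z\<bar>"
        by (simp add: norm_mult norm_power mult_left_mono mult.commute[of K])
    qed
    then show ?thesis by simp
  qed
  have est: "real n * norm (?c n) \<le> C" for n
  proof -
    define Q where "Q = twist \<alpha> 0 (\<lambda>y. moebius_inv y ^ n * recip_speed y)"
    have G: "(\<lambda>y. moebius_inv y ^ n * recip_speed y) analytic_on circle"
      by (intro analytic_intros analytic_moebius_inv_circle analytic_recip_speed)
    have Q: "Q analytic_on circle" unfolding Q_def by (rule analytic_twist[OF G])
    have Qz: "Q z = N z ^ n * r z" for z
      by (simp add: Q_def N_def r_def twist_def)
    have rQ: "rot_deriv Q z = \<i> * of_nat n * N z ^ n + N z ^ n * r' z" if z: "z \<in> circle" for z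
      using rot_deriv_moebius_inv_power[OF rotate_in_circle[OF z]]
      by (simp add: Q_def rot_deriv_twist[OF G z]) (simp add: twist_def N_def r'_def)
    have i: "integrable circle_measure (\<lambda>z. of_real (f z) * N z ^ n)"
      "integrable circle_measure (\<lambda>z. of_real (f z) * (N z ^ n * r' z))"
      by (intro integrable_on_circle_complex fi continuous_intros cont)+
    have "(\<integral>z. of_real (f z) * rot_deriv Q z \<partial>circle_measure) =
        (\<integral>z. \<i> * of_nat n * (of_real (f z) * N z ^ n) + of_real (f z) * (N z ^ n * r' z) \<partial>circle_measure)"
      by (rule Bochner_Integration.integral_cong) (simp_all add: rQ algebra_simps)
    also have "\<dots> = \<i> * of_nat n * ?c n + (\<integral>z. of_real (f z) * (N z ^ n * r' z) \<partial>circle_measure)"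
      using i by simp
    finally have "\<i> * of_nat n * ?c n + (\<integral>z. of_real (f z) * (N z ^ n * r' z) \<partial>circle_measure) =
        - (\<integral>z. of_real (g z) * (N z ^ n * r z) \<partial>circle_measure)"
      using is_weak_deriv_complex[OF fi g Q] by (simp only: Qz)
    then have "\<i> * of_nat n * ?c n = - (\<integral>z. of_real (g z) * (N z ^ n * r z) \<partial>circle_measure)
        - (\<integral>z. of_real (f z) * (N z ^ n * r' z) \<partial>circle_measure)"
      by (simp only: eq_diff_eq)
    then have "norm (\<i> * of_nat n * ?c n) \<le> norm (\<integral>z. of_real (g z) * (N z ^ n * r z) \<partial>circle_measure)
        + norm (\<integral>z. of_real (f z) * (N z ^ n * r' z) \<partial>circle_measure)"
      using norm_triangle_ineq4[of "- (\<integral>z. of_real (g z) * (N z ^ n * r z) \<partial>circle_measure)"]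
      by (simp only: norm_minus_cancel)
    also have "\<dots> \<le> C"
      unfolding C_def by (intro add_mono bound gi fi cont B B')
    finally show ?thesis by (simp add: norm_mult)
  qed
  have "(\<lambda>n. ?c n) \<longlonglongrightarrow> 0"
  proof (rule Lim_null_comparison)
    show "\<forall>\<^sub>F n in sequentially. norm (?c n) \<le> C / real n"
      using eventually_gt_at_top[of 0] by eventually_elim (use est in \<open>simp add: field_simps\<close>)
    show "(\<lambda>n. C / real n) \<longlonglongrightarrow> 0" by (rule lim_const_over_n)
  qed
  then show ?thesis by (simp add: N_def)
qed


section \<open>The driving system: a Bernoulli shift\<close>

text \<open>
  The sites are independent with \<open>P (site = n) = 1 / 2 ^ (n + 1)\<close>. The law is chosen so that the
  amplitude \<open>2 ^ site\<close> is not integrable while its logarithm has all moments, and so that it is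
  discrete, which makes measurability with values in function spaces trivial.
\<close>

definition site_law :: "real measure" where
  "site_law = distr (measure_pmf (geometric_pmf (1 / 2))) borel real"

definition bernoulli :: "(int \<Rightarrow> real) measure" where
  "bernoulli = (\<Pi>\<^sub>M i\<in>UNIV. site_law)"

definition translate :: "int \<Rightarrow> (int \<Rightarrow> real) \<Rightarrow> int \<Rightarrow> real" where
  "translate k \<omega> = (\<lambda>i. \<omega> (i + k))"

abbreviation shift :: "(int \<Rightarrow> real) \<Rightarrow> int \<Rightarrow> real" where
  "shift \<equiv> translate 1"

definition site :: "int \<Rightarrow> (int \<Rightarrow> real) \<Rightarrow> nat" where
  "site k \<omega> = nat \<lfloor>\<omega> k\<rfloor>"

lemma prob_space_site_law: "prob_space site_law"
  unfolding site_law_def by (intro prob_space.prob_space_distr measure_pmf.prob_space_axioms) simp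

lemma sets_site_law [measurable_cong]: "sets site_law = sets borel"
  and space_site_law [simp]: "space site_law = UNIV"
  by (simp_all add: site_law_def)

interpretation bernoulli: product_prob_space "\<lambda>_. site_law" "UNIV :: int set"
  by (intro product_prob_spaceI prob_space_site_law)

lemma prob_space_bernoulli: "prob_space bernoulli"
  unfolding bernoulli_def by (rule bernoulli.prob_space_axioms)

interpretation bernoulli_prob: prob_space bernoulli
  by (rule prob_space_bernoulli)

lemma space_bernoulli [simp]: "space bernoulli = UNIV"
  by (simp add: bernoulli_def space_PiM PiE_UNIV_domain)

lemma sets_bernoulli [measurable_cong]: "sets bernoulli = sets borel"
proof -
  have "sets bernoulli = sets (\<Pi>\<^sub>M i\<in>(UNIV :: int set). (borel :: real measure))"
    unfolding bernoulli_def by (intro sets_PiM_cong refl sets_site_law)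
  then show ?thesis by (simp add: sets_PiM_equal_borel)
qed

lemma translate_translate: "translate k (translate l \<omega>) = translate (k + l) \<omega>"
  by (simp add: translate_def add.assoc)

lemma translate_0 [simp]: "translate 0 \<omega> = \<omega>"
  by (simp add: translate_def)

lemma shift_funpow: "(translate k ^^ n) \<omega> = translate (int n * k) \<omega>"
  by (induction n) (simp_all add: translate_translate algebra_simps)

lemma inv_shift: "inv_into UNIV shift = translate (- 1)"
  by (rule inv_equality) (simp_all add: translate_translate)

lemma site_translate: "site i (translate k \<omega>) = site (i + k) \<omega>"
  by (simp add: site_def translate_def)

lemma continuous_translate: "continuous_on UNIV (translate k)"
  unfolding translate_def[abs_def]
  by (intro continuous_on_coordinatewise_then_product continuous_on_product_coordinates)

lemma measurable_translate [measurable]: "translate k \<in> bernoulli \<rightarrow>\<^sub>M bernoulli"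
proof -
  have "translate k \<in> borel_measurable borel"
    by (intro borel_measurable_continuous_onI continuous_translate)
  then show ?thesis using measurable_cong_sets[OF sets_bernoulli sets_bernoulli] by blast
qed

lemma distr_translate: "distr bernoulli bernoulli (translate k) = bernoulli"
proof -
  have "distr (Pi\<^sub>M UNIV (\<lambda>_. site_law)) (\<Pi>\<^sub>M i\<in>UNIV. site_law) (\<lambda>\<omega>. \<lambda>n\<in>UNIV. \<omega> (n + k)) =
      (\<Pi>\<^sub>M i\<in>UNIV. site_law)"
    by (rule distr_PiM_reindex) (auto intro: prob_space_site_law injI)
  then show ?thesis by (simp add: bernoulli_def translate_def[abs_def] restrict_def)
qed

lemma measure_vimage_translate:
  assumes "A \<in> sets bernoulli"
  shows "measure bernoulli (translate k -` A) = measure bernoulli A"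
proof -
  have "measure bernoulli A = measure (distr bernoulli bernoulli (translate k)) A"
    by (simp only: distr_translate)
  also have "\<dots> = measure bernoulli (translate k -` A)"
    using assms by (subst measure_distr) auto
  finally show ?thesis by simp
qed

lemma vimage_translate_sets: "A \<in> sets bernoulli \<Longrightarrow> translate k -` A \<in> sets bernoulli"
  using measurable_sets[OF measurable_translate, of A k] by simp

definition cylinders :: "(int \<Rightarrow> real) set set" where
  "cylinders = prod_algebra UNIV (\<lambda>_. site_law)"

lemma sets_bernoulli_cylinders: "sets bernoulli = sigma_sets UNIV cylinders"
  unfolding bernoulli_def cylinders_def sets_PiM by (simp add: PiE_UNIV_domain)

lemma cylinderE:
  assumes "C \<in> cylinders"
  obtains J E where "finite J" "\<And>i. i \<in> J \<Longrightarrow> E i \<in> sets site_law" "C = {\<omega>. \<forall>i\<in>J. \<omega> i \<in> E i}"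
proof -
  obtain J E where J: "C = prod_emb UNIV (\<lambda>_. site_law) J (Pi\<^sub>E J E)" "finite J"
    "\<And>i. i \<in> J \<Longrightarrow> E i \<in> sets site_law"
    using assms unfolding cylinders_def by (rule prod_algebraE) blast
  have "C = {\<omega>. \<forall>i\<in>J. \<omega> i \<in> E i}"
    unfolding J(1) by (auto simp: prod_emb_def PiE_def Pi_def extensional_def restrict_def)
  with J that show ?thesis by blast
qed

lemma measure_cylinder:
  assumes "finite J" "\<And>i. i \<in> J \<Longrightarrow> E i \<in> sets site_law"
  shows "measure bernoulli {\<omega>. \<forall>i\<in>J. \<omega> i \<in> E i} = (\<Prod>i\<in>J. measure site_law (E i))"
proof -
  have "{\<omega>. \<forall>i\<in>J. \<omega> i \<in> E i} = prod_emb UNIV (\<lambda>_. site_law) J (Pi\<^sub>E J E)"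
    by (auto simp: prod_emb_def PiE_def Pi_def extensional_def restrict_def)
  then show ?thesis
    unfolding bernoulli_def using bernoulli.measure_PiM_emb[OF _ assms] by simp
qed

text \<open>Far translates of a cylinder involve other coordinates.\<close>

lemma cylinders_mixing:
  assumes "C \<in> cylinders" "B \<in> cylinders"
  shows "eventually (\<lambda>n. measure bernoulli (C \<inter> translate (int n) -` B) = measure bernoulli C * measure bernoulli B) sequentially"
proof -
  obtain J E where C: "finite J" "\<And>i. i \<in> J \<Longrightarrow> E i \<in> sets site_law" "C = {\<omega>. \<forall>i\<in>J. \<omega> i \<in> E i}"
    using assms(1) by (rule cylinderE) blast
  obtain K F where B: "finite K" "\<And>i. i \<in> K \<Longrightarrow> F i \<in> sets site_law" "B = {\<omega>. \<forall>i\<in>K. \<omega> i \<in> F i}"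
    using assms(2) by (rule cylinderE) blast
  define m where "m = (\<Sum>i\<in>J \<union> K. \<bar>i\<bar>)"
  have m: "\<bar>i\<bar> \<le> m" if "i \<in> J \<union> K" for i
    unfolding m_def using C(1) B(1) that by (intro member_le_sum[of i "J \<union> K" abs]) auto
  have "measure bernoulli (C \<inter> translate (int n) -` B) = measure bernoulli C * measure bernoulli B"
    if n: "n > nat (2 * m)" for n
  proof -
    define K' where "K' = (\<lambda>i. i + int n) ` K"
    define H where "H i = (if i \<in> J then E i else F (i - int n))" for i
    have "int n > 2 * m" using n by linarith
    then have disj: "i + int n \<notin> J" if "i \<in> K" for i
      using m[of i] m[of "i + int n"] that by auto
    then have "J \<inter> K' = {}" by (auto simp: K'_def)
    have H: "i \<in> J \<Longrightarrow> H i = E i" "i \<in> K \<Longrightarrow> H (i + int n) = F i" for i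
      using disj by (auto simp: H_def)
    have "C \<inter> translate (int n) -` B = {\<omega>. \<forall>i\<in>J \<union> K'. \<omega> i \<in> H i}"
      unfolding C(3) B(3) K'_def translate_def ball_Un ball_simps vimage_def
      by (auto simp: H)
    also have "measure bernoulli \<dots> = (\<Prod>i\<in>J \<union> K'. measure site_law (H i))"
      using C B disj by (intro measure_cylinder) (auto simp: K'_def H_def)
    also have "\<dots> = (\<Prod>i\<in>J. measure site_law (H i)) * (\<Prod>i\<in>K'. measure site_law (H i))"
      using C(1) B(1) \<open>J \<inter> K' = {}\<close> by (intro prod.union_disjoint) (auto simp: K'_def)
    also have "(\<Prod>i\<in>J. measure site_law (H i)) = measure bernoulli C"
      by (simp add: C measure_cylinder H_def)
    also have "(\<Prod>i\<in>K'. measure site_law (H i)) = (\<Prod>i\<in>K. measure site_law (F i))"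
      unfolding K'_def by (subst prod.reindex) (use disj in \<open>auto simp: H_def inj_on_def intro!: prod.cong\<close>)
    also have "\<dots> = measure bernoulli B" by (simp add: B measure_cylinder)
    finally show ?thesis .
  qed
  then show ?thesis by (rule eventually_mono[OF eventually_gt_at_top[of "nat (2 * m)"]])
qed

lemma cylinder_sets: "C \<in> cylinders \<Longrightarrow> C \<in> sets bernoulli"
  unfolding sets_bernoulli_cylinders by (rule sigma_sets.Basic)

text \<open>
  For fixed \<open>C\<close> the sets \<open>B\<close> with this property form a Dynkin system; countable disjoint unions
  are handled by dominated convergence for series, since translations preserve the measure.
\<close>

lemma mixing:
  assumes C: "C \<in> cylinders" and B: "B \<in> sets bernoulli"
  shows "(\<lambda>n. measure bernoulli (C \<inter> translate (int n) -` B)) \<longlonglongrightarrow> measure bernoulli C * measure bernoulli B"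
proof -
  have Cs: "C \<in> sets bernoulli" by (rule cylinder_sets[OF C])
  have "Int_stable cylinders" unfolding cylinders_def by (rule Int_stable_prod_algebra)
  moreover have "cylinders \<subseteq> Pow UNIV" by simp
  moreover have "B \<in> sigma_sets UNIV cylinders" using B by (simp add: sets_bernoulli_cylinders)
  ultimately show ?thesis
  proof (induction rule: sigma_sets_induct_disjoint)
    case (basic B)
    show ?case by (rule tendsto_eventually[OF cylinders_mixing[OF C basic]])
  next
    case empty
    then show ?case by simp
  next
    case (compl B)
    then have Bs: "B \<in> sets bernoulli" by (simp add: sets_bernoulli_cylinders)
    have "measure bernoulli (C \<inter> translate (int n) -` (UNIV - B)) =
        measure bernoulli C - measure bernoulli (C \<inter> translate (int n) -` B)" for n
    proof -
      have "C \<inter> translate (int n) -` (UNIV - B) = C - C \<inter> translate (int n) -` B" by auto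
      then show ?thesis
        using Cs vimage_translate_sets[OF Bs] by (simp add: bernoulli_prob.finite_measure_Diff)
    qed
    moreover have "measure bernoulli (UNIV - B) = 1 - measure bernoulli B"
      using bernoulli_prob.prob_compl[OF Bs] by simp
    ultimately show ?case
      using tendsto_diff[OF tendsto_const compl.IH, of "measure bernoulli C"] by (simp add: right_diff_distrib)
  next
    case (union A)
    then have As: "A k \<in> sets bernoulli" for k by (auto simp: sets_bernoulli_cylinders)
    define a where "a k n = measure bernoulli (C \<inter> translate (int n) -` A k)" for k n
    define b where "b k = measure bernoulli C * measure bernoulli (A k)" for k
    have disj: "disjoint_family A" using union.hyps by blast
    have sumA: "(\<lambda>k. measure bernoulli (A k)) sums measure bernoulli (\<Union>k. A k)"
      using As disj by (intro bernoulli_prob.finite_measure_UNION) auto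
    have a_le: "norm (a k n) \<le> measure bernoulli (A k)" for k n
    proof -
      have "a k n \<le> measure bernoulli (translate (int n) -` A k)"
        unfolding a_def by (intro bernoulli_prob.finite_measure_mono vimage_translate_sets As) auto
      then show ?thesis by (simp add: measure_vimage_translate[OF As] a_def)
    qed
    have "(\<lambda>n. suminf (\<lambda>k. a k n)) \<longlonglongrightarrow> suminf b"
    proof (rule tannerys_theorem[THEN conjunct2, THEN conjunct2])
      show "a k \<longlonglongrightarrow> b k" for k
        using union.IH[of k] by (simp add: a_def[abs_def] b_def)
      show "\<forall>\<^sub>F (k, n) in sequentially \<times>\<^sub>F sequentially. norm (a k n) \<le> measure bernoulli (A k)"
        using a_le by (intro always_eventually) auto
      show "summable (\<lambda>k. measure bernoulli (A k))" by (rule sums_summable[OF sumA])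
    qed simp
    moreover have "suminf (\<lambda>k. a k n) = measure bernoulli (C \<inter> translate (int n) -` (\<Union>k. A k))" for n
    proof -
      have "(\<lambda>k. a k n) sums measure bernoulli (\<Union>k. C \<inter> translate (int n) -` A k)"
        unfolding a_def
      proof (rule bernoulli_prob.finite_measure_UNION)
        show "range (\<lambda>k. C \<inter> translate (int n) -` A k) \<subseteq> sets bernoulli"
          using As Cs vimage_translate_sets by blast
        show "disjoint_family (\<lambda>k. C \<inter> translate (int n) -` A k)"
          using disj unfolding disjoint_family_on_def by blast
      qed
      then have "suminf (\<lambda>k. a k n) = measure bernoulli (\<Union>k. C \<inter> translate (int n) -` A k)"
        by (rule sums_unique[symmetric])
      also have "(\<Union>k. C \<inter> translate (int n) -` A k) = C \<inter> translate (int n) -` (\<Union>k. A k)"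
        by blast
      finally show ?thesis .
    qed
    moreover have "suminf b = measure bernoulli C * measure bernoulli (\<Union>k. A k)"
      unfolding b_def by (rule sums_unique[symmetric, OF sums_mult[OF sumA]])
    ultimately show ?case by simp
  qed
qed

text \<open>
  Mixing makes an invariant set independent of all cylinders, hence of every measurable set and in
  particular of itself.
\<close>

lemma shift_ergodic:
  assumes A: "A \<in> sets bernoulli" and inv: "shift -` A = A"
  shows "measure bernoulli A = 0 \<or> measure bernoulli A = 1"
proof -
  have inv': "translate (int n) -` A = A" for n
  proof (induction n)
    case (Suc n)
    have "translate (int (Suc n)) -` A = translate (int n) -` (shift -` A)"
      by (auto simp: translate_translate)
    then show ?case using Suc inv by simp
  qed simp
  have cyl: "measure bernoulli (A \<inter> C) = measure bernoulli A * measure bernoulli C" if "C \<in> cylinders" for C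
    using mixing[OF that A] by (simp add: inv' LIMSEQ_const_iff Int_commute mult.commute)
  have "bernoulli_prob.indep_set {A} cylinders"
    using A cyl by (intro bernoulli_prob.indep_setI) (auto simp: cylinder_sets)
  then have "bernoulli_prob.indep_set (sigma_sets (space bernoulli) {A}) (sigma_sets (space bernoulli) cylinders)"
    by (rule bernoulli_prob.indep_set_sigma_sets)
      (auto simp: Int_stable_def cylinders_def intro: Int_stable_prod_algebra[unfolded Int_stable_def, rule_format])
  then have "measure bernoulli (A \<inter> A) = measure bernoulli A * measure bernoulli A"
    using A by (intro bernoulli_prob.indep_setD[of "sigma_sets (space bernoulli) {A}"
          "sigma_sets (space bernoulli) cylinders"]) (auto simp: sets_bernoulli_cylinders)
  then show ?thesis by simp
qed

lemma driving_system_shift: "driving_system UNIV bernoulli shift"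
  unfolding driving_system_def
proof (intro conjI)
  show "homeomorphism UNIV UNIV shift (inv_into UNIV shift)"
    unfolding inv_shift
  proof (rule homeomorphismI)
    show "continuous_on UNIV shift" "continuous_on UNIV (translate (- 1))"
      by (rule continuous_translate)+
  qed (auto simp: translate_translate)
  show "\<forall>A\<in>sets bernoulli. shift -` A \<inter> space bernoulli = A \<longrightarrow>
      measure bernoulli A = 0 \<or> measure bernoulli A = 1"
    using shift_ergodic by simp
qed (simp_all add: prob_space_bernoulli distr_translate sets_bernoulli)

lemma measurable_site [measurable]: "site k \<in> bernoulli \<rightarrow>\<^sub>M count_space UNIV"
proof -
  have "(\<lambda>\<omega>. \<omega> k) \<in> bernoulli \<rightarrow>\<^sub>M site_law" unfolding bernoulli_def by measurable
  then have [measurable]: "(\<lambda>\<omega>. \<omega> k) \<in> borel_measurable bernoulli"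
    using measurable_cong_sets[OF refl sets_site_law] by blast
  show ?thesis unfolding site_def[abs_def] by measurable
qed

lemma distr_site: "distr bernoulli (count_space UNIV) (site k) = measure_pmf (geometric_pmf (1 / 2))"
proof -
  have c: "(\<lambda>\<omega>. \<omega> k) \<in> bernoulli \<rightarrow>\<^sub>M site_law" unfolding bernoulli_def by measurable
  have f: "(\<lambda>x::real. nat \<lfloor>x\<rfloor>) \<in> borel \<rightarrow>\<^sub>M count_space UNIV" by measurable
  have "distr bernoulli (count_space UNIV) (site k) =
      distr (distr bernoulli site_law (\<lambda>\<omega>. \<omega> k)) (count_space UNIV) (\<lambda>x. nat \<lfloor>x\<rfloor>)"
    using f by (subst distr_distr[OF _ c]) (auto simp: site_def[abs_def] o_def measurable_cong_sets[OF sets_site_law refl])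
  also have "distr bernoulli site_law (\<lambda>\<omega>. \<omega> k) = site_law"
    unfolding bernoulli_def by (rule distr_PiM_component) (auto intro: prob_space_site_law)
  also have "distr site_law (count_space UNIV) (\<lambda>x. nat \<lfloor>x\<rfloor>) = distr (measure_pmf (geometric_pmf (1 / 2))) (count_space UNIV) (\<lambda>n. n)"
    unfolding site_law_def using f by (subst distr_distr) (auto simp: o_def)
  also have "\<dots> = measure_pmf (geometric_pmf (1 / 2))" by (rule distr_id2) simp
  finally show ?thesis .
qed

lemma nn_integral_site:
  "(\<integral>\<^sup>+\<omega>. ennreal (f (site k \<omega>)) \<partial>bernoulli) = (\<Sum>n. ennreal ((1 / 2) ^ Suc n) * ennreal (f n))"
proof -
  have "(\<integral>\<^sup>+\<omega>. ennreal (f (site k \<omega>)) \<partial>bernoulli) = (\<integral>\<^sup>+n. ennreal (f n) \<partial>measure_pmf (geometric_pmf (1 / 2)))"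
    unfolding distr_site[of k, symmetric] by (subst nn_integral_distr) auto
  also have "\<dots> = (\<integral>\<^sup>+n. ennreal ((1 / 2) ^ Suc n) * ennreal (f n) \<partial>count_space UNIV)"
    by (subst nn_integral_measure_pmf) (simp add: mult.commute)
  finally show ?thesis by (simp only: nn_integral_count_space_nat)
qed

lemma integrable_site: "integrable bernoulli (\<lambda>\<omega>. real (site k \<omega>))"
proof -
  have "integrable (distr bernoulli (count_space UNIV) (site k)) real"
    unfolding distr_site by (rule integrable_real_geometric_pmf) auto
  then show ?thesis by (subst (asm) integrable_distr_eq) auto
qed

lemma nn_integral_exp_site: "(\<integral>\<^sup>+\<omega>. ennreal (2 ^ site k \<omega>) \<partial>bernoulli) = \<infinity>"
proof -
  have "(\<integral>\<^sup>+\<omega>. ennreal (2 ^ site k \<omega>) \<partial>bernoulli) = (\<Sum>n. ennreal ((1 / 2) ^ Suc n) * ennreal (2 ^ n))"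
    by (rule nn_integral_site)
  also have "(\<lambda>n. ennreal ((1 / 2) ^ Suc n) * ennreal (2 ^ n)) = (\<lambda>n. ennreal (1 / 2))"
    by (subst ennreal_mult[symmetric]) (auto simp: power_divide)
  also have "(\<Sum>n. ennreal (1 / 2)) = \<infinity>"
  proof (rule ccontr)
    assume "(\<Sum>n::nat. ennreal (1 / 2)) \<noteq> \<infinity>"
    then have "summable (\<lambda>n::nat. 1 / 2 :: real)" by (intro summable_suminf_not_top) auto
    then show False by (simp add: summable_const_iff)
  qed
  finally show ?thesis .
qed

lemma nn_integral_site_square: "(\<integral>\<^sup>+\<omega>. ennreal ((real (site k \<omega>))\<^sup>2) \<partial>bernoulli) < \<infinity>"
proof -
  have summable: "summable (\<lambda>n. (1 / 2) ^ Suc n * (real n)\<^sup>2)"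
  proof (rule summable_comparison_test_bigo)
    show "(\<lambda>n. (1 / 2) ^ Suc n * (real n)\<^sup>2) \<in> O(\<lambda>n. (3 / 4) ^ n)" by real_asymp
    show "summable (\<lambda>n. norm ((3 / 4 :: real) ^ n))" by simp
  qed
  have "(\<integral>\<^sup>+\<omega>. ennreal ((real (site k \<omega>))\<^sup>2) \<partial>bernoulli) =
      (\<Sum>n. ennreal ((1 / 2) ^ Suc n) * ennreal ((real n)\<^sup>2))"
    by (rule nn_integral_site)
  also have "\<dots> = (\<Sum>n. ennreal ((1 / 2) ^ Suc n * (real n)\<^sup>2))"
    by (intro suminf_cong ennreal_mult[symmetric]) auto
  also have "\<dots> = ennreal (\<Sum>n. (1 / 2) ^ Suc n * (real n)\<^sup>2)"
    by (rule suminf_ennreal2[OF _ summable]) auto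
  finally show ?thesis by simp
qed

text \<open>
  The series of \<open>(site (\<kappa> n) / n)\<^sup>2\<close> has finite expectation, because all sites have the same finite
  second moment, so almost surely it converges and its terms tend to 0.
\<close>

lemma site_sublinear:
  "AE \<omega> in bernoulli. (\<lambda>n. real (site (\<kappa> n) \<omega>) / real n) \<longlonglongrightarrow> 0"
proof -
  define m where "m = (\<integral>\<^sup>+\<omega>. ennreal ((real (site 0 \<omega>))\<^sup>2) \<partial>bernoulli)"
  have m: "(\<integral>\<^sup>+\<omega>. ennreal ((real (site k \<omega>))\<^sup>2) \<partial>bernoulli) = m" for k
    unfolding m_def using nn_integral_site[of "\<lambda>n. (real n)\<^sup>2"] by simp
  have "(\<integral>\<^sup>+\<omega>. (\<Sum>n. ennreal ((real (site (\<kappa> n) \<omega>) / real n)\<^sup>2)) \<partial>bernoulli) =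
      (\<Sum>n. \<integral>\<^sup>+\<omega>. ennreal ((real (site (\<kappa> n) \<omega>) / real n)\<^sup>2) \<partial>bernoulli)"
    by (rule nn_integral_suminf) measurable
  also have "\<dots> = (\<Sum>n. ennreal (1 / (real n)\<^sup>2) * m)"
  proof -
    have "(\<integral>\<^sup>+\<omega>. ennreal ((real (site (\<kappa> n) \<omega>) / real n)\<^sup>2) \<partial>bernoulli) = ennreal (1 / (real n)\<^sup>2) * m" for n
    proof -
      have "(\<integral>\<^sup>+\<omega>. ennreal ((real (site (\<kappa> n) \<omega>) / real n)\<^sup>2) \<partial>bernoulli) =
          (\<integral>\<^sup>+\<omega>. ennreal (1 / (real n)\<^sup>2) * ennreal ((real (site (\<kappa> n) \<omega>))\<^sup>2) \<partial>bernoulli)"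
        by (intro nn_integral_cong) (simp add: ennreal_mult[symmetric] power_divide)
      then show ?thesis by (simp add: nn_integral_cmult m)
    qed
    then show ?thesis by simp
  qed
  also have "\<dots> = ennreal (\<Sum>n. 1 / (real n)\<^sup>2) * m"
  proof -
    have "summable (\<lambda>n. 1 / (real n)\<^sup>2)"
      using inverse_power_summable[of 2, where 'a = real] by (simp add: divide_inverse)
    then have "(\<Sum>n. ennreal (1 / (real n)\<^sup>2)) = ennreal (\<Sum>n. 1 / (real n)\<^sup>2)"
      by (intro suminf_ennreal2) auto
    then show ?thesis by (simp only: ennreal_suminf_multc)
  qed
  also have "\<dots> < \<infinity>"
    using nn_integral_site_square[of 0] by (simp add: m_def ennreal_mult_less_top)
  finally have "AE \<omega> in bernoulli. (\<Sum>n. ennreal ((real (site (\<kappa> n) \<omega>) / real n)\<^sup>2)) \<noteq> \<infinity>"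
    by (intro nn_integral_noteq_infinite) auto
  then show ?thesis
  proof eventually_elim
    case (elim \<omega>)
    then have "summable (\<lambda>n. (real (site (\<kappa> n) \<omega>) / real n)\<^sup>2)"
      by (intro summable_suminf_not_top) auto
    from tendsto_real_sqrt[OF summable_LIMSEQ_zero[OF this]] show ?case by simp
  qed
qed


section \<open>The cocycle\<close>

text \<open>
  Parameter derivatives of \<open>\<epsilon> \<mapsto> twist (\<epsilon> * a) (\<epsilon> * b) G\<close> are twists of such combinations: one
  derivative replaces \<open>G\<close> by \<open>\<i> b G - a rot_deriv G\<close>. Order two suffices for the cocycle conditions.
\<close>

definition rot_comb :: "complex \<Rightarrow> complex \<Rightarrow> complex \<Rightarrow> (complex \<Rightarrow> complex) \<Rightarrow> complex \<Rightarrow> complex" where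
  "rot_comb c0 c1 c2 G z = c0 * G z + c1 * rot_deriv G z + c2 * rot_deriv (rot_deriv G) z"

lemma analytic_rot_comb: "G analytic_on circle \<Longrightarrow> rot_comb c0 c1 c2 G analytic_on circle"
  unfolding rot_comb_def[abs_def] by (intro analytic_intros)

lemma rot_deriv_rot_comb:
  assumes G: "G analytic_on circle" and z: "z \<in> circle"
  shows "rot_deriv (rot_comb c0 c1 c2 G) z = rot_comb c0 c1 c2 (rot_deriv G) z"
proof -
  have "(rot_comb c0 c1 c2 G has_field_derivative
      c0 * deriv G z + c1 * deriv (rot_deriv G) z + c2 * deriv (rot_deriv (rot_deriv G)) z) (at z)"
    unfolding rot_comb_def[abs_def]
    by (intro DERIV_add DERIV_cmult DERIV_circle analytic_rot_deriv G z)
  from rot_deriv_eqI[OF this] show ?thesis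
    by (simp add: rot_comb_def rot_deriv_def[of "rot_deriv (rot_deriv G)"] rot_deriv_def[of "rot_deriv G"]
        rot_deriv_def[of G] algebra_simps)
qed

lemma circle_deriv_iter_twist_rot_comb:
  assumes G: "G analytic_on circle" and z: "z \<in> circle"
    and f: "\<And>z. z \<in> circle \<Longrightarrow> f z = twist \<alpha> \<beta> (rot_comb c0 c1 c2 G) z"
  shows "(circle_deriv ^^ j) f z = twist \<alpha> \<beta> (rot_comb c0 c1 c2 ((rot_deriv ^^ j) G)) z"
  using z
proof (induction j arbitrary: z)
  case (Suc j)
  let ?G = "(rot_deriv ^^ j) G"
  have a: "?G analytic_on circle" by (rule analytic_rot_deriv_iter[OF G])
  have "circle_deriv ((circle_deriv ^^ j) f) z = rot_deriv (twist \<alpha> \<beta> (rot_comb c0 c1 c2 ?G)) z"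
    using circle_deriv_analytic(1)[OF bounded_linear_ident analytic_twist[OF analytic_rot_comb[OF a]] Suc.IH Suc.prems] .
  also have "\<dots> = twist \<alpha> \<beta> (rot_deriv (rot_comb c0 c1 c2 ?G)) z"
    by (rule rot_deriv_twist[OF analytic_rot_comb[OF a] Suc.prems])
  also have "\<dots> = twist \<alpha> \<beta> (rot_comb c0 c1 c2 (rot_deriv ?G)) z"
    by (simp only: twist_def rot_deriv_rot_comb[OF a rotate_in_circle[OF Suc.prems]])
  finally show ?case by simp
qed (use f in simp)

lemma has_vector_derivative_twist_param:
  assumes G: "G analytic_on circle" and z: "z \<in> circle"
  shows "((\<lambda>e. twist (e * a) (e * b) G z) has_vector_derivative
      twist (\<epsilon> * a) (\<epsilon> * b) (rot_comb (\<i> * of_real b) (- of_real a) 0 G) z) (at \<epsilon> within I)"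
proof -
  have "((\<lambda>e. - (e * a)) has_vector_derivative - a) (at \<epsilon>)"
    by (auto intro!: derivative_eq_intros simp: has_real_derivative_iff_has_vector_derivative[symmetric])
  from vector_diff_chain_at[OF this has_vector_derivative_rotate[OF G z]]
  have 1: "((\<lambda>e. G (cis (- (e * a)) * z)) has_vector_derivative (- a) *\<^sub>R rot_deriv G (cis (- (\<epsilon> * a)) * z)) (at \<epsilon>)"
    by (simp add: o_def mult.commute)
  have 2: "((\<lambda>e. cis (e * b)) has_vector_derivative \<i> * of_real b * cis (\<epsilon> * b)) (at \<epsilon>)"
    unfolding has_vector_derivative_def
    using has_derivative_cis[OF has_derivative_mult_left[OF has_derivative_ident, of b], of \<epsilon> UNIV]
    by (simp add: scaleR_conv_of_real mult_ac)
  have "((\<lambda>e. twist (e * a) (e * b) G z) has_vector_derivative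
      cis (\<epsilon> * b) * ((- a) *\<^sub>R rot_deriv G (cis (- (\<epsilon> * a)) * z)) +
      \<i> * of_real b * cis (\<epsilon> * b) * G (cis (- (\<epsilon> * a)) * z)) (at \<epsilon>)"
    unfolding twist_def by (rule has_vector_derivative_mult[OF 2 1])
  also have "cis (\<epsilon> * b) * ((- a) *\<^sub>R rot_deriv G (cis (- (\<epsilon> * a)) * z)) +
      \<i> * of_real b * cis (\<epsilon> * b) * G (cis (- (\<epsilon> * a)) * z) =
      twist (\<epsilon> * a) (\<epsilon> * b) (rot_comb (\<i> * of_real b) (- of_real a) 0 G) z"
    by (simp add: twist_def rot_comb_def scaleR_conv_of_real algebra_simps)
  finally show ?thesis by (rule has_vector_derivative_at_within)
qed

lemma param_interval_nontrivial:
  assumes "param_interval I" "\<epsilon> \<in> I"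
  shows "at \<epsilon> within I \<noteq> bot"
proof -
  have "connected I" using assms by (simp add: param_interval_def is_interval_connected)
  moreover have "\<not> (\<exists>x. I = {x})" using assms by (auto simp: param_interval_def)
  ultimately have "\<epsilon> islimpt I" using connected_imp_perfect assms(2) by blast
  then show ?thesis by (simp add: trivial_limit_within)
qed

lemma param_deriv_twist:
  assumes I: "param_interval I" and G: "G analytic_on circle"
    and F: "\<And>e z. e \<in> I \<Longrightarrow> z \<in> circle \<Longrightarrow> F e z = twist (e * a) (e * b) G z"
    and mem: "\<epsilon> \<in> I" "z \<in> circle"
  shows "(\<lambda>e. F e z) differentiable (at \<epsilon> within I)"
    and "param_deriv I F \<epsilon> z = twist (\<epsilon> * a) (\<epsilon> * b) (rot_comb (\<i> * of_real b) (- of_real a) 0 G) z"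
proof -
  have *: "((\<lambda>e. F e z) has_vector_derivative
      twist (\<epsilon> * a) (\<epsilon> * b) (rot_comb (\<i> * of_real b) (- of_real a) 0 G) z) (at \<epsilon> within I)"
    by (rule has_vector_derivative_transform[OF mem(1) _ has_vector_derivative_twist_param[OF G mem(2)]])
      (use F mem in auto)
  then show "(\<lambda>e. F e z) differentiable (at \<epsilon> within I)" by (rule differentiableI_vector)
  show "param_deriv I F \<epsilon> z = twist (\<epsilon> * a) (\<epsilon> * b) (rot_comb (\<i> * of_real b) (- of_real a) 0 G) z"
    unfolding param_deriv_def by (rule vector_derivative_within[OF param_interval_nontrivial[OF I mem(1)] *])
qed

text \<open>
  The function \<open>F\<close> is only assumed to agree with the twists on \<open>I \<times> circle\<close>, so that the
  induction hypothesis applies to its derivatives, which are known only there.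
\<close>

lemma C_k_on_twist:
  assumes I: "param_interval I" and G: "G analytic_on circle"
    and F: "\<And>e z. e \<in> I \<Longrightarrow> z \<in> circle \<Longrightarrow> F e z = twist (e * a) (e * b) G z"
  shows "C_k_on k I F"
proof -
  have continuous: "continuous_on (I \<times> circle) (\<lambda>(\<epsilon>, z). F \<epsilon> z)"
    if G: "G analytic_on circle"
      and F: "\<And>e z. e \<in> I \<Longrightarrow> z \<in> circle \<Longrightarrow> F e z = twist (e * a) (e * b) G z" for F G
  proof -
    have "continuous_on (I \<times> circle) (\<lambda>p. cis (fst p * b) * G (cis (- (fst p * a)) * snd p))"
      by (intro continuous_intros continuous_on_compose2[OF analytic_on_circle_continuous[OF G]])
        (auto simp: norm_mult)
    then show ?thesis
      using F by (auto simp: twist_def split_beta elim!: continuous_on_eq)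
  qed
  show ?thesis
    using G F
  proof (induction k arbitrary: G F)
    case (0 G F)
    then show ?case using continuous by simp
  next
    case (Suc k G F)
    have "continuous_on (I \<times> circle) (\<lambda>(\<epsilon>, z). F \<epsilon> z)"
      by (rule continuous[OF Suc.prems])
    moreover have "(\<lambda>e. F e z) differentiable (at \<epsilon> within I)" if "\<epsilon> \<in> I" "z \<in> circle" for \<epsilon> z
      by (rule param_deriv_twist(1)[OF I Suc.prems that])
    moreover have "(\<lambda>t. F \<epsilon> (z * cis t)) differentiable (at 0)"
      and "circle_deriv (F \<epsilon>) z = twist (\<epsilon> * a) (\<epsilon> * b) (rot_deriv G) z" if "\<epsilon> \<in> I" "z \<in> circle" for \<epsilon> z
    proof -
      note * = circle_deriv_analytic[OF bounded_linear_ident analytic_twist[OF Suc.prems(1)]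
          Suc.prems(2)[OF that(1)] that(2)]
      show "(\<lambda>t. F \<epsilon> (z * cis t)) differentiable (at 0)" by (rule *(2))
      show "circle_deriv (F \<epsilon>) z = twist (\<epsilon> * a) (\<epsilon> * b) (rot_deriv G) z"
        using *(1) rot_deriv_twist[OF Suc.prems(1) that(2)] by simp
    qed
    moreover from this(2) have "C_k_on k I (angle_deriv F)"
      by (intro Suc.IH[OF analytic_rot_deriv[OF Suc.prems(1)]]) (simp add: angle_deriv_def)
    moreover have "C_k_on k I (param_deriv I F)"
      by (rule Suc.IH[OF analytic_rot_comb[OF Suc.prems(1)] param_deriv_twist(2)[OF I Suc.prems]])
    ultimately show ?case by simp
  qed
qed

lemma twist_base_map_C_maps:
  assumes "param_interval I"
  shows "(\<lambda>\<epsilon>. twist (\<epsilon> * a) (\<epsilon> * b) base_map) \<in> C_maps r I"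
  unfolding C_maps_def
  using C_k_on_twist[OF assms analytic_base_map_circle refl] twist_in_circle[of base_map] norm_base_map
  by auto

lemma circle_C_norm_le:
  assumes "\<And>j z. j \<le> k \<Longrightarrow> z \<in> circle \<Longrightarrow> norm ((circle_deriv ^^ j) f z) \<le> B"
  shows "circle_C_norm k f \<le> B"
  unfolding circle_C_norm_def
proof (rule cSUP_least)
  have "(0, 1) \<in> {..k} \<times> circle" by simp
  then show "{..k} \<times> circle \<noteq> {}" by blast
qed (use assms in auto)

lemma base_map_bound:
  obtains B where "B > 0" "\<And>m z. m \<le> k \<Longrightarrow> z \<in> circle \<Longrightarrow> norm ((rot_deriv ^^ m) base_map z) \<le> B"
proof -
  have "\<exists>B>0. \<forall>z\<in>circle. norm ((rot_deriv ^^ m) base_map z) \<le> B" for m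
    by (rule continuous_bounded_circle[OF analytic_on_circle_continuous[OF
        analytic_rot_deriv_iter[OF analytic_base_map_circle, of m]]]) blast
  then obtain b where b: "\<And>m. b m > 0" "\<And>m z. z \<in> circle \<Longrightarrow> norm ((rot_deriv ^^ m) base_map z) \<le> b m"
    by metis
  show ?thesis
  proof (rule that[of "\<Sum>m\<le>k. b m"])
    show "(\<Sum>m\<le>k. b m) > 0" using b(1) by (intro sum_pos) auto
    fix m z assume "m \<le> k" "z \<in> circle"
    then have "norm ((rot_deriv ^^ m) base_map z) \<le> b m" "b m \<le> (\<Sum>m\<le>k. b m)"
      using b less_imp_le[OF b(1)] by (auto intro!: member_le_sum)
    then show "norm ((rot_deriv ^^ m) base_map z) \<le> (\<Sum>m\<le>k. b m)" by linarith
  qed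
qed

lemma circle_C_norm_twist_rot_comb_le:
  assumes B: "\<And>m z. m \<le> k + 2 \<Longrightarrow> z \<in> circle \<Longrightarrow> norm ((rot_deriv ^^ m) G z) \<le> B"
    and G: "G analytic_on circle"
    and f: "\<And>z. z \<in> circle \<Longrightarrow> f z = twist \<alpha> \<beta> (rot_comb c0 c1 c2 G) z"
  shows "circle_C_norm k f \<le> (norm c0 + norm c1 + norm c2) * B"
proof (rule circle_C_norm_le)
  fix j z assume j: "j \<le> k" and z: "z \<in> circle"
  define y where "y = cis (- \<alpha>) * z"
  have y: "y \<in> circle" unfolding y_def by (rule rotate_in_circle[OF z])
  have "norm ((circle_deriv ^^ j) f z) = norm (rot_comb c0 c1 c2 ((rot_deriv ^^ j) G) y)"
    by (subst circle_deriv_iter_twist_rot_comb[OF G z f]) (simp_all add: y_def)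
  also have "\<dots> \<le> norm (c0 * (rot_deriv ^^ j) G y) + norm (c1 * (rot_deriv ^^ (Suc j)) G y)
      + norm (c2 * (rot_deriv ^^ (Suc (Suc j))) G y)"
    unfolding rot_comb_def by (intro order_trans[OF norm_triangle_ineq] add_right_mono norm_triangle_ineq)
      (simp_all add: norm_triangle_ineq)
  also have "\<dots> \<le> norm c0 * B + norm c1 * B + norm c2 * B"
    unfolding norm_mult using j by (intro add_mono mult_left_mono B y) auto
  finally show "norm ((circle_deriv ^^ j) f z) \<le> (norm c0 + norm c1 + norm c2) * B"
    by (simp add: ring_distribs)
qed

text \<open>
  The sites take countably many values with measurable level sets, so the sigma-algebra of the
  target is irrelevant.
\<close>

lemma measurable_from_sites:
  assumes "\<And>m n. K m n \<in> space N"
  shows "(\<lambda>\<omega>. K (site i \<omega>) (site j \<omega>)) \<in> bernoulli \<rightarrow>\<^sub>M N"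
proof -
  have 1: "(\<lambda>\<omega>. K m (site j \<omega>)) \<in> bernoulli \<rightarrow>\<^sub>M N" for m
    by (rule measurable_compose[OF measurable_site]) (use assms in auto)
  show ?thesis by (rule measurable_compose_countable[OF 1 measurable_site])
qed

text \<open>
  The source rotation at \<open>\<omega>\<close> has angle \<open>\<epsilon> * 2 ^ site 0 \<omega>\<close>, and the target rotation is the source
  rotation at \<open>shift \<omega>\<close>. So the perturbed cocycle is conjugate to the constant one by random
  rotations.
\<close>

definition cocycle :: "(int \<Rightarrow> real) \<Rightarrow> real \<Rightarrow> complex \<Rightarrow> complex" where
  "cocycle \<omega> \<epsilon> = twist (\<epsilon> * 2 ^ site 0 \<omega>) (\<epsilon> * 2 ^ site 1 \<omega>) base_map"

lemma space_C_maps_borel: "space (C_maps_borel r I) = C_maps r I"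
  unfolding C_maps_borel_def by (simp add: space_measure_of_conv)

text \<open>The i-th parameter derivative costs a factor \<open>(a + b) ^ i\<close>, where \<open>a\<close> and \<open>b\<close> are the two amplitudes.\<close>

lemma cocycle_C_norm:
  assumes I: "param_interval I" and \<epsilon>: "\<epsilon> \<in> I" and r: "2 \<le> r"
    and B: "B > 0" "\<And>m z. m \<le> r + 2 \<Longrightarrow> z \<in> circle \<Longrightarrow> norm ((rot_deriv ^^ m) base_map z) \<le> B"
    and K: "K = 4 * B * (2 ^ site 0 \<omega> * 2 ^ site 1 \<omega>)\<^sup>2"
  shows "circle_C_norm r (cocycle \<omega> \<epsilon>) \<le> K"
    and "i \<in> {1, 2} \<Longrightarrow> circle_C_norm (r - i) ((param_deriv I ^^ i) (cocycle \<omega>) \<epsilon>) \<le> K"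
proof -
  define a b :: real where "a = 2 ^ site 0 \<omega>" and "b = 2 ^ site 1 \<omega>"
  have ab: "a \<ge> 1" "b \<ge> 1" by (simp_all add: a_def b_def)
  have "a * 1 \<le> a * b" "1 * b \<le> a * b" using ab by (auto intro!: mult_mono)
  then have sum_le: "a + b \<le> 2 * (a * b)" by simp
  then have "(a + b)\<^sup>2 \<le> (2 * (a * b))\<^sup>2" using ab by (intro power_mono) auto
  then have sq: "(a + b)\<^sup>2 * B \<le> K"
    using B(1) by (simp add: K a_def[symmetric] b_def[symmetric] power_mult_distrib mult_ac)
  have "(a + b) * 1 \<le> (a + b)\<^sup>2" unfolding power2_eq_square using ab by (intro mult_left_mono) auto
  then have "(a + b) * B \<le> (a + b)\<^sup>2 * B" using B(1) by (intro mult_right_mono) auto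
  with sq have first: "(a + b) * B \<le> K" by linarith
  have "1 * B \<le> (a + b) * B" using ab B(1) by (intro mult_right_mono) auto
  then have one: "B \<le> K" using first by simp
  have T0: "cocycle \<omega> e z = twist (e * a) (e * b) base_map z" for e z
    by (simp add: cocycle_def a_def b_def)
  have T1: "param_deriv I (cocycle \<omega>) e z = twist (e * a) (e * b) (rot_comb (\<i> * of_real b) (- of_real a) 0 base_map) z"
    if "e \<in> I" "z \<in> circle" for e z
    by (rule param_deriv_twist(2)[OF I analytic_base_map_circle T0 that])
  have T2: "param_deriv I (param_deriv I (cocycle \<omega>)) e z =
      twist (e * a) (e * b) (rot_comb (- of_real (b\<^sup>2)) (- 2 * \<i> * of_real (a * b)) (of_real (a\<^sup>2)) base_map) z"
    if "e \<in> I" "z \<in> circle" for e z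
  proof -
    have "param_deriv I (param_deriv I (cocycle \<omega>)) e z = twist (e * a) (e * b)
        (rot_comb (\<i> * of_real b) (- of_real a) 0 (rot_comb (\<i> * of_real b) (- of_real a) 0 base_map)) z"
      by (rule param_deriv_twist(2)[OF I analytic_rot_comb[OF analytic_base_map_circle] T1 that])
    moreover have "rot_comb (\<i> * of_real b) (- of_real a) 0 (rot_comb (\<i> * of_real b) (- of_real a) 0 base_map) y =
        rot_comb (- of_real (b\<^sup>2)) (- 2 * \<i> * of_real (a * b)) (of_real (a\<^sup>2)) base_map y" if "y \<in> circle" for y
    proof -
      have "rot_comb (\<i> * of_real b) (- of_real a) 0 (rot_comb (\<i> * of_real b) (- of_real a) 0 base_map) y =
          \<i> * of_real b * rot_comb (\<i> * of_real b) (- of_real a) 0 base_map y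
          - of_real a * rot_comb (\<i> * of_real b) (- of_real a) 0 (rot_deriv base_map) y"
        using rot_deriv_rot_comb[OF analytic_base_map_circle that, of "\<i> * of_real b" "- of_real a" 0]
        by (subst rot_comb_def) simp
      also have "\<dots> = rot_comb (- of_real (b\<^sup>2)) (- 2 * \<i> * of_real (a * b)) (of_real (a\<^sup>2)) base_map y"
        by (simp add: rot_comb_def power2_eq_square algebra_simps)
      finally show ?thesis .
    qed
    ultimately show ?thesis
      using rotate_in_circle[OF that(2)] by (simp add: twist_def)
  qed
  have "circle_C_norm r (cocycle \<omega> \<epsilon>) \<le> (norm (1::complex) + norm (0::complex) + norm (0::complex)) * B"
    by (rule circle_C_norm_twist_rot_comb_le[where G = base_map and \<alpha> = "\<epsilon> * a" and \<beta> = "\<epsilon> * b"])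
      (use B(2) in \<open>auto simp: T0 twist_def rot_comb_def analytic_base_map_circle\<close>)
  then show "circle_C_norm r (cocycle \<omega> \<epsilon>) \<le> K" using one by simp
  assume "i \<in> {1, 2}"
  then consider "i = 1" | "i = 2" by auto
  then show "circle_C_norm (r - i) ((param_deriv I ^^ i) (cocycle \<omega>) \<epsilon>) \<le> K"
  proof cases
    case 1
    have "circle_C_norm (r - 1) (param_deriv I (cocycle \<omega>) \<epsilon>) \<le>
        (norm (\<i> * of_real b) + norm (- complex_of_real a) + norm (0::complex)) * B"
      by (rule circle_C_norm_twist_rot_comb_le[where G = base_map])
        (use B(2) in \<open>auto intro!: T1[OF \<epsilon>] analytic_base_map_circle\<close>)
    also have "\<dots> = (a + b) * B" using ab by (simp add: norm_mult algebra_simps)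
    finally show ?thesis using 1 first by simp
  next
    case 2
    have "circle_C_norm (r - 2) (param_deriv I (param_deriv I (cocycle \<omega>)) \<epsilon>) \<le>
        (norm (- complex_of_real (b\<^sup>2)) + norm (- 2 * \<i> * complex_of_real (a * b)) + norm (complex_of_real (a\<^sup>2))) * B"
    proof (rule circle_C_norm_twist_rot_comb_le)
      show "norm ((rot_deriv ^^ m) base_map z) \<le> B" if "m \<le> r - 2 + 2" "z \<in> circle" for m z
        using B(2)[of m z] that by simp
      show "param_deriv I (param_deriv I (cocycle \<omega>)) \<epsilon> z = twist (\<epsilon> * a) (\<epsilon> * b)
          (rot_comb (- of_real (b\<^sup>2)) (- 2 * \<i> * of_real (a * b)) (of_real (a\<^sup>2)) base_map) z"
        if "z \<in> circle" for z by (rule T2[OF \<epsilon> that])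
    qed (rule analytic_base_map_circle)
    also have "norm (- complex_of_real (b\<^sup>2)) + norm (- 2 * \<i> * complex_of_real (a * b)) + norm (complex_of_real (a\<^sup>2)) = (a + b)\<^sup>2"
      using ab by (simp add: norm_mult norm_power power2_sum)
    finally show ?thesis using 2 sq by (simp add: numeral_2_eq_2)
  qed
qed

lemma min_expansion_cocycle: "min_expansion (cocycle \<omega> \<epsilon>) \<ge> 10 / 9"
  unfolding min_expansion_def
proof (rule cINF_greatest)
  have "(1::complex) \<in> circle" by simp
  then show "circle \<noteq> ({} :: complex set)" by blast
  fix z :: complex assume "z \<in> circle"
  from circle_map_deriv_twist_base_map[OF this]
  show "10 / 9 \<le> \<bar>circle_map_deriv (cocycle \<omega> \<epsilon>) z\<bar>" unfolding cocycle_def by (meson abs_ge_self order_trans)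
qed

lemma cocycle_expanding_on_average:
  assumes r: "4 \<le> r" and I: "param_interval I"
  shows "expanding_on_average_cocycle UNIV bernoulli shift I r cocycle"
  unfolding expanding_on_average_cocycle_def
proof (intro conjI driving_system_shift r I)
  show "cocycle \<in> bernoulli \<rightarrow>\<^sub>M C_maps_borel r I"
    unfolding cocycle_def[abs_def]
    by (rule measurable_from_sites[where K = "\<lambda>m n \<epsilon>. twist (\<epsilon> * 2 ^ m) (\<epsilon> * 2 ^ n) base_map"])
      (simp add: space_C_maps_borel twist_base_map_C_maps[OF I])
  obtain B where B: "B > 0" "\<And>m z. m \<le> r + 2 \<Longrightarrow> z \<in> circle \<Longrightarrow> norm ((rot_deriv ^^ m) base_map z) \<le> B"
    using base_map_bound[of "r + 2"] by metis
  define K where "K \<omega> = 4 * B * (2 ^ site 0 \<omega> * 2 ^ site 1 \<omega>)\<^sup>2" for \<omega>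
  have "positive_rv bernoulli K"
    unfolding positive_rv_def K_def[abs_def] using B(1)
    by (auto intro!: measurable_from_sites[where K = "\<lambda>m n. 4 * B * (2 ^ m * 2 ^ n)\<^sup>2"])
  moreover have "integrable bernoulli (\<lambda>\<omega>. ln (K \<omega>))"
  proof -
    have "(\<lambda>\<omega>. ln (K \<omega>)) = (\<lambda>\<omega>. ln (4 * B) + 2 * ln 2 * real (site 0 \<omega>) + 2 * ln 2 * real (site 1 \<omega>))"
      using B(1) by (auto simp: K_def ln_mult ln_realpow fun_eq_iff algebra_simps)
    then show ?thesis using integrable_site by simp
  qed
  moreover have "\<forall>\<epsilon>\<in>I. AE \<omega> in bernoulli. circle_C_norm r (cocycle \<omega> \<epsilon>) \<le> K \<omega> \<and>
           (\<forall>i\<in>{1, 2}. circle_C_norm (r - i) ((param_deriv I ^^ i) (cocycle \<omega>) \<epsilon>) \<le> K \<omega>)"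
  proof (intro ballI AE_I2 conjI)
    fix \<epsilon> \<omega> assume \<epsilon>: "\<epsilon> \<in> I"
    show "circle_C_norm r (cocycle \<omega> \<epsilon>) \<le> K \<omega>"
      by (rule cocycle_C_norm(1)[OF I \<epsilon> _ B(1) B(2) K_def]) (use r in auto)
    show "circle_C_norm (r - i) ((param_deriv I ^^ i) (cocycle \<omega>) \<epsilon>) \<le> K \<omega>" if "i \<in> {1, 2}" for i
      by (rule cocycle_C_norm(2)[OF I \<epsilon> _ B(1) B(2) K_def that]) (use r in auto)
  qed
  ultimately show "\<exists>K. positive_rv bernoulli K \<and> integrable bernoulli (\<lambda>\<omega>. ln (K \<omega>)) \<and>
        (\<forall>\<epsilon>\<in>I. AE \<omega> in bernoulli. circle_C_norm r (cocycle \<omega> \<epsilon>) \<le> K \<omega> \<and>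
           (\<forall>i\<in>{1, 2}. circle_C_norm (r - i) ((param_deriv I ^^ i) (cocycle \<omega>) \<epsilon>) \<le> K \<omega>))"
    by blast
  show "\<forall>\<epsilon>\<in>I. (\<lambda>\<omega>. min_expansion (cocycle \<omega> \<epsilon>)) \<in> borel_measurable bernoulli \<and>
             (\<lambda>\<omega>. distortion (cocycle \<omega> \<epsilon>)) \<in> borel_measurable bernoulli"
    unfolding cocycle_def
    by (intro ballI conjI
        measurable_from_sites[where K = "\<lambda>m n. min_expansion (twist (_ * 2 ^ m) (_ * 2 ^ n) base_map)"]
        measurable_from_sites[where K = "\<lambda>m n. distortion (twist (_ * 2 ^ m) (_ * 2 ^ n) base_map)"]) auto
  show "\<exists>\<Lambda>. positive_rv bernoulli \<Lambda> \<and>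
      (\<forall>\<epsilon>\<in>I. AE \<omega> in bernoulli. \<Lambda> \<omega> \<le> min_expansion (cocycle \<omega> \<epsilon>)) \<and>
      integrable bernoulli (\<lambda>\<omega>. ln (\<Lambda> \<omega>)) \<and> 0 < (\<integral>\<omega>. ln (\<Lambda> \<omega>) \<partial>bernoulli)"
  proof (intro exI[of _ "\<lambda>_. 10 / 9"] conjI ballI AE_I2 min_expansion_cocycle)
    show "0 < (\<integral>\<omega>. ln (10 / 9 :: real) \<partial>bernoulli)"
      using bernoulli_prob.prob_space by simp
  qed (auto simp: positive_rv_def)
qed


section \<open>Existence and uniqueness of the equivariant density\<close>

lemma space_W11_borel: "space W11_borel = W11"
  unfolding W11_borel_def by (rule space_measure_of) auto

text \<open>The functional is continuous for the \<open>L\<^sup>1\<close> norm, which is one of the two terms of the norm.\<close>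

lemma W11_borel_measurable_integral:
  fixes v :: "complex \<Rightarrow> complex"
  assumes v: "continuous_on circle v"
  shows "(\<lambda>f. \<integral>z. of_real (f z) * v z \<partial>circle_measure) \<in> borel_measurable W11_borel"
proof (rule borel_measurableI)
  let ?L = "\<lambda>f :: complex \<Rightarrow> real. \<integral>z. of_real (f z) * v z \<partial>circle_measure"
  fix S :: "complex set" assume S: "open S"
  let ?U = "?L -` S \<inter> space W11_borel"
  obtain B where B: "B > 0" "\<And>z. z \<in> circle \<Longrightarrow> norm (v z) \<le> B"
    using continuous_bounded_circle[OF v] by metis
  have "\<exists>e>0. \<forall>g\<in>W11. W11_norm (\<lambda>z. g z - f z) < e \<longrightarrow> g \<in> ?U" if f: "f \<in> ?U" for f
  proof -
    have "?L f \<in> S" using f by simp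
    from S[unfolded open_dist, rule_format, OF this]
    obtain d where d: "d > 0" "\<And>w. dist w (?L f) < d \<Longrightarrow> w \<in> S" by auto
    have "g \<in> ?U" if g: "g \<in> W11" and less: "W11_norm (\<lambda>z. g z - f z) < d / B" for g
    proof -
      have gf: "integrable circle_measure g" "integrable circle_measure f"
        using g \<open>f \<in> ?U\<close> by (auto simp: space_W11_borel W11_def)
      note i = integrable_on_circle_complex[OF gf(1) v] integrable_on_circle_complex[OF gf(2) v]
      have "?L g - ?L f = (\<integral>z. of_real (g z) * v z - of_real (f z) * v z \<partial>circle_measure)"
        by (rule Bochner_Integration.integral_diff[symmetric]) (rule i)+
      then have "norm (?L g - ?L f) = norm (\<integral>z. of_real (g z) * v z - of_real (f z) * v z \<partial>circle_measure)"
        by (rule arg_cong)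
      also have "\<dots> \<le> (\<integral>z. B * \<bar>g z - f z\<bar> \<partial>circle_measure)"
      proof (rule Bochner_Integration.integral_norm_bound_integral)
        show "integrable circle_measure (\<lambda>z. of_real (g z) * v z - of_real (f z) * v z)"
          by (rule Bochner_Integration.integrable_diff) (rule i)+
        show "integrable circle_measure (\<lambda>z. B * \<bar>g z - f z\<bar>)"
          using gf by auto
        fix z assume "z \<in> space circle_measure"
        then have "norm (v z) \<le> B" using B by simp
        moreover have "norm (of_real (g z) * v z - of_real (f z) * v z) = \<bar>g z - f z\<bar> * norm (v z)"
          by (simp only: left_diff_distrib[symmetric] of_real_diff[symmetric] norm_mult norm_of_real)
        ultimately show "norm (of_real (g z) * v z - of_real (f z) * v z) \<le> B * \<bar>g z - f z\<bar>"
          by (simp add: mult.commute[of B] mult_left_mono)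
      qed
      also have "\<dots> = B * (\<integral>z. \<bar>g z - f z\<bar> \<partial>circle_measure)" by simp
      also have "\<dots> \<le> B * W11_norm (\<lambda>z. g z - f z)"
        using B(1) by (intro mult_left_mono) (simp_all add: W11_norm_def)
      also have "\<dots> < d" using less B(1) by (simp add: field_simps)
      finally have "?L g \<in> S" by (intro d(2)) (simp add: dist_norm)
      then show ?thesis using g by (simp add: space_W11_borel)
    qed
    then show ?thesis using d(1) B(1) by (intro exI[of _ "d / B"]) auto
  qed
  then have "?U \<in> {U. U \<subseteq> W11 \<and> (\<forall>f\<in>U. \<exists>e>0. \<forall>g\<in>W11. W11_norm (\<lambda>z. g z - f z) < e \<longrightarrow> g \<in> U)}"
    by (auto simp: space_W11_borel)
  then show "?U \<in> sets W11_borel"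
    unfolding W11_borel_def by (subst sets_measure_of) (auto intro: sigma_sets.Basic)
qed

lemma is_transfer_complex:
  fixes \<phi> :: "complex \<Rightarrow> complex"
  assumes tr: "is_transfer g f u" and f: "integrable circle_measure f"
    and \<phi>: "continuous_on circle \<phi>" and \<phi>g: "continuous_on circle (\<lambda>z. \<phi> (g z))"
  shows "(\<integral>z. of_real (u z) * \<phi> z \<partial>circle_measure) = (\<integral>z. of_real (f z) * \<phi> (g z) \<partial>circle_measure)"
proof -
  have u: "integrable circle_measure u" using tr unfolding is_transfer_def by (rule conjunct1)
  have real: "(\<integral>z. u z * \<theta> z \<partial>circle_measure) = (\<integral>z. f z * \<theta> (g z) \<partial>circle_measure)"
    if \<theta>: "continuous_on circle \<theta>" for \<theta> :: "complex \<Rightarrow> real"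
  proof -
    obtain B where "\<And>z. z \<in> circle \<Longrightarrow> norm (\<theta> z) \<le> B"
      using continuous_bounded_circle[OF \<theta>] by metis
    then have "\<exists>B. \<forall>z\<in>circle. \<bar>\<theta> z\<bar> \<le> B" by (intro exI[of _ B]) simp
    then show ?thesis
      using tr[unfolded is_transfer_def, THEN conjunct2] continuous_measurable_circle[OF \<theta>] by blast
  qed
  have "continuous_on circle (\<lambda>z. Re (\<phi> z))" "continuous_on circle (\<lambda>z. Im (\<phi> z))"
    by (intro continuous_intros \<phi>)+
  note parts = this[THEN real]
  note i = integrable_on_circle_complex[OF u \<phi>] integrable_on_circle_complex[OF f \<phi>g]
  show ?thesis
  proof (rule complex_eqI)
    show "Re (\<integral>z. of_real (u z) * \<phi> z \<partial>circle_measure) = Re (\<integral>z. of_real (f z) * \<phi> (g z) \<partial>circle_measure)"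
      unfolding integral_Re[OF i(1), symmetric] integral_Re[OF i(2), symmetric] using parts(1) by simp
    show "Im (\<integral>z. of_real (u z) * \<phi> z \<partial>circle_measure) = Im (\<integral>z. of_real (f z) * \<phi> (g z) \<partial>circle_measure)"
      unfolding integral_Im[OF i(1), symmetric] integral_Im[OF i(2), symmetric] using parts(2) by simp
  qed
qed

definition density_family :: "real \<Rightarrow> (int \<Rightarrow> real) \<Rightarrow> complex \<Rightarrow> real" where
  "density_family \<epsilon> \<omega> = poisson (\<epsilon> * 2 ^ site 0 \<omega>)"

lemma poisson_in_W11: "poisson \<alpha> \<in> W11"
  unfolding poisson_eq_twist[abs_def]
  by (intro analytic_in_W11 bounded_linear_Re analytic_intros analytic_twist analytic_herglotz_circle)

lemma density_family_equivariant:
  "equivariant_density bernoulli shift (\<lambda>\<omega>. cocycle \<omega> \<epsilon>) (density_family \<epsilon>)"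
  unfolding equivariant_density_def
proof (intro conjI AE_I2)
  show "density_family \<epsilon> \<in> bernoulli \<rightarrow>\<^sub>M W11_borel"
    unfolding density_family_def[abs_def]
    by (rule measurable_from_sites[where K = "\<lambda>m n. poisson (\<epsilon> * 2 ^ m)"])
      (simp add: space_W11_borel poisson_in_W11)
  fix \<omega>
  show "0 \<le> density_family \<epsilon> \<omega> z" if "z \<in> space circle_measure" for z
    using poisson_pos[of z] that by (simp add: density_family_def less_imp_le)
  show "(\<integral>z. density_family \<epsilon> \<omega> z \<partial>circle_measure) = 1"
    unfolding density_family_def by (rule poisson_integral_1)
  show "is_transfer (cocycle \<omega> \<epsilon>) (density_family \<epsilon> \<omega>) (density_family \<epsilon> (shift \<omega>))"
    unfolding density_family_def cocycle_def site_translate by (simp add: poisson_is_transfer)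
qed

lemma continuous_straighten_power: "continuous_on circle (\<lambda>z. straighten \<alpha> z ^ n)"
  by (intro continuous_intros analytic_on_circle_continuous analytic_twist analytic_moebius_inv_circle)

text \<open>
  Let \<open>c n \<omega>\<close> be the moments of another solution in the straightened coordinate. Equivariance
  gives \<open>c n (shift \<omega>) = c (10 * n) \<omega>\<close>. Hence the random variables \<open>\<bar>c n\<bar>\<close> and \<open>\<bar>c (10 ^ k * n)\<bar>\<close>
  have the same expectation for all \<open>k\<close>. The latter tend to 0 pointwise and are bounded by 1, so
  \<open>c n = 0\<close> almost surely for all \<open>n > 0\<close>.
\<close>

lemma density_family_unique:
  assumes h': "equivariant_density bernoulli shift (\<lambda>\<omega>. cocycle \<omega> \<epsilon>) h'"
  shows "AE \<omega> in bernoulli. AE z in circle_measure. h' \<omega> z = density_family \<epsilon> \<omega> z"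
proof -
  define c where "c n \<omega> = (\<integral>z. of_real (h' \<omega> z) * straighten (\<epsilon> * 2 ^ site 0 \<omega>) z ^ n \<partial>circle_measure)" for n \<omega>
  have meas: "h' \<in> bernoulli \<rightarrow>\<^sub>M W11_borel"
    and h'AE: "AE \<omega> in bernoulli. (AE z in circle_measure. h' \<omega> z \<ge> 0) \<and> (\<integral>z. h' \<omega> z \<partial>circle_measure) = 1 \<and>
                 is_transfer (cocycle \<omega> \<epsilon>) (h' \<omega>) (h' (shift \<omega>))"
    using h' unfolding equivariant_density_def by auto
  have W: "h' \<omega> \<in> W11" for \<omega>
    using measurable_space[OF meas, of \<omega>] by (simp add: space_W11_borel)
  then have hi: "integrable circle_measure (h' \<omega>)" for \<omega> by (auto simp: W11_def)
  have [measurable]: "c n \<in> borel_measurable bernoulli" for n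
    unfolding c_def[abs_def]
    by (rule measurable_compose_countable[OF measurable_compose[OF meas
        W11_borel_measurable_integral[OF continuous_straighten_power]] measurable_site])
  have step: "AE \<omega> in bernoulli. \<forall>n. c n (shift \<omega>) = c (10 * n) \<omega>"
    using h'AE
  proof eventually_elim
    case (elim \<omega>)
    define \<alpha> \<beta> where "\<alpha> = \<epsilon> * 2 ^ site 0 \<omega>" and "\<beta> = \<epsilon> * 2 ^ site 1 \<omega>"
    have T: "cocycle \<omega> \<epsilon> = twist \<alpha> \<beta> base_map" by (simp add: cocycle_def \<alpha>_def \<beta>_def fun_eq_iff)
    have pow: "straighten \<beta> (cocycle \<omega> \<epsilon> z) ^ n = straighten \<alpha> z ^ (10 * n)" if "z \<in> circle" for z n
      unfolding T straighten_base_map[OF that] by (simp add: power_mult)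
    have "c n (shift \<omega>) = c (10 * n) \<omega>" for n
    proof -
      have "c n (shift \<omega>) = (\<integral>z. of_real (h' (shift \<omega>) z) * straighten \<beta> z ^ n \<partial>circle_measure)"
        by (simp add: c_def site_translate \<beta>_def)
      also have "\<dots> = (\<integral>z. of_real (h' \<omega> z) * straighten \<beta> (cocycle \<omega> \<epsilon> z) ^ n \<partial>circle_measure)"
      proof (rule is_transfer_complex[where \<phi> = "\<lambda>z. straighten \<beta> z ^ n"])
        show "continuous_on circle (\<lambda>z. straighten \<beta> (cocycle \<omega> \<epsilon> z) ^ n)"
          by (rule continuous_on_cong[THEN iffD2, OF refl pow continuous_straighten_power])
      qed (use elim hi continuous_straighten_power in auto)
      also have "\<dots> = c (10 * n) \<omega>"
        unfolding c_def \<alpha>_def[symmetric]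
        by (rule Bochner_Integration.integral_cong) (simp_all only: space_circle_measure pow)
      finally show ?thesis .
    qed
    then show ?case by blast
  qed
  have orbit: "AE \<omega> in bernoulli. \<forall>k n. c n (translate (int k) \<omega>) = c (10 ^ k * n) \<omega>"
  proof -
    have "AE \<omega> in bernoulli. \<forall>n. c n (shift (translate (int k) \<omega>)) = c (10 * n) (translate (int k) \<omega>)" for k
      by (rule AE_distrD[OF measurable_translate[of "int k"]]) (simp only: distr_translate step)
    then have "AE \<omega> in bernoulli. \<forall>k n. c n (shift (translate (int k) \<omega>)) = c (10 * n) (translate (int k) \<omega>)"
      by (simp add: AE_all_countable)
    then show ?thesis
    proof eventually_elim
      case (elim \<omega>)
      have "c n (translate (int k) \<omega>) = c (10 ^ k * n) \<omega>" for k n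
      proof (induction k arbitrary: n)
        case (Suc k)
        have "c n (translate (int (Suc k)) \<omega>) = c n (shift (translate (int k) \<omega>))"
          by (simp add: translate_translate)
        also have "\<dots> = c (10 * n) (translate (int k) \<omega>)" using elim by blast
        also have "\<dots> = c (10 ^ k * (10 * n)) \<omega>" by (rule Suc.IH)
        finally show ?case by (simp add: mult_ac)
      qed simp
      then show ?case by blast
    qed
  qed
  have bound: "AE \<omega> in bernoulli. \<forall>n. norm (c n \<omega>) \<le> 1"
    using h'AE
  proof eventually_elim
    case (elim \<omega>)
    have "norm (c n \<omega>) \<le> 1" for n
    proof -
      have "norm (c n \<omega>) \<le> (\<integral>z. norm (of_real (h' \<omega> z) * straighten (\<epsilon> * 2 ^ site 0 \<omega>) z ^ n) \<partial>circle_measure)"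
        unfolding c_def by (rule integral_norm_bound)
      also have "\<dots> = (\<integral>z. h' \<omega> z \<partial>circle_measure)"
      proof (rule integral_cong_AE)
        have "AE z in circle_measure. h' \<omega> z \<ge> 0" using elim by blast
        moreover have "AE z in circle_measure. z \<in> circle" by (rule AE_I2) simp
        ultimately show "AE z in circle_measure.
            norm (of_real (h' \<omega> z) * straighten (\<epsilon> * 2 ^ site 0 \<omega>) z ^ n) = h' \<omega> z"
        proof eventually_elim
          case (elim z)
          then have "norm (straighten (\<epsilon> * 2 ^ site 0 \<omega>) z) = 1"
            using straighten_in_circle by simp
          then show ?case using elim by (simp add: norm_mult norm_power del: norm_twist)
        qed
      qed (use hi integrable_on_circle_complex[OF hi continuous_straighten_power] in \<open>auto intro!: borel_measurable_norm borel_measurable_integrable simp del: norm_twist\<close>)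
      also have "\<dots> = 1" using elim by blast
      finally show ?thesis .
    qed
    then show ?case by blast
  qed
  have zero: "AE \<omega> in bernoulli. c n \<omega> = 0" if n: "n > 0" for n
  proof -
    have lim: "(\<lambda>k. \<integral>\<omega>. norm (c (10 ^ k * n) \<omega>) \<partial>bernoulli) \<longlonglongrightarrow> (\<integral>\<omega>. 0 \<partial>bernoulli)"
    proof (rule integral_dominated_convergence[where w = "\<lambda>_. 1"])
      have "(\<lambda>k. norm (c (10 ^ k * n) \<omega>)) \<longlonglongrightarrow> 0" for \<omega>
      proof (rule tendsto_norm_zero)
        have "(\<lambda>m. c m \<omega>) \<longlonglongrightarrow> 0" unfolding c_def by (rule straighten_coeff_tendsto_0[OF W])
        moreover have "filterlim (\<lambda>k. 10 ^ k * n) at_top sequentially"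
        proof (rule filterlim_at_top_mono[OF filterlim_ident])
          have "k \<le> 10 ^ k * n" for k
          proof -
            have "k \<le> 10 ^ k" by (rule less_imp_le[OF power_gt_expt]) simp
            also have "\<dots> \<le> 10 ^ k * n" using n by simp
            finally show ?thesis .
          qed
          then show "\<forall>\<^sub>F k in sequentially. k \<le> 10 ^ k * n" by simp
        qed
        ultimately show "(\<lambda>k. c (10 ^ k * n) \<omega>) \<longlonglongrightarrow> 0"
          by (rule filterlim_compose)
      qed
      then show "AE \<omega> in bernoulli. (\<lambda>k. norm (c (10 ^ k * n) \<omega>)) \<longlonglongrightarrow> 0" by simp
      show "AE \<omega> in bernoulli. norm (norm (c (10 ^ k * n) \<omega>)) \<le> 1" for k
        using bound by eventually_elim simp
    qed auto
    have "(\<integral>\<omega>. norm (c (10 ^ k * n) \<omega>) \<partial>bernoulli) = (\<integral>\<omega>. norm (c n \<omega>) \<partial>bernoulli)" for k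
    proof -
      have "(\<integral>\<omega>. norm (c (10 ^ k * n) \<omega>) \<partial>bernoulli) = (\<integral>\<omega>. norm (c n (translate (int k) \<omega>)) \<partial>bernoulli)"
      proof (rule integral_cong_AE)
        show "AE \<omega> in bernoulli. norm (c (10 ^ k * n) \<omega>) = norm (c n (translate (int k) \<omega>))"
          using orbit by eventually_elim simp
      qed measurable
      also have "\<dots> = (\<integral>\<omega>. norm (c n \<omega>) \<partial>distr bernoulli bernoulli (translate (int k)))"
        by (rule integral_distr[symmetric]) measurable
      finally show ?thesis by (simp only: distr_translate)
    qed
    with lim have eq0: "(\<integral>\<omega>. norm (c n \<omega>) \<partial>bernoulli) = 0"
      by (simp add: LIMSEQ_const_iff)
    have int: "integrable bernoulli (\<lambda>\<omega>. norm (c n \<omega>))"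
    proof (rule bernoulli_prob.integrable_const_bound[of _ 1])
      show "AE \<omega> in bernoulli. norm (norm (c n \<omega>)) \<le> 1" using bound by eventually_elim simp
    qed measurable
    have "AE \<omega> in bernoulli. norm (c n \<omega>) = 0"
      by (rule integral_nonneg_eq_0_iff_AE[OF int, THEN iffD1, OF _ eq0]) simp
    then show ?thesis by simp
  qed
  then have "AE \<omega> in bernoulli. \<forall>n. n > 0 \<longrightarrow> c n \<omega> = 0"
    by (simp add: AE_all_countable)
  with h'AE show ?thesis
  proof eventually_elim
    case (elim \<omega>)
    then show ?case
      unfolding density_family_def using hi
      by (intro poisson_AE_unique) (auto simp: c_def)
  qed
qed


section \<open>Linear response\<close>

lemma norm_diff_le_derivative_bound:
  fixes u :: "real \<Rightarrow> complex"
  assumes u: "\<And>s. (u has_vector_derivative u' s) (at s)"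
    and B: "\<And>s. \<bar>s\<bar> \<le> \<bar>t\<bar> \<Longrightarrow> norm (u' s) \<le> B"
  shows "norm (u t - u 0) \<le> B * \<bar>t\<bar>"
proof -
  have "norm (u t - u 0) \<le> B * norm (t - 0)"
  proof (rule differentiable_bound[where f' = "\<lambda>s h. h *\<^sub>R u' s"])
    fix s assume "s \<in> closed_segment 0 t"
    then have "\<bar>s\<bar> \<le> \<bar>t\<bar>" by (auto simp: closed_segment_eq_real_ivl split: if_splits)
    then show "onorm (\<lambda>h. h *\<^sub>R u' s) \<le> B"
      using B[of s] by (intro onorm_le) (simp add: mult.commute[of B] mult_left_mono)
    show "(u has_derivative (\<lambda>h. h *\<^sub>R u' s)) (at s within closed_segment 0 t)"
      using u[of s] by (simp add: has_vector_derivative_def has_derivative_at_withinI)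
  qed auto
  then show ?thesis by simp
qed

text \<open>The mean value inequality applied twice; the missing factor 1/2 is immaterial.\<close>

lemma rotation_taylor:
  assumes G: "G analytic_on circle" and z: "z \<in> circle"
    and B: "\<And>z. z \<in> circle \<Longrightarrow> norm (rot_deriv (rot_deriv G) z) \<le> B"
  shows "norm (G (z * cis t) - G z - of_real t * rot_deriv G z) \<le> B * t\<^sup>2"
proof -
  have G': "rot_deriv G analytic_on circle" by (rule analytic_rot_deriv[OF G])
  have inner: "norm (rot_deriv G (z * cis s) - rot_deriv G z) \<le> B * \<bar>s\<bar>" for s
  proof -
    have "norm (rot_deriv G (z * cis s) - rot_deriv G (z * cis 0)) \<le> B * \<bar>s\<bar>"
      by (rule norm_diff_le_derivative_bound[OF has_vector_derivative_rotate[OF G' z]])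
        (rule B[OF mult_cis_in_circle[OF z]])
    then show ?thesis by simp
  qed
  have "B \<ge> 0" using order_trans[OF norm_ge_zero B[OF z]] .
  have "norm ((G (z * cis t) - of_real t * rot_deriv G z) - (G (z * cis 0) - of_real 0 * rot_deriv G z)) \<le> (B * \<bar>t\<bar>) * \<bar>t\<bar>"
  proof (rule norm_diff_le_derivative_bound[where u' = "\<lambda>s. rot_deriv G (z * cis s) - rot_deriv G z"
        and u = "\<lambda>s. G (z * cis s) - of_real s * rot_deriv G z"])
    fix s :: real
    have "((\<lambda>s. of_real s * rot_deriv G z) has_vector_derivative 1 * rot_deriv G z) (at s)"
      by (intro has_vector_derivative_mult_left has_vector_derivative_of_real)
        (auto intro!: derivative_eq_intros simp: has_real_derivative_iff_has_vector_derivative[symmetric])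
    from has_vector_derivative_diff[OF has_vector_derivative_rotate[OF G z] this]
    show "((\<lambda>s. G (z * cis s) - of_real s * rot_deriv G z) has_vector_derivative
        rot_deriv G (z * cis s) - rot_deriv G z) (at s)" by simp
    assume "\<bar>s\<bar> \<le> \<bar>t\<bar>"
    then show "norm (rot_deriv G (z * cis s) - rot_deriv G z) \<le> B * \<bar>t\<bar>"
      using inner[of s] mult_left_mono[OF _ \<open>B \<ge> 0\<close>] order_trans by blast
  qed
  then show ?thesis by (simp add: power2_eq_square mult.assoc algebra_simps)
qed

text \<open>
  For \<open>G = herglotz\<close> the real part is the error of the difference quotient of the densities.
  The definition commutes with \<open>rot_deriv\<close>, so one estimate serves for the error and its derivative.
\<close>

definition remainder :: "real \<Rightarrow> real \<Rightarrow> (complex \<Rightarrow> complex) \<Rightarrow> complex \<Rightarrow> complex" where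
  "remainder a \<epsilon> G z = of_real (1 / (2 * pi)) *
    (of_real (1 / \<epsilon>) * (twist (\<epsilon> * a) 0 G z - G z) + of_real a * rot_deriv G z)"

lemma analytic_remainder: "G analytic_on circle \<Longrightarrow> remainder a \<epsilon> G analytic_on circle"
  unfolding remainder_def[abs_def]
  by (intro analytic_intros analytic_twist)

lemma rot_deriv_remainder:
  assumes G: "G analytic_on circle" and z: "z \<in> circle"
  shows "rot_deriv (remainder a \<epsilon> G) z = remainder a \<epsilon> (rot_deriv G) z"
proof -
  have "(remainder a \<epsilon> G has_field_derivative of_real (1 / (2 * pi)) *
      (of_real (1 / \<epsilon>) * (deriv (twist (\<epsilon> * a) 0 G) z - deriv G z) + of_real a * deriv (rot_deriv G) z)) (at z)"
    unfolding remainder_def[abs_def]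
    by (intro DERIV_add DERIV_diff DERIV_cmult DERIV_circle analytic_twist analytic_rot_deriv G z)
  from rot_deriv_eqI[OF this]
  have "rot_deriv (remainder a \<epsilon> G) z = of_real (1 / (2 * pi)) *
      (of_real (1 / \<epsilon>) * (rot_deriv (twist (\<epsilon> * a) 0 G) z - rot_deriv G z) + of_real a * rot_deriv (rot_deriv G) z)"
    by (simp only: rot_deriv_def[of "twist (\<epsilon> * a) 0 G"] rot_deriv_def[of "rot_deriv G"] rot_deriv_def[of G])
      (simp add: algebra_simps)
  then show ?thesis by (simp only: rot_deriv_twist[OF G z] remainder_def)
qed

lemma norm_remainder_le:
  assumes G: "G analytic_on circle" and z: "z \<in> circle" and \<epsilon>: "\<epsilon> \<noteq> 0"
    and B: "\<And>z. z \<in> circle \<Longrightarrow> norm (rot_deriv (rot_deriv G) z) \<le> B"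
  shows "norm (remainder a \<epsilon> G z) \<le> B * a\<^sup>2 * \<bar>\<epsilon>\<bar> / (2 * pi)"
proof -
  let ?d = "G (z * cis (- (\<epsilon> * a))) - G z - of_real (- (\<epsilon> * a)) * rot_deriv G z"
  have rescale: "of_real (1 / \<epsilon>) * of_real (\<epsilon> * a) = (of_real a :: complex)"
    using \<epsilon> by simp
  have "c * (e * (w - g) + e * o' * D) = c * e * (w - g - (- o') * D)" for c e w g o' D :: complex
    by (simp add: algebra_simps)
  from this[of _ "of_real (1 / \<epsilon>)" _ _ "of_real (\<epsilon> * a)"]
  have "remainder a \<epsilon> G z = of_real (1 / (2 * pi)) * of_real (1 / \<epsilon>) * ?d"
    unfolding rescale by (simp only: remainder_def twist_def cis_zero mult_1 mult.commute[of z] of_real_minus)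
  then have "norm (remainder a \<epsilon> G z) = 1 / (2 * pi) * (1 / \<bar>\<epsilon>\<bar>) * norm ?d"
    by (simp only: norm_mult norm_of_real) (simp add: abs_mult)
  also have "\<dots> \<le> 1 / (2 * pi) * (1 / \<bar>\<epsilon>\<bar>) * (B * (- (\<epsilon> * a))\<^sup>2)"
    by (intro mult_left_mono rotation_taylor[OF G z B]) auto
  also have "\<dots> = B * a\<^sup>2 * \<bar>\<epsilon>\<bar> / (2 * pi)"
  proof -
    have "(- (\<epsilon> * a))\<^sup>2 = \<bar>\<epsilon>\<bar> * \<bar>\<epsilon>\<bar> * a\<^sup>2" by (simp add: power2_eq_square)
    moreover have "1 / (2 * pi) * (1 / e) * (B * (e * e * q)) = B * q * e / (2 * pi)" if "e \<noteq> 0" for e q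
      using that by simp
    ultimately show ?thesis using \<epsilon> by (simp only: abs_eq_0 not_False_eq_True)
  qed
  finally show ?thesis .
qed

text \<open>The \<open>\<epsilon>\<close>-derivative of \<open>poisson (\<epsilon> * a)\<close> at 0, with the amplitude \<open>a = 2 ^ site 0 \<omega>\<close>.\<close>

definition response :: "(int \<Rightarrow> real) \<Rightarrow> complex \<Rightarrow> real" where
  "response \<omega> z = - (2 ^ site 0 \<omega>) * Re (rot_deriv herglotz z) / (2 * pi)"

lemma response_measurable: "response \<in> bernoulli \<rightarrow>\<^sub>M W11_borel"
proof -
  have "(\<lambda>z. - (2 ^ m) * Re (rot_deriv herglotz z) / (2 * pi)) \<in> W11" for m
  proof -
    have "(\<lambda>z. Re (of_real (- (2 ^ m) / (2 * pi)) * rot_deriv herglotz z)) \<in> W11"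
      by (intro analytic_in_W11 bounded_linear_Re analytic_intros analytic_herglotz_circle)
    then show ?thesis by simp
  qed
  then show ?thesis
    unfolding response_def[abs_def]
    by (intro measurable_from_sites[where K = "\<lambda>m n z. - (2 ^ m) * Re (rot_deriv herglotz z) / (2 * pi)"])
      (simp add: space_W11_borel)
qed

lemma herglotz_bound:
  obtains B where "B > 0" "\<And>z. z \<in> circle \<Longrightarrow> norm ((rot_deriv ^^ n) herglotz z) \<le> B"
  by (rule continuous_bounded_circle[OF analytic_on_circle_continuous[OF
      analytic_rot_deriv_iter[OF analytic_herglotz_circle, of n]]]) blast

lemma response_estimate:
  obtains B where "B > 0" and "\<And>\<epsilon> \<omega>. \<epsilon> \<noteq> 0 \<Longrightarrow>
    W11_norm (\<lambda>z. 1 / \<epsilon> * (density_family \<epsilon> \<omega> z - density_family 0 \<omega> z) - response \<omega> z)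
      \<le> B * (2 ^ site 0 \<omega>)\<^sup>2 * \<bar>\<epsilon>\<bar>"
proof -
  obtain B2 where B2: "B2 > 0" "\<And>z. z \<in> circle \<Longrightarrow> norm ((rot_deriv ^^ 2) herglotz z) \<le> B2"
    using herglotz_bound[of 2] by metis
  obtain B3 where B3: "B3 > 0" "\<And>z. z \<in> circle \<Longrightarrow> norm ((rot_deriv ^^ 3) herglotz z) \<le> B3"
    using herglotz_bound[of 3] by metis
  show ?thesis
  proof (rule that[of "B2 + B3"])
    show "B2 + B3 > 0" using B2 B3 by simp
    fix \<epsilon> :: real and \<omega> assume \<epsilon>: "\<epsilon> \<noteq> 0"
    define a :: real where "a = 2 ^ site 0 \<omega>"
    note W = analytic_herglotz_circle
    have eq: "(\<lambda>z. 1 / \<epsilon> * (density_family \<epsilon> \<omega> z - density_family 0 \<omega> z) - response \<omega> z) =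
        (\<lambda>z. Re (remainder a \<epsilon> herglotz z))"
    proof
      fix z
      define p x y d where "p = 1 / (2 * pi)" and "x = Re (herglotz (cis (- (\<epsilon> * a)) * z))"
        and "y = Re (herglotz z)" and "d = Re (rot_deriv herglotz z)"
      have "density_family \<epsilon> \<omega> z = x * p" "density_family 0 \<omega> z = y * p" "response \<omega> z = - a * d * p"
        by (simp_all add: density_family_def response_def poisson_def a_def p_def x_def y_def d_def)
      moreover have "Re (remainder a \<epsilon> herglotz z) = p * (1 / \<epsilon> * (x - y) + a * d)"
        unfolding remainder_def twist_def cis_zero mult_1 p_def x_def y_def d_def
        by (simp only: times_complex.sel plus_complex.sel minus_complex.sel Re_complex_of_real
            Im_complex_of_real mult_zero_left diff_zero)
      ultimately show "1 / \<epsilon> * (density_family \<epsilon> \<omega> z - density_family 0 \<omega> z) - response \<omega> z =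
          Re (remainder a \<epsilon> herglotz z)"
        by (simp add: algebra_simps diff_divide_distrib)
    qed
    have 2: "\<bar>Re (remainder a \<epsilon> herglotz z)\<bar> \<le> B2 * a\<^sup>2 * \<bar>\<epsilon>\<bar> / (2 * pi)" if "z \<in> circle" for z
      by (rule order_trans[OF abs_Re_le_cmod norm_remainder_le[OF W that \<epsilon>]])
        (use B2(2) in \<open>simp add: numeral_2_eq_2\<close>)
    have 3: "\<bar>Re (rot_deriv (remainder a \<epsilon> herglotz) z)\<bar> \<le> B3 * a\<^sup>2 * \<bar>\<epsilon>\<bar> / (2 * pi)" if "z \<in> circle" for z
      unfolding rot_deriv_remainder[OF W that]
      by (rule order_trans[OF abs_Re_le_cmod norm_remainder_le[OF analytic_rot_deriv[OF W] that \<epsilon>]])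
        (use B3(2) in \<open>simp add: numeral_3_eq_3\<close>)
    have "W11_norm (\<lambda>z. Re (remainder a \<epsilon> herglotz z)) \<le>
        2 * pi * (B2 * a\<^sup>2 * \<bar>\<epsilon>\<bar> / (2 * pi) + B3 * a\<^sup>2 * \<bar>\<epsilon>\<bar> / (2 * pi))"
      by (rule W11_norm_analytic_le[OF analytic_remainder[OF W] 2 3])
    also have "\<dots> = (B2 + B3) * a\<^sup>2 * \<bar>\<epsilon>\<bar>" by (simp add: field_simps)
    finally show "W11_norm (\<lambda>z. 1 / \<epsilon> * (density_family \<epsilon> \<omega> z - density_family 0 \<omega> z) - response \<omega> z)
        \<le> (B2 + B3) * (2 ^ site 0 \<omega>)\<^sup>2 * \<bar>\<epsilon>\<bar>" unfolding eq a_def .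
  qed
qed

text \<open>The logarithm along an orbit is affine in the sites, which grow sublinearly in both directions of time.\<close>

lemma tempered_exp_site:
  assumes B: "B > 0"
  shows "tempered bernoulli shift (\<lambda>\<omega>. B * (2 ^ site 0 \<omega>)\<^sup>2)"
  unfolding tempered_def
proof (intro conjI)
  show "positive_rv bernoulli (\<lambda>\<omega>. B * (2 ^ site 0 \<omega>)\<^sup>2)"
    unfolding positive_rv_def using B
    by (auto intro!: measurable_from_sites[where K = "\<lambda>m n. B * (2 ^ m)\<^sup>2"])
  have ln_eq: "ln (B * (2 ^ k)\<^sup>2) = ln B + 2 * ln 2 * real k" for k :: nat
    using B by (simp add: ln_mult ln_realpow)
  have lim: "(\<lambda>n. ln B * (1 / real n) + 2 * ln 2 * (real (x n) / real n)) \<longlonglongrightarrow> 0"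
    if x: "(\<lambda>n. real (x n) / real n) \<longlonglongrightarrow> 0" for x :: "nat \<Rightarrow> nat"
  proof -
    have "(\<lambda>n. ln B * (1 / real n) + 2 * ln 2 * (real (x n) / real n)) \<longlonglongrightarrow> ln B * 0 + 2 * ln 2 * 0"
      by (intro tendsto_intros x lim_const_over_n)
    then show ?thesis by simp
  qed
  show "AE \<omega> in bernoulli.
     (\<lambda>n. 1 / real n * ln (B * (2 ^ site 0 ((shift ^^ n) \<omega>))\<^sup>2)) \<longlonglongrightarrow> 0 \<and>
     (\<lambda>n. 1 / (- real n) * ln (B * (2 ^ site 0 ((inv_into (space bernoulli) shift ^^ n) \<omega>))\<^sup>2)) \<longlonglongrightarrow> 0"
    using site_sublinear[of int] site_sublinear[of "\<lambda>n. - int n"]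
  proof eventually_elim
    case (elim \<omega>)
    have "(\<lambda>n. 1 / real n * ln (B * (2 ^ site 0 ((shift ^^ n) \<omega>))\<^sup>2)) =
        (\<lambda>n. ln B * (1 / real n) + 2 * ln 2 * (real (site (int n) \<omega>) / real n))"
      by (simp add: fun_eq_iff shift_funpow site_translate ln_eq add_divide_distrib)
    moreover have "(\<lambda>n. 1 / (- real n) * ln (B * (2 ^ site 0 ((inv_into (space bernoulli) shift ^^ n) \<omega>))\<^sup>2)) =
        (\<lambda>n. - (ln B * (1 / real n) + 2 * ln 2 * (real (site (- int n) \<omega>) / real n)))"
      by (simp add: fun_eq_iff inv_shift shift_funpow site_translate ln_eq add_divide_distrib)
    ultimately show ?case
      using lim[OF elim(1)] tendsto_minus[OF lim[OF elim(2)]] by simp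
  qed
qed

text \<open>
  After integration by parts this is the amplitude times the mean of \<open>Re\<close> under \<open>poisson 0\<close>, which
  is the real part of the base point 1/2.
\<close>

lemma integral_Im_response: "(\<integral>z. Im z * response \<omega> z \<partial>circle_measure) = 2 ^ site 0 \<omega> / 2"
proof -
  have id: "(\<lambda>z. z) analytic_on S" for S :: "complex set" by (rule analytic_on_ident)
  have "rot_deriv (\<lambda>z. z) z = \<i> * z" for z by (simp add: rot_deriv_def)
  then have d: "circle_deriv Im z = Re z" if "z \<in> circle" for z
    using circle_deriv_analytic(1)[OF bounded_linear_Im id refl that] by simp
  have parts: "(\<integral>z. Re (herglotz z) * circle_deriv Im z \<partial>circle_measure) =
      - (\<integral>z. Re (rot_deriv herglotz z) * Im z \<partial>circle_measure)"
    using is_weak_deriv_analytic[OF bounded_linear_Re analytic_herglotz_circle]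
      smooth_on_circle_analytic[OF bounded_linear_Im id] unfolding is_weak_deriv_def by blast
  have centre: "(\<integral>z. Re (of_real (poisson 0 z) * z) \<partial>circle_measure) = 1 / 2"
  proof -
    have "integrable circle_measure (\<lambda>z. of_real (poisson 0 z) * z)"
      by (intro integrable_on_circle_complex integrable_poisson continuous_intros)
    from integral_Re[OF this] show ?thesis using poisson_integral[OF id, of 0] by simp
  qed
  have "(\<integral>z. Re (herglotz z) * circle_deriv Im z \<partial>circle_measure) =
      (\<integral>z. 2 * pi * Re (of_real (poisson 0 z) * z) \<partial>circle_measure)"
    by (rule Bochner_Integration.integral_cong) (simp_all add: d poisson_def)
  also have "\<dots> = 2 * pi * (1 / 2)"
    unfolding centre[symmetric] by (rule integral_mult_right_zero)
  finally have *: "(\<integral>z. Re (rot_deriv herglotz z) * Im z \<partial>circle_measure) = - pi"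
    using parts by linarith
  have "(\<integral>z. Im z * response \<omega> z \<partial>circle_measure) =
      (\<integral>z. - (2 ^ site 0 \<omega>) / (2 * pi) * (Re (rot_deriv herglotz z) * Im z) \<partial>circle_measure)"
    by (rule Bochner_Integration.integral_cong) (simp_all add: response_def)
  also have "\<dots> = - (2 ^ site 0 \<omega>) / (2 * pi) * (- pi)"
    unfolding *[symmetric] by (rule integral_mult_right_zero)
  finally show ?thesis by simp
qed

lemma response_integral_infinite:
  "integral_is_infinity bernoulli (\<lambda>\<omega>. \<integral>z. Im z * response \<omega> z \<partial>circle_measure)"
  unfolding integral_Im_response integral_is_infinity_def
proof (intro conjI)
  show "(\<lambda>\<omega>. 2 ^ site 0 \<omega> / 2 :: real) \<in> borel_measurable bernoulli"
    by (rule measurable_from_sites[where K = "\<lambda>m n. 2 ^ m / 2"]) simp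
  have "(\<integral>\<^sup>+\<omega>. ennreal (- (2 ^ site 0 \<omega> / 2)) \<partial>bernoulli) = (\<integral>\<^sup>+\<omega>. 0 \<partial>bernoulli)"
    by (rule nn_integral_cong) (simp add: ennreal_neg)
  then show "(\<integral>\<^sup>+\<omega>. ennreal (- (2 ^ site 0 \<omega> / 2)) \<partial>bernoulli) < \<infinity>" by simp
  have [measurable]: "(\<lambda>\<omega>. 2 ^ site 0 \<omega> :: real) \<in> borel_measurable bernoulli"
    by (rule measurable_from_sites[where K = "\<lambda>m n. 2 ^ m"]) simp
  have "(\<integral>\<^sup>+\<omega>. ennreal (2 ^ site 0 \<omega> / 2) \<partial>bernoulli) = (\<integral>\<^sup>+\<omega>. ennreal (1 / 2) * ennreal (2 ^ site 0 \<omega>) \<partial>bernoulli)"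
    by (rule nn_integral_cong) (subst ennreal_mult[symmetric], auto)
  also have "\<dots> = ennreal (1 / 2) * (\<integral>\<^sup>+\<omega>. ennreal (2 ^ site 0 \<omega>) \<partial>bernoulli)"
    by (rule nn_integral_cmult) measurable
  also have "\<dots> = \<infinity>"
    unfolding nn_integral_exp_site by (simp add: ennreal_mult_top)
  finally show "(\<integral>\<^sup>+\<omega>. ennreal (2 ^ site 0 \<omega> / 2) \<partial>bernoulli) = \<infinity>" .
qed

theorem mainTheorem4:
  fixes r :: nat and I :: "real set"
  assumes "4 \<le> r" and "param_interval I"
  shows "\<exists>(\<Omega> :: (int \<Rightarrow> real) set) (P :: (int \<Rightarrow> real) measure) (\<sigma> :: (int \<Rightarrow> real) \<Rightarrow> (int \<Rightarrow> real))
      (T :: (int \<Rightarrow> real) \<Rightarrow> real \<Rightarrow> complex \<Rightarrow> complex) (\<psi> :: complex \<Rightarrow> real)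
      (h :: real \<Rightarrow> (int \<Rightarrow> real) \<Rightarrow> complex \<Rightarrow> real) (hhat :: (int \<Rightarrow> real) \<Rightarrow> complex \<Rightarrow> real).
    expanding_on_average_cocycle \<Omega> P \<sigma> I r T \<and>
    smooth_on_circle \<psi> \<and>
    (\<forall>\<epsilon>\<in>I. unique_equivariant_density P \<sigma> (\<lambda>\<omega>. T \<omega> \<epsilon>) (h \<epsilon>)) \<and>
    hhat \<in> P \<rightarrow>\<^sub>M W11_borel \<and>
    (\<forall>\<epsilon> :: nat \<Rightarrow> real. (\<forall>k. \<epsilon> k \<in> I - {0}) \<and> \<epsilon> \<longlonglongrightarrow> 0 \<longrightarrow>
       (\<exists>s>0. \<exists>K. tempered P \<sigma> K \<and>
          (AE \<omega> in P. \<forall>k.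
             W11_norm (\<lambda>z. 1 / \<epsilon> k * (h (\<epsilon> k) \<omega> z - h 0 \<omega> z) - hhat \<omega> z)
               \<le> K \<omega> * \<bar>\<epsilon> k\<bar> powr s))) \<and>
    (AE \<omega> in P. integrable circle_measure (\<lambda>z. \<psi> z * hhat \<omega> z)) \<and>
    integral_is_infinity P (\<lambda>\<omega>. \<integral>z. \<psi> z * hhat \<omega> z \<partial>circle_measure)"
proof (rule exI[of _ UNIV], rule exI[of _ bernoulli], rule exI[of _ shift], rule exI[of _ cocycle],
    rule exI[of _ Im], rule exI[of _ density_family], rule exI[of _ response], intro conjI)
  show "expanding_on_average_cocycle UNIV bernoulli shift I r cocycle"
    by (rule cocycle_expanding_on_average[OF assms])
  show "smooth_on_circle Im"
    using smooth_on_circle_analytic[OF bounded_linear_Im analytic_on_ident] by simp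
  show "\<forall>\<epsilon>\<in>I. unique_equivariant_density bernoulli shift (\<lambda>\<omega>. cocycle \<omega> \<epsilon>) (density_family \<epsilon>)"
    unfolding unique_equivariant_density_def
    using density_family_equivariant density_family_unique by blast
  show "response \<in> bernoulli \<rightarrow>\<^sub>M W11_borel" by (rule response_measurable)
  obtain B where B: "B > 0" "\<And>\<epsilon> \<omega>. \<epsilon> \<noteq> 0 \<Longrightarrow>
    W11_norm (\<lambda>z. 1 / \<epsilon> * (density_family \<epsilon> \<omega> z - density_family 0 \<omega> z) - response \<omega> z)
      \<le> B * (2 ^ site 0 \<omega>)\<^sup>2 * \<bar>\<epsilon>\<bar>"
    using response_estimate by metis
  show "\<forall>\<epsilon> :: nat \<Rightarrow> real. (\<forall>k. \<epsilon> k \<in> I - {0}) \<and> \<epsilon> \<longlonglongrightarrow> 0 \<longrightarrow>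
       (\<exists>s>0. \<exists>K. tempered bernoulli shift K \<and>
          (AE \<omega> in bernoulli. \<forall>k.
             W11_norm (\<lambda>z. 1 / \<epsilon> k * (density_family (\<epsilon> k) \<omega> z - density_family 0 \<omega> z) - response \<omega> z)
               \<le> K \<omega> * \<bar>\<epsilon> k\<bar> powr s))"
  proof (intro allI impI)
    fix \<epsilon> :: "nat \<Rightarrow> real" assume "(\<forall>k. \<epsilon> k \<in> I - {0}) \<and> \<epsilon> \<longlonglongrightarrow> 0"
    then have "\<epsilon> k \<noteq> 0" for k by blast
    then show "\<exists>s>0. \<exists>K. tempered bernoulli shift K \<and>
          (AE \<omega> in bernoulli. \<forall>k.
             W11_norm (\<lambda>z. 1 / \<epsilon> k * (density_family (\<epsilon> k) \<omega> z - density_family 0 \<omega> z) - response \<omega> z)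
               \<le> K \<omega> * \<bar>\<epsilon> k\<bar> powr s)"
      using B(2) tempered_exp_site[OF B(1)]
      by (intro exI[of _ "1::real"] exI[of _ "\<lambda>\<omega>. B * (2 ^ site 0 \<omega>)\<^sup>2"] conjI AE_I2) auto
  qed
  show "AE \<omega> in bernoulli. integrable circle_measure (\<lambda>z. Im z * response \<omega> z)"
  proof (rule AE_I2)
    fix \<omega>
    show "integrable circle_measure (\<lambda>z. Im z * response \<omega> z)"
      unfolding response_def
      by (intro integrable_continuous_circle continuous_intros analytic_on_circle_continuous
          analytic_rot_deriv analytic_herglotz_circle) simp
  qed
  show "integral_is_infinity bernoulli (\<lambda>\<omega>. \<integral>z. Im z * response \<omega> z \<partial>circle_measure)"
    by (rule response_integral_infinite)
qed

end
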